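(* Let $\varepsilon>0$, $\delta>0$, $\kappa>0$, where $\delta$ and $\kappa$ may depend on $\varepsilon$, and let $(v_\varepsilon,\varphi_\varepsilon)$ be a minimizer of $G_{\varepsilon,\delta,\kappa}$ in $\mathcal I$ with $v_\varepsilon\ge0$. Then: (a) If $\kappa$ is bounded and $\delta$ is fixed, then for $\varepsilon>0$ small there exists $C>0$ independent of all parameters such that $\|v_\varepsilon-1\|_{L^\infty((0,1))}=o_\varepsilon(\varepsilon)$, $$\varphi_\varepsilon(1)=2\kappa\frac{\varepsilon}{\sqrt\delta}(1+o_\varepsilon(1)),\qquad \|\varphi_\varepsilon\|_{L^\infty((0,1))}\le C\kappa\frac{\varepsilon}{\sqrt\delta},$$ $$G_{\varepsilon,\delta,\kappa}(v_\varepsilon,\varphi_\varepsilon)=-\frac{\kappa^2\varepsilon}{2\sqrt\delta}(1+o_\varepsilon(1)).$$ Moreover, if $\Phi_\varepsilon(x)=\frac{\sqrt\delta}{2\kappa\varepsilon}\varphi_\varepsilon\left(1-\frac{\varepsilon x}{\sqrt\delta}\right)$, then $\Phi_\varepsilon\to e^{-x}$ in $\mathcal C^1_{loc}([0,+\infty))$. (b) If $\kappa=\frac{\tilde\kappa\sqrt\delta}{\varepsilon}$ with $\tilde\kappa<\frac1\pi$ independent of $\varepsilon$, $\delta=o_\varepsilon(\varepsilon)$ and $\varepsilon^2=o_\varepsilon(\delta)$, then $\|1-v_\varepsilon\|_{L^\infty((0,1))}=o_\varepsilon(\delta^{1/4})$, $\varphi_\varepsilon(1)=\arcsin(2\tilde\kappa)(1+o_\varepsilon(1))$,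 $$G_{\varepsilon,\delta,\kappa}(v_\varepsilon,\varphi_\varepsilon)=\frac{\sqrt\delta}{\varepsilon}\left(\frac{1-\sqrt{1-4\tilde\kappa^2}}{4}-\frac{\tilde\kappa}{2}\arcsin(2\tilde\kappa)\right)(1+o_\varepsilon(1)),$$ and $\|\varphi_\varepsilon\|_{L^\infty((0,1))}\le\arcsin(2\tilde\kappa)(1+o_\varepsilon(1))$. Setting $\psi_\varepsilon(x)=\varphi_\varepsilon\left(1-\frac{\varepsilon x}{\sqrt\delta}\right)$, we have $\psi_\varepsilon\to\psi_0$ in $\mathcal C^1_{loc}([0,+\infty))$ with $\psi_0(x)=2\arctan\left[\tan\left(\frac{\arcsin(2\tilde\kappa)}{2}\right)e^{-x}\right]$. (c) If $\kappa=\frac{\tilde\kappa\sqrt\delta}{\varepsilon}$ with $\tilde\kappa>\frac1\pi$ independent of $\varepsilon$, $\varepsilon^2=o_\varepsilon(\delta)$ and $\delta=o_\varepsilon(\varepsilon)$, then $\|v_\varepsilon-1\|_{L^\infty((0,1))}\le C\sqrt{\delta/\varepsilon}$ for some constant $C$ and $$G_{\varepsilon,\delta,\kappa}(v_\varepsilon,\varphi_\varepsilon)=-\frac{\tilde\alpha_0^2\delta}{8\varepsilon^2}(1+o_\varepsilon(1)),$$ where $\tilde\alpha_0$ is the unique number in $(0,2\tilde\kappa]$ with $\int_0^{\pi/2}\sqrt{\tilde\alpha_0^2+\sin^2y}\,dy=\tilde\kappa\pi$. Letting $\tilde\varphi_\varepsilon(x):=\varphi_\varepsilon\left(\frac{\varepsilon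 x}{\sqrt\delta}\right)$ on $[0,\frac{\sqrt\delta}{\varepsilon}]$, if moreover $\delta=O_\varepsilon(\varepsilon^{3/2})$ then $\tilde\varphi_\varepsilon$ converges in $\mathcal C^1_{loc}(\mathbb R^+)$ to the solution $\varphi_0$ of $\varphi_0''=\sin\varphi_0\cos\varphi_0$ in $\mathbb R^+$, $\varphi_0(0)=0$, $\varphi_0'(0)=\tilde\alpha_0$.
   Context: For $\varepsilon,\delta,\kappa>0$ and suitable $(v,\varphi)$ on $(0,1)$ let $$G_{\varepsilon,\delta,\kappa}(v,\varphi)=\frac12\int_0^1v'^2+\frac{1}{4\varepsilon^2}\int_0^1(1-v^2)^2+\frac18\int_0^1v^2\varphi'^2+\frac{\delta}{8\varepsilon^2}\int_0^1v^4\sin^2\varphi-\frac\kappa2\int_0^1v^2\varphi'.$$ Let $\mathcal S(v)=\{x\in[0,1]:v(x)=0\}$. The admissible class $\mathcal I$ consists of pairs $(v,\varphi)$ with $v\in H^1((0,1))$, $\varphi$ of class $H^1$ on $(0,1)\setminus\mathcal S(v)$, $\varphi(0)=0$ and $\int_0^1v^2=1$; on $\mathcal S(v)$ the quantities $v^2\varphi'^2$, $v^2\varphi'$ and $v^4\sin^2\varphi$ are set equal to $0$. The notations $o_\varepsilon$, $O_\varepsilon$ refer to the limit $\varepsilon\to0$. *)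

theory Defs
  imports "HOL-Analysis.Analysis" "HOL-Library.Landau_Symbols"
begin

definition test_fun :: "real set \<Rightarrow> (nat \<Rightarrow> real \<Rightarrow> real) \<Rightarrow> bool" where
  "test_fun U D \<longleftrightarrow>
     (\<forall>k x. (D k has_real_derivative D (Suc k) x) (at x)) \<and>
     compact (closure {x. D 0 x \<noteq> 0}) \<and> closure {x. D 0 x \<noteq> 0} \<subseteq> U"

definition L2_on :: "real set \<Rightarrow> (real \<Rightarrow> real) \<Rightarrow> bool" where
  "L2_on U f \<longleftrightarrow> set_borel_measurable lebesgue U f \<and>
                  set_integrable lebesgue U (\<lambda>x. (f x)\<^sup>2)"

definition H1_on :: "real set \<Rightarrow> (real \<Rightarrow> real) \<Rightarrow> (real \<Rightarrow> real) \<Rightarrow> bool" where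
  "H1_on U f g \<longleftrightarrow> L2_on U f \<and> L2_on U g \<and>
     (\<forall>D. test_fun U D \<longrightarrow>
        (LINT x:U|lebesgue. f x * D 1 x) = - (LINT x:U|lebesgue. g x * D 0 x))"

text \<open>The weak derivative (unique almost everywhere).\<close>
definition wderiv :: "real set \<Rightarrow> (real \<Rightarrow> real) \<Rightarrow> real \<Rightarrow> real" where
  "wderiv U f = (SOME g. H1_on U f g)"

definition zero_set :: "(real \<Rightarrow> real) \<Rightarrow> real set" where
  "zero_set v = {x\<in>{0..1}. v x = 0}"

definition good_set :: "(real \<Rightarrow> real) \<Rightarrow> real set" where
  "good_set v = {0<..<1} - zero_set v"

text \<open>Continuous representatives are used: v is continuous on [0,1] and \<phi> is continuous on
  [0,1] minus the zero set of v; the condition \<phi>(0) = 0 is thus a trace condition.\<close>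
definition admissible :: "(real \<Rightarrow> real) \<Rightarrow> (real \<Rightarrow> real) \<Rightarrow> bool" where
  "admissible v \<phi> \<longleftrightarrow>
     continuous_on {0..1} v \<and> (\<exists>g. H1_on {0<..<1} v g) \<and>
     continuous_on ({0..1} - zero_set v) \<phi> \<and> (\<exists>g. H1_on (good_set v) \<phi> g) \<and>
     \<phi> 0 = 0 \<and> (LINT x:{0<..<1}|lebesgue. (v x)\<^sup>2) = 1"

text \<open>G_{\<epsilon>,\<delta>,\<kappa>}; the terms involving \<phi> are integrated over (0,1) minus the zero set of v,
  i.e. they are set to 0 on the zero set.\<close>
definition G :: "real \<Rightarrow> real \<Rightarrow> real \<Rightarrow> (real \<Rightarrow> real) \<Rightarrow> (real \<Rightarrow> real) \<Rightarrow> real" where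
  "G \<epsilon> \<delta> \<kappa> v \<phi> =
     (let dv = wderiv {0<..<1} v; d\<phi> = wderiv (good_set v) \<phi>; U = good_set v in
       1/2 * (LINT x:{0<..<1}|lebesgue. (dv x)\<^sup>2)
     + 1/(4*\<epsilon>\<^sup>2) * (LINT x:{0<..<1}|lebesgue. (1 - (v x)\<^sup>2)\<^sup>2)
     + 1/8 * (LINT x:U|lebesgue. (v x)\<^sup>2 * (d\<phi> x)\<^sup>2)
     + \<delta>/(8*\<epsilon>\<^sup>2) * (LINT x:U|lebesgue. (v x)^4 * (sin (\<phi> x))\<^sup>2)
     - \<kappa>/2 * (LINT x:U|lebesgue. (v x)\<^sup>2 * d\<phi> x))"

definition is_minimizer :: "real \<Rightarrow> real \<Rightarrow> real \<Rightarrow> (real \<Rightarrow> real) \<Rightarrow> (real \<Rightarrow> real) \<Rightarrow> bool" where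
  "is_minimizer \<epsilon> \<delta> \<kappa> v \<phi> \<longleftrightarrow> admissible v \<phi> \<and>
     (\<forall>w \<psi>. admissible w \<psi> \<longrightarrow> G \<epsilon> \<delta> \<kappa> v \<phi> \<le> G \<epsilon> \<delta> \<kappa> w \<psi>)"

definition minimizer_family ::
  "(real \<Rightarrow> real) \<Rightarrow> (real \<Rightarrow> real) \<Rightarrow> (real \<Rightarrow> real \<Rightarrow> real) \<Rightarrow> (real \<Rightarrow> real \<Rightarrow> real) \<Rightarrow> bool" where
  "minimizer_family \<delta> \<kappa> v \<phi> \<longleftrightarrow>
     (\<forall>\<epsilon>>0. \<delta> \<epsilon> > 0 \<and> \<kappa> \<epsilon> > 0 \<and> is_minimizer \<epsilon> (\<delta> \<epsilon>) (\<kappa> \<epsilon>) (v \<epsilon>) (\<phi> \<epsilon>) \<and>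
             (\<forall>x\<in>{0..1}. v \<epsilon> x \<ge> 0))"

definition asymp_eq :: "'a filter \<Rightarrow> ('a \<Rightarrow> real) \<Rightarrow> ('a \<Rightarrow> real) \<Rightarrow> bool" where
  "asymp_eq F f g \<longleftrightarrow> (\<exists>h. (h \<longlongrightarrow> 0) F \<and> eventually (\<lambda>e. f e = g e * (1 + h e)) F)"

definition C1_loc_conv :: "(real \<Rightarrow> real \<Rightarrow> real) \<Rightarrow> (real \<Rightarrow> real) \<Rightarrow> real filter \<Rightarrow> bool" where
  "C1_loc_conv f g F \<longleftrightarrow>
     (\<forall>T>0. \<exists>Df Dg.
        (\<forall>x\<in>{0..T}. (g has_real_derivative Dg x) (at x within {0..T})) \<and>
        eventually (\<lambda>e. \<forall>x\<in>{0..T}. (f e has_real_derivative Df e x) (at x within {0..T})) F \<and>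
        uniform_limit {0..T} f g F \<and> uniform_limit {0..T} Df Dg F)"

definition ode_sol :: "real \<Rightarrow> (real \<Rightarrow> real) \<Rightarrow> bool" where
  "ode_sol \<alpha> f \<longleftrightarrow> (\<exists>f'. f 0 = 0 \<and> f' 0 = \<alpha> \<and>
     (\<forall>x\<ge>0. (f has_real_derivative f' x) (at x within {0..}) \<and>
             (f' has_real_derivative sin (f x) * cos (f x)) (at x within {0..})))"

end

theory Submission
  imports Defs "HOL-Real_Asymp.Real_Asymp"
begin

text \<open>Comparison with the pair \<^term>\<open>(1, 0)\<close> bounds the well energy of \<^term>\<open>v\<close> by
  \<open>\<kappa>\<^sup>2 / 2\<close>, and a Hoelder estimate turns this into \<open>(v - 1)\<^sup>2 \<le> 12 \<epsilon> E\<close> with \<open>E\<close> the well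
  energy, so \<open>v\<close> has no zeros and the phase satisfies an Euler-Lagrange equation
  \<open>\<phi>' = 2 \<kappa> - M / v\<^sup>2\<close>, \<open>M' = - \<sigma>\<^sup>2 v\<^sup>4 sin \<phi> cos \<phi>\<close>, \<open>M 1 = 0\<close> with \<open>\<sigma> = sqrt \<delta> / \<epsilon>\<close>.
  The cross term \<open>\<kappa> (v\<^sup>2 - 1) \<phi>'\<close> is absorbed with relative error \<open>\<kappa> \<epsilon>\<close>, which reduces the energy
  to the case \<open>v = 1\<close>. There \<open>\<phi>'\<^sup>2 + \<sigma>\<^sup>2 sin\<^sup>2 \<phi> \<ge> 2 \<sigma> \<bar>sin \<phi>\<bar> \<bar>\<phi>'\<bar>\<close> (cases (a), (b)), respectively the
  square completion with \<open>r = sqrt (\<alpha>\<^sup>2 + sin\<^sup>2 \<phi>)\<close> (case (c)), gives sharp lower bounds that are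
  matched by explicit profiles. The resulting energy gap controls \<open>v - 1\<close> and the boundary values,
  and Gronwall's inequality for the Euler-Lagrange system gives the local \<open>C\<^sup>1\<close> convergence.\<close>

section \<open>Smooth cut-off functions\<close>

text \<open>Only the phase is varied, with \<open>v\<close> frozen, so the mass constraint produces
  no multiplier and \<open>v\<close> enters the equations merely as a coefficient close to 1. Since
  \<open>v\<close> is only H1, \<open>\<phi>'\<close> need not be differentiable, but the flux
  \<open>M = v\<^sup>2 * (2 * \<kappa> - \<phi>')\<close> is; hence the Euler-Lagrange equation is a
  first-order system in \<open>\<phi>\<close> and \<open>M\<close>. At the free end 1 the condition
  \<open>M 1 = 0\<close> gives the slope outright, so the profiles in (a) and (b) need only the
  limit of \<open>\<phi> 1\<close>, which the energy supplies. At the left end in (c) the slope is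
  unknown and has to be extracted from the energy itself; the growth condition on \<delta> there
  keeps the error caused by \<open>v\<close> below the size of the quantity to be read off. Weak
  derivatives are defined by testing against smooth functions, so cut-offs are built first: they
  turn weak derivatives into the fundamental theorem of calculus, on which the Hoelder estimate and
  the first variation rest.\<close>

primrec n_differentiable :: "nat \<Rightarrow> (real \<Rightarrow> real) \<Rightarrow> bool" where
  "n_differentiable 0 f = True"
| "n_differentiable (Suc n) f = (\<exists>f'. (\<forall>x. (f has_real_derivative f' x) (at x)) \<and> n_differentiable n f')"

lemma n_differentiable_Suc_imp: "n_differentiable (Suc n) f \<Longrightarrow> n_differentiable n f"
proof (induction n arbitrary: f)
  case 0
  then show ?case by simp
next
  case (Suc n)
  then show ?case by (metis n_differentiable.simps(2))
qed

lemma n_differentiable_add: "n_differentiable n f \<Longrightarrow> n_differentiable n g \<Longrightarrow> n_differentiable n (\<lambda>x. f x + g x)"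
proof (induction n arbitrary: f g)
  case (Suc n)
  then obtain f' g' where "\<forall>x. (f has_real_derivative f' x) (at x)" "n_differentiable n f'"
    "\<forall>x. (g has_real_derivative g' x) (at x)" "n_differentiable n g'" by auto
  then show ?case
    using Suc.IH[of f' g'] by (auto intro!: exI[of _ "\<lambda>x. f' x + g' x"] derivative_eq_intros)
qed simp

lemma n_differentiable_mult: "n_differentiable n f \<Longrightarrow> n_differentiable n g \<Longrightarrow> n_differentiable n (\<lambda>x. f x * g x)"
proof (induction n arbitrary: f g)
  case (Suc n)
  from Suc.prems obtain f' g' where *: "\<forall>x. (f has_real_derivative f' x) (at x)" "n_differentiable n f'"
    "\<forall>x. (g has_real_derivative g' x) (at x)" "n_differentiable n g'" by auto
  have "n_differentiable n f" "n_differentiable n g" using Suc.prems n_differentiable_Suc_imp by blast+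
  then have "n_differentiable n (\<lambda>x. f' x * g x + f x * g' x)"
    using Suc.IH * by (intro n_differentiable_add) auto
  then show ?case using *
    by (auto intro!: exI[of _ "\<lambda>x. f' x * g x + f x * g' x"] derivative_eq_intros)
qed simp

lemma n_differentiable_const: "n_differentiable n (\<lambda>x. c)"
proof (induction n arbitrary: c)
  case (Suc n)
  then show ?case by (auto intro!: exI[of _ "\<lambda>x. 0"])
qed simp

lemma n_differentiable_affine: "n_differentiable n f \<Longrightarrow> n_differentiable n (\<lambda>x. f (a * x + b))"
proof (induction n arbitrary: f)
  case (Suc n)
  from Suc.prems obtain f' where *: "\<forall>x. (f has_real_derivative f' x) (at x)" "n_differentiable n f'" by auto
  have "((\<lambda>x. f (a * x + b)) has_real_derivative a * f' (a * x + b)) (at x)" for x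
    by (rule DERIV_cong[OF DERIV_chain2[OF *(1)[rule_format], of "\<lambda>x. a * x + b" a x UNIV]])
       (auto intro!: derivative_eq_intros)
  moreover have "n_differentiable n (\<lambda>x. a * f' (a * x + b))"
    using n_differentiable_mult[OF n_differentiable_const Suc.IH[OF *(2)]] by simp
  ultimately show ?case by (auto intro!: exI[of _ "\<lambda>x. a * f' (a * x + b)"])
qed simp

text \<open>Derivatives are unique, so the witnesses hidden in \<open>n_differentiable\<close> for
  different \<open>n\<close> are all \<open>deriv f\<close>, and the iterates of
  \<open>deriv\<close> form the sequence that \<open>test_fun\<close> asks for.\<close>

lemma n_differentiable_derivs:
  assumes "\<And>n. n_differentiable n f"
  shows "\<exists>D. D 0 = f \<and> (\<forall>k x. (D k has_real_derivative D (Suc k) x) (at x))"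
proof -
  have step: "(\<forall>x. (g has_real_derivative deriv g x) (at x)) \<and> (\<forall>n. n_differentiable n (deriv g))"
    if "\<And>n. n_differentiable n g" for g
  proof -
    have "\<exists>g'. (\<forall>x. (g has_real_derivative g' x) (at x)) \<and> n_differentiable n g'" for n
      using that[of "Suc n"] by simp
    then show ?thesis by (metis DERIV_deriv_iff_has_field_derivative DERIV_imp_deriv ext)
  qed
  have "\<forall>n. n_differentiable n ((deriv ^^ k) f)" for k
    by (induction k) (use assms step in auto)
  then show ?thesis
    using step by (intro exI[of _ "\<lambda>k. (deriv ^^ k) f"]) auto
qed

text \<open>The derivatives of the flat function \<^term>\<open>\<lambda>x. exp (- 1 / x)\<close> (extended by 0) are all of
  this form.\<close>

definition flat :: "real poly \<Rightarrow> real \<Rightarrow> real" where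
  "flat p x = (if x \<le> 0 then 0 else poly p (1 / x) * exp (- 1 / x))"

lemma poly_exp_tendsto_0: "((\<lambda>u. poly p u * exp (- u)) \<longlongrightarrow> 0) (at_top :: real filter)"
proof -
  have "((\<lambda>u. \<Sum>i\<le>degree p. coeff p i * (u ^ i / exp u)) \<longlongrightarrow> (\<Sum>i\<le>degree p. coeff p i * 0)) at_top"
    by (intro tendsto_intros tendsto_power_div_exp_0)
  then show ?thesis
    by (simp add: poly_altdef sum_distrib_right exp_minus divide_inverse mult.assoc)
qed

lemma flat_at_0: "(flat p \<longlongrightarrow> 0) (at 0)"
proof -
  have "((\<lambda>x::real. poly p (inverse x) * exp (- inverse x)) \<longlongrightarrow> 0) (at_right 0)"
    using filterlim_compose[OF poly_exp_tendsto_0 filterlim_inverse_at_top_right] .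
  then have "(flat p \<longlongrightarrow> 0) (at_right 0)"
    by (rule Lim_transform_eventually)
       (auto simp: flat_def eventually_at_right_field inverse_eq_divide intro!: exI[of _ 1])
  moreover have "(flat p \<longlongrightarrow> 0) (at_left 0)"
    by (rule Lim_transform_eventually[OF tendsto_const])
       (auto simp: flat_def eventually_at_left_field intro!: exI[of _ "-1"])
  ultimately show ?thesis by (simp add: filterlim_at_split)
qed

text \<open>With \<open>u = 1 / x\<close> the derivative of \<open>p u * exp (- u)\<close> is
  \<open>u\<^sup>2 * (p u - p' u) * exp (- u)\<close>, so the class is closed under differentiation;
  \<open>[:0,0,1:]\<close> stands for \<open>u\<^sup>2\<close>.\<close>

lemma flat_deriv: "(flat p has_real_derivative flat ([:0,0,1:] * (p - pderiv p)) x) (at x)"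
proof (cases x "0::real" rule: linorder_cases)
  case less
  have "((\<lambda>x. 0) has_real_derivative 0) (at x)" by simp
  then have "(flat p has_real_derivative 0) (at x)"
    by (rule has_field_derivative_transform_within_open[of _ _ _ "{..<0}"])
       (use less in \<open>auto simp: flat_def\<close>)
  then show ?thesis using less by (simp add: flat_def)
next
  case greater
  have "((\<lambda>x. poly p (1 / x) * exp (- 1 / x)) has_real_derivative
     (poly [:0,0,1:] (1/x) * (poly p (1/x) - poly (pderiv p) (1/x))) * exp (- 1 / x)) (at x)"
    using greater
    by (auto intro!: derivative_eq_intros DERIV_chain2[OF poly_DERIV]
        simp: field_simps power2_eq_square)
  then have "(flat p has_real_derivative
     (poly [:0,0,1:] (1/x) * (poly p (1/x) - poly (pderiv p) (1/x))) * exp (- 1 / x)) (at x)"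
    by (rule has_field_derivative_transform_within_open[of _ _ _ "{0<..}"])
       (use greater in \<open>auto simp: flat_def\<close>)
  then show ?thesis using greater by (simp add: flat_def algebra_simps)
next
  case equal
  \<comment> \<open>At 0 the difference quotient is again flat: dividing by \<open>h\<close>
    multiplies \<open>p\<close> by \<open>u\<close>.\<close>
  have "(\<lambda>h. (flat p (0 + h) - flat p 0) / h) \<midarrow>0\<rightarrow> 0"
    by (rule Lim_transform_eventually[OF flat_at_0[of "[:0,1:] * p"]])
       (auto simp: flat_def eventually_at_filter field_simps)
  then show ?thesis using equal by (simp add: DERIV_def flat_def)
qed

lemma n_differentiable_flat: "n_differentiable n (flat p)"
proof (induction n arbitrary: p)
  case (Suc n)
  show ?case unfolding n_differentiable.simps
    by (rule exI[of _ "flat ([:0,0,1:] * (p - pderiv p))"]) (use flat_deriv Suc in blast)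
qed simp

lemma antiderivative_UNIV:
  fixes f :: "real \<Rightarrow> real"
  assumes "continuous_on UNIV f"
  obtains F where "F 0 = 0" "\<And>x. (F has_real_derivative f x) (at x)"
proof (rule that[of "\<lambda>x. (LBINT y=0..x. f y)"])
  show "(LBINT y=0..(0::real). f y) = 0" by (simp add: zero_ereal_def)
  fix x :: real
  define a where "a = min x 0 - 1"
  define b where "b = max x 0 + 1"
  have "((\<lambda>u. LBINT y=0..u. f y) has_vector_derivative f x) (at x within {a..b})"
    using interval_integral_FTC2[of a 0 b f x] continuous_on_subset[OF assms] 
    by (auto simp: a_def b_def zero_ereal_def)
  then show "((\<lambda>x. LBINT y=0..x. f y) has_real_derivative f x) (at x)"
    unfolding has_real_derivative_iff_has_vector_derivative
    by (subst (asm) at_within_interior) (auto simp: a_def b_def)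
qed

text \<open>\<open>h\<close> is the normalised primitive of the bump
  \<open>flat 1 x * flat 1 (1 - x)\<close>. Its derivative \<open>\<rho>\<close> is exported too,
  because it serves as a mollifier kernel of mass 1 on {0..1}.\<close>

lemma smooth_step:
  obtains h \<rho> :: "real \<Rightarrow> real" where "\<And>n. n_differentiable n h"
    "\<And>x. (h has_real_derivative \<rho> x) (at x)" "\<And>x. 0 \<le> \<rho> x"
    "\<And>x. x \<le> 0 \<Longrightarrow> h x = 0" "\<And>x. x \<ge> 1 \<Longrightarrow> h x = 1" "\<And>x. 0 \<le> h x" "\<And>x. h x \<le> 1"
    "continuous_on UNIV \<rho>" "\<And>x. x \<le> 0 \<or> x \<ge> 1 \<Longrightarrow> \<rho> x = 0"
proof -
  define r where "r = (\<lambda>x. flat 1 x * flat 1 (1 - x))"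
  have sm: "n_differentiable n r" for n
    unfolding r_def using n_differentiable_mult[OF n_differentiable_flat n_differentiable_affine[OF n_differentiable_flat, of n _ "-1" 1]]
    by simp
  have cont: "continuous_on UNIV r"
  proof -
    obtain r' where "\<forall>x. (r has_real_derivative r' x) (at x)" using sm[of "Suc 0"] by auto
    then show ?thesis by (meson DERIV_continuous_on)
  qed
  obtain H where H: "H 0 = 0" "\<And>x. (H has_real_derivative r x) (at x)"
    by (rule antiderivative_UNIV[OF cont]) blast
  have nn: "r x \<ge> 0" for x by (auto simp: r_def flat_def)
  have z: "r x = 0" if "x \<le> 0 \<or> x \<ge> 1" for x using that by (auto simp: r_def flat_def)
  have mono: "H x \<le> H y" if "x \<le> y" for x y
    using DERIV_nonneg_imp_nondecreasing[OF that] H(2) nn by blast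
  have contH: "continuous_on A H" for A
    by (rule DERIV_continuous_on[OF has_field_derivative_at_within[OF H(2)]])
  have H0: "H x = 0" if "x \<le> 0" for x
  proof (cases "x < 0")
    case True
    have "(H has_real_derivative 0) (at y)" if "y < 0" for y
      using H(2)[of y] z[of y] that by simp
    then have "H 0 = H x"
      by (intro DERIV_isconst_end[OF True contH]) auto
    then show ?thesis using H by simp
  qed (use that H in simp)
  have H1: "H x = H 1" if "x \<ge> 1" for x
  proof (cases "x > 1")
    case True
    have "(H has_real_derivative 0) (at y)" if "y > 1" for y
      using H(2)[of y] z[of y] that by simp
    then show ?thesis
      by (intro DERIV_isconst_end[OF True contH]) auto
  qed (use that in simp)
  have "0 < r y" if "0 < y" "y < 1" for y
    using that by (simp add: r_def flat_def)
  then have "\<exists>y. (H has_real_derivative y) (at x) \<and> 0 < y" if "0 < x" "x < 1" for x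
    using H(2) that by blast
  then have "H 0 < H 1"
    by (rule DERIV_pos_imp_increasing_open[OF zero_less_one]) (auto intro: contH)
  then have pos: "H 1 > 0" using H by simp
  define h where "h = (\<lambda>x. H x * (1 / H 1))"
  define \<rho> where "\<rho> = (\<lambda>x. r x * (1 / H 1))"
  have dh: "(h has_real_derivative \<rho> x) (at x)" for x
    unfolding h_def \<rho>_def using H(2) by (rule DERIV_cmult_right)
  have "n_differentiable n \<rho>" for n unfolding \<rho>_def by (intro n_differentiable_mult sm n_differentiable_const)
  then have "n_differentiable (Suc n) h" for n using dh by auto
  then have dn: "n_differentiable n h" for n using n_differentiable_Suc_imp by blast
  have "0 \<le> H x" "H x \<le> H 1" for x
    using mono[of 0 x] mono[of x 1] H0[of x] H1[of x] H(1) by linarith+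
  note Hb = this
  show thesis
  proof (rule that[of h \<rho>])
    show "n_differentiable n h" for n by (rule dn)
    show "(h has_real_derivative \<rho> x) (at x)" for x by (rule dh)
    show "0 \<le> \<rho> x" for x using nn[of x] pos by (simp add: \<rho>_def)
    show "h x = 0" if "x \<le> 0" for x using H0[OF that] by (simp add: h_def)
    show "h x = 1" if "x \<ge> 1" for x using H1[OF that] pos by (simp add: h_def)
    show "0 \<le> h x" "h x \<le> 1" for x using Hb[of x] pos by (simp_all add: h_def)
    show "continuous_on UNIV \<rho>" unfolding \<rho>_def by (intro continuous_intros cont)
    show "\<rho> x = 0" if "x \<le> 0 \<or> x \<ge> 1" for x using z[OF that] by (simp add: \<rho>_def)
  qed
qed

section \<open>Weak derivatives on an interval\<close>

lemma set_borel_measurable_mult: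
  fixes f g :: "real \<Rightarrow> real"
  assumes "set_borel_measurable M U f" "set_borel_measurable M U g"
  shows "set_borel_measurable M U (\<lambda>x. f x * g x)"
proof -
  have "(\<lambda>x. indicat_real U x *\<^sub>R (f x * g x)) = (\<lambda>x. (indicat_real U x *\<^sub>R f x) * (indicat_real U x *\<^sub>R g x))"
    by (simp add: fun_eq_iff indicator_def)
  then show ?thesis
    using borel_measurable_times[OF assms[unfolded set_borel_measurable_def]]
    by (simp only: set_borel_measurable_def)
qed

lemma L2_on_mult_integrable:
  assumes "L2_on U f" "L2_on U g"
  shows "set_integrable lebesgue U (\<lambda>x. f x * g x)"
proof -
  have "set_integrable lebesgue U (\<lambda>x. (f x)\<^sup>2 + (g x)\<^sup>2)"
    using assms unfolding L2_on_def by (intro set_integral_add) auto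
  moreover have "set_borel_measurable lebesgue U (\<lambda>x. f x * g x)"
    using assms by (intro set_borel_measurable_mult) (auto simp: L2_on_def)
  moreover have "\<bar>a * b\<bar> \<le> \<bar>a\<^sup>2 + b\<^sup>2\<bar>" for a b :: real
  proof -
    have "2 * \<bar>a\<bar> * \<bar>b\<bar> \<le> \<bar>a\<bar>\<^sup>2 + \<bar>b\<bar>\<^sup>2" by (rule sum_squares_bound)
    moreover have "0 \<le> \<bar>a\<bar> * \<bar>b\<bar>" by simp
    ultimately show ?thesis unfolding abs_mult by (simp only: power2_abs)
  qed
  ultimately show ?thesis
    by (elim set_integrable_bound) simp_all
qed

lemma L2_on_bounded:
  assumes U: "U \<in> lmeasurable" and "set_borel_measurable lebesgue U f" "\<And>x. x \<in> U \<Longrightarrow> \<bar>f x\<bar> \<le> B"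
  shows "L2_on U f"
proof -
  have "set_integrable lebesgue U (\<lambda>x. B\<^sup>2)"
    using U by (auto simp: set_integrable_def fmeasurable_def intro!: integrable_mult_left)
  moreover have "set_borel_measurable lebesgue U (\<lambda>x. (f x)\<^sup>2)"
    unfolding power2_eq_square by (intro set_borel_measurable_mult assms)
  ultimately have "set_integrable lebesgue U (\<lambda>x. (f x)\<^sup>2)"
  proof (rule set_integrable_bound, intro AE_I2 impI)
    fix x assume "x \<in> U"
    then have "\<bar>f x\<bar>\<^sup>2 \<le> B\<^sup>2" using assms(3) by (intro power_mono) auto
    then show "norm ((f x)\<^sup>2) \<le> norm (B\<^sup>2)" by simp
  qed
  then show ?thesis using assms by (simp add: L2_on_def)
qed

lemma L2_on_const: "U \<in> lmeasurable \<Longrightarrow> L2_on U (\<lambda>x. c)"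
  by (rule L2_on_bounded[of _ _ "\<bar>c\<bar>"])
     (auto simp: set_borel_measurable_def fmeasurable_def)

lemma L2_on_integrable:
  assumes "U \<in> lmeasurable" "L2_on U f"
  shows "set_integrable lebesgue U f"
  using L2_on_mult_integrable[OF assms(2) L2_on_const[OF assms(1), of 1]] by simp

lemma set_integrable_bounded_mult:
  fixes f b :: "real \<Rightarrow> real"
  assumes "set_integrable lebesgue U f" "set_borel_measurable lebesgue U b" 
    "\<And>x. x \<in> U \<Longrightarrow> \<bar>b x\<bar> \<le> B"
  shows "set_integrable lebesgue U (\<lambda>x. b x * f x)"
proof -
  have "set_integrable lebesgue U (\<lambda>x. B * f x)" using assms by simp
  moreover have "set_borel_measurable lebesgue U (\<lambda>x. b x * f x)"
    using assms(1) by (intro set_borel_measurable_mult assms) (simp add: set_integrable_def set_borel_measurable_def)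
  ultimately show ?thesis
  proof (rule set_integrable_bound, intro AE_I2 impI)
    fix x assume "x \<in> U"
    then show "norm (b x * f x) \<le> norm (B * f x)"
      using assms(3)[of x] by (simp add: abs_mult mult_right_mono)
  qed
qed

text \<open>The kernels \<open>m * \<rho> (m * (x - c))\<close> are a one-sided approximate
  identity: nonnegative, of mass \<open>h 1 - h 0 = 1\<close>, and integrated over the interval of
  length \<open>1 / m\<close> to the right of \<open>c\<close>, so continuity of \<open>f\<close> on
  that side suffices.\<close>

lemma mollifier_integral_tendsto:
  fixes h \<rho> f :: "real \<Rightarrow> real"
  assumes h: "\<And>x. (h has_real_derivative \<rho> x) (at x)" "\<And>x. 0 \<le> \<rho> x" "continuous_on UNIV \<rho>"
    and h01: "h 0 = 0" "h 1 = 1"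
    and r: "r > 0" "continuous_on {c..c+r} f"
  shows "(\<lambda>n. integral {c..c + 1 / real (Suc n)} (\<lambda>x. f x * (real (Suc n) * \<rho> (real (Suc n) * (x - c))))) \<longlonglongrightarrow> f c"
proof (rule LIMSEQ_I)
  fix e :: real assume e: "e > 0"
  have "\<exists>d>0. \<forall>x\<in>{c..c+r}. dist x c < d \<longrightarrow> dist (f x) (f c) < e/2"
    using r e by (intro r(2)[unfolded continuous_on_iff, rule_format]) auto
  then obtain d where d: "d > 0" "\<And>x. x \<in> {c..c+r} \<Longrightarrow> dist x c < d \<Longrightarrow> dist (f x) (f c) < e/2"
    by blast
  obtain N where N: "1 / real (Suc N) < min d r"
    using nat_approx_posE[of "min d r"] d r by auto
  show "\<exists>no. \<forall>n\<ge>no. norm (integral {c..c + 1 / real (Suc n)} (\<lambda>x. f x * (real (Suc n) * \<rho> (real (Suc n) * (x - c)))) - f c) < e"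
  proof (intro exI[of _ N] allI impI)
    fix n assume "n \<ge> N"
    define m where "m = real (Suc n)"
    have m: "m > 0" "1 / m < d" "1 / m < r"
    proof -
      have "1 / m \<le> 1 / real (Suc N)" using \<open>n \<ge> N\<close> by (simp add: m_def field_simps)
      then show "1 / m < d" "1 / m < r" using N by auto
    qed (simp add: m_def)
    let ?I = "{c..c+1/m}" and ?k = "\<lambda>x. m * \<rho> (m * (x - c))"
    have contk: "continuous_on ?I ?k"
      by (intro continuous_intros continuous_on_compose2[OF h(3)]) auto
    have contf: "continuous_on ?I f" using r m by (auto intro: continuous_on_subset)
    have "((\<lambda>x. h (m * (x - c))) has_real_derivative ?k x) (at x)" for x
      by (rule DERIV_cong[OF DERIV_chain2[OF h(1)]]) (auto intro!: derivative_eq_intros)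
    then have "(?k has_integral h (m * (c + 1/m - c)) - h (m * (c - c))) ?I"
      using m(1) by (intro fundamental_theorem_of_calculus)
        (auto simp flip: has_real_derivative_iff_has_vector_derivative
              intro: has_field_derivative_at_within)
    then have k1: "(?k has_integral 1) ?I" using m h01 by simp
    have "((\<lambda>x. f x * ?k x) has_integral integral ?I (\<lambda>x. f x * ?k x)) ?I"
      by (intro integrable_integral integrable_continuous_real continuous_intros contf contk)
    from has_integral_diff[OF this has_integral_mult_right[OF k1, of "f c"]]
    have d1: "((\<lambda>x. (f x - f c) * ?k x) has_integral integral ?I (\<lambda>x. f x * ?k x) - f c) ?I"
      by (simp add: algebra_simps)
    have d2: "((\<lambda>x. e/2 * ?k x) has_integral e/2 * 1) ?I" by (intro has_integral_mult_right k1)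
    have "norm ((f x - f c) * ?k x) \<le> e/2 * ?k x" if "x \<in> ?I" for x
    proof -
      have "dist (f x) (f c) < e/2" using that m by (intro d(2)) (auto simp: dist_real_def)
      then show ?thesis using h(2)[of "m*(x-c)"] m e unfolding norm_mult
        by (intro mult_mono) (auto simp: dist_real_def)
    qed
    then have "norm (integral ?I (\<lambda>x. (f x - f c) * ?k x)) \<le> integral ?I (\<lambda>x. e/2 * ?k x)"
      using d1 d2 by (intro integral_norm_bound_integral) auto
    then have "norm (integral ?I (\<lambda>x. f x * ?k x) - f c) \<le> e/2"
      unfolding integral_unique[OF d1] integral_unique[OF d2] by simp
    then show "norm (integral {c..c + 1 / real (Suc n)} (\<lambda>x. f x * (real (Suc n) * \<rho> (real (Suc n) * (x - c)))) - f c) < e"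
      using e unfolding m_def by linarith
  qed
qed

lemma set_lebesgue_integral_subset:
  fixes f :: "real \<Rightarrow> real"
  assumes "A \<subseteq> U" "\<And>x. x \<in> U - A \<Longrightarrow> f x = 0"
  shows "(LINT x:U|M. f x) = (LINT x:A|M. f x)"
  unfolding set_lebesgue_integral_def
  by (rule Bochner_Integration.integral_cong) (use assms in \<open>auto simp: indicator_def\<close>)

text \<open>The weak identity is tested with \<open>B n\<close>, a smooth approximation of the
  indicator of {p<..q}. Its derivative is a difference of approximate identities at \<open>p\<close>
  and \<open>q\<close>, so one side tends to \<open>f p - f q\<close> by continuity and the other to
  minus the integral of \<open>g\<close> by dominated convergence.\<close>

lemma H1_on_FTC:
  assumes H: "H1_on U f g" and U: "open U" "U \<in> lmeasurable" and pq: "p < q" "{p..q} \<subseteq> U"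
    and cont: "continuous_on U f"
  shows "set_integrable lebesgue {p..q} g" "integral {p..q} g = f q - f p"
proof -
  have gU: "set_integrable lebesgue U g"
    using H U by (auto simp: H1_on_def intro: L2_on_integrable)
  then show gpq: "set_integrable lebesgue {p..q} g"
    by (rule set_integrable_subset) (use pq in auto)
  obtain h \<rho> :: "real \<Rightarrow> real" where h: "\<And>n. n_differentiable n h"
    "\<And>x. (h has_real_derivative \<rho> x) (at x)" "\<And>x. 0 \<le> \<rho> x"
    "\<And>x. x \<le> 0 \<Longrightarrow> h x = 0" "\<And>x. x \<ge> 1 \<Longrightarrow> h x = 1" "\<And>x. 0 \<le> h x" "\<And>x. h x \<le> 1"
    "continuous_on UNIV \<rho>" "\<And>x. x \<le> 0 \<or> x \<ge> 1 \<Longrightarrow> \<rho> x = 0"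
    by (rule smooth_step) blast
  have "q \<in> U" using pq by auto
  then obtain e where e: "e > 0" "cball q e \<subseteq> U" using U open_contains_cball by blast
  have pqe: "{p..q+e} \<subseteq> U"
  proof
    fix x assume "x \<in> {p..q+e}"
    then show "x \<in> U" using pq e by (cases "x \<le> q") (auto simp: subset_iff dist_real_def)
  qed
  obtain N where N: "1 / real (Suc N) < e" using nat_approx_posE[OF e(1)] .
  \<comment> \<open>The kernels lean to the right, so room is needed only beyond \<open>q\<close>;
    the shift by \<open>N\<close> keeps every support inside {p..q+e}.\<close>
  define m where "m n = real (Suc (n + N))" for n
  define A where "A c n = (\<lambda>x. m n * \<rho> (m n * (x - c)))" for c n
  define B where "B n x = h (m n * (x - p)) - h (m n * (x - q))" for n x
  have m: "m n > 0" "1 / m n < e" "1 / m n > 0" for n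
  proof -
    have "1 / m n \<le> 1 / real (Suc N)" by (simp add: m_def field_simps)
    then show "1 / m n < e" using N by auto
  qed (simp_all add: m_def)
  have contA: "continuous_on S (A c n)" for c n S
    unfolding A_def by (intro continuous_intros continuous_on_compose2[OF h(8)]) auto
  have A0: "A c n x = 0" if "x \<notin> {c..c+1/m n}" for c n x
  proof -
    have "m n * (x - c) \<le> 0 \<or> m n * (x - c) \<ge> 1"
      using that m(1)[of n] by (auto simp: field_simps mult_le_0_iff not_le)
    then show ?thesis using h(9) by (auto simp: A_def)
  qed
  have B0: "B n x = 0" if "x \<notin> {p..q+1/m n}" for n x
  proof (cases "x < p")
    case True
    then have "m n * (x - p) \<le> 0" "m n * (x - q) \<le> 0" using pq m(1)[of n]
      by (auto intro!: mult_nonneg_nonpos)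
    then show ?thesis using h(4) by (simp add: B_def)
  next
    case False
    then have "1/m n \<le> x - q" using that by auto
    then have "1 \<le> m n * (x - q)" using m(1)[of n] by (simp add: field_simps)
    moreover have "m n * (x - q) \<le> m n * (x - p)" using pq m(1)[of n] by simp
    ultimately have "1 \<le> m n * (x - q)" "1 \<le> m n * (x - p)" by linarith+
    then show ?thesis using h(5) by (simp add: B_def)
  qed
  have int_A: "set_integrable lebesgue U (\<lambda>x. f x * A c n x)"
       "(LINT x:U|lebesgue. f x * A c n x) = integral {c..c+1/m n} (\<lambda>x. f x * A c n x)"
    if "c \<in> {p,q}" for c n
  proof -
    have sub: "{c..c+1/m n} \<subseteq> U" using that pq pqe m(2)[of n] m(3)[of n] by (auto simp: subset_iff)
    have i: "set_integrable lebesgue {c..c+1/m n} (\<lambda>x. f x * A c n x)"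
      by (intro absolutely_integrable_continuous_real continuous_intros contA continuous_on_subset[OF cont] sub)
    have "(\<lambda>x. indicat_real U x *\<^sub>R (f x * A c n x)) = (\<lambda>x. indicat_real {c..c+1/m n} x *\<^sub>R (f x * A c n x))"
      using sub A0[of _ c n] by (auto simp: indicator_def fun_eq_iff)
    then show "set_integrable lebesgue U (\<lambda>x. f x * A c n x)"
       "(LINT x:U|lebesgue. f x * A c n x) = integral {c..c+1/m n} (\<lambda>x. f x * A c n x)"
      using i set_lebesgue_integral_eq_integral(2)[OF i]
      by (simp_all add: set_integrable_def set_lebesgue_integral_def)
  qed
  have eq: "integral {p..p+1/m n} (\<lambda>x. f x * A p n x) - integral {q..q+1/m n} (\<lambda>x. f x * A q n x)
      = - (LINT x:U|lebesgue. g x * B n x)" for n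
  proof -
    have "n_differentiable k (\<lambda>x. h (m n * x + - (m n * p)) + (- 1) * h (m n * x + - (m n * q)))" for k
      by (intro n_differentiable_add n_differentiable_mult n_differentiable_const n_differentiable_affine h(1))
    then have "n_differentiable k (B n)" for k
      by (rule subst[of _ _ "n_differentiable k", rotated]) (auto simp: B_def algebra_simps)
    then obtain D where D: "D 0 = B n" "\<And>k x. (D k has_real_derivative D (Suc k) x) (at x)"
      using n_differentiable_derivs by metis
    have dB: "(B n has_real_derivative A p n x - A q n x) (at x)" for x
      unfolding B_def A_def
      by (intro DERIV_diff DERIV_cong[OF DERIV_chain2[OF h(2)]]) (auto intro!: derivative_eq_intros)
    then have D1: "D 1 x = A p n x - A q n x" for x
      using DERIV_unique[OF D(2)[of 0 x, unfolded D(1)] dB[of x]] by simp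
    have cl: "closure {x. D 0 x \<noteq> 0} \<subseteq> {p..q+1/m n}"
      using B0[of _ n] by (intro closure_minimal) (auto simp: D(1) simp del: atLeastAtMost_iff)
    have "bounded (closure {x. D 0 x \<noteq> 0})" by (rule bounded_subset[OF _ cl]) auto
    moreover have "{p..q+1/m n} \<subseteq> U" using pqe m(2)[of n] by (auto simp: subset_iff)
    ultimately have "test_fun U D" using D(2) cl by (auto simp: test_fun_def compact_eq_bounded_closed)
    then have "(LINT x:U|lebesgue. f x * D 1 x) = - (LINT x:U|lebesgue. g x * D 0 x)"
      using H by (auto simp: H1_on_def)
    also have "(LINT x:U|lebesgue. f x * D 1 x) = (LINT x:U|lebesgue. f x * A p n x - f x * A q n x)"
      by (simp only: D1 right_diff_distrib)
    also have "\<dots> = (LINT x:U|lebesgue. f x * A p n x) - (LINT x:U|lebesgue. f x * A q n x)"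
      by (intro set_integral_diff int_A) auto
    finally show ?thesis using int_A(2)[of p n] int_A(2)[of q n] by (simp add: D(1))
  qed
  have lim1: "(\<lambda>n. integral {c..c+1/m n} (\<lambda>x. f x * A c n x)) \<longlonglongrightarrow> f c" if "c \<in> {p,q}" for c
  proof -
    have "continuous_on {c..c+e} f"
      using that pq pqe by (intro continuous_on_subset[OF cont]) (auto simp: subset_iff)
    from LIMSEQ_ignore_initial_segment[OF mollifier_integral_tendsto[OF h(2,3,8) h(4)[OF order_refl] h(5)[OF order_refl] e(1) this], of N]
    show ?thesis unfolding A_def m_def by simp
  qed
  \<comment> \<open>Half-open because \<open>h 0 = 0\<close>: \<open>B n\<close> vanishes at
    \<open>p\<close> and tends to 1 at \<open>q\<close>.\<close>
  let ?L = "LINT x|lebesgue. indicator U x *\<^sub>R (g x * indicator {p<..q} x)"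
  have lim2: "(\<lambda>n. LINT x:U|lebesgue. g x * B n x) \<longlonglongrightarrow> ?L"
    unfolding set_lebesgue_integral_def
  proof (rule integral_dominated_convergence)
    show "integrable lebesgue (\<lambda>x. norm (indicator U x *\<^sub>R g x))"
      using gU unfolding set_integrable_def by (rule integrable_norm)
    have mg: "(\<lambda>x. indicator U x *\<^sub>R g x) \<in> borel_measurable lebesgue"
      using gU by (simp add: set_integrable_def)
    have conth: "continuous_on UNIV h" by (rule DERIV_continuous_on[OF has_field_derivative_at_within[OF h(2)]])
    have "continuous_on UNIV (\<lambda>x. h (m n * (x - c)))" for n c
      by (rule continuous_on_compose2[OF conth]) (auto intro!: continuous_intros)
    then have "continuous_on UNIV (B n)" for n
      unfolding B_def by (intro continuous_on_diff)
    then have mB: "B n \<in> borel_measurable lebesgue" for n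
      by (intro measurable_completion) (simp add: borel_measurable_continuous_onI)
    have "(\<lambda>x. (indicator U x *\<^sub>R g x) * B n x) \<in> borel_measurable lebesgue" for n
      by (intro borel_measurable_times mg mB)
    then show "(\<lambda>x. indicator U x *\<^sub>R (g x * B n x)) \<in> borel_measurable lebesgue" for n
      by (simp add: mult.assoc)
    have "(\<lambda>x. (indicator U x *\<^sub>R g x) * indicator {p<..q} x) \<in> borel_measurable lebesgue"
      by (intro borel_measurable_times mg borel_measurable_indicator) simp
    then show "(\<lambda>x. indicator U x *\<^sub>R (g x * indicator {p<..q} x)) \<in> borel_measurable lebesgue"
      by (simp add: mult.assoc)
    have m_large: "\<forall>\<^sub>F n in sequentially. 1 \<le> m n * t" if t: "t > 0" for t
    proof -
      obtain K where K: "1 / real (Suc K) < t" using nat_approx_posE[OF t] by blast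
      have "1 \<le> m n * t" if "n \<ge> K" for n
      proof -
        have "1 / m n \<le> 1 / real (Suc K)" using that by (simp add: m_def field_simps)
        then have "1 / m n < t" using K by linarith
        then show ?thesis using m(1)[of n] by (simp add: pos_divide_less_eq mult.commute)
      qed
      then show ?thesis by (auto simp: eventually_sequentially)
    qed
    have "(\<lambda>n. B n x) \<longlonglongrightarrow> indicator {p<..q} x" for x
    proof (rule Lim_transform_eventually[OF tendsto_const])
      consider "x \<le> p" | "p < x" "x \<le> q" | "q < x" by linarith
      then show "\<forall>\<^sub>F n in sequentially. indicator {p<..q} x = B n x"
      proof cases
        case 1
        then have "m n * (x - p) \<le> 0" "m n * (x - q) \<le> 0" for n using pq m(1)[of n]
          by (auto intro!: mult_nonneg_nonpos)
        then show ?thesis using 1 h(4) by (simp add: B_def)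
      next
        case 2
        then have "m n * (x - q) \<le> 0" for n using m(1)[of n] by (auto intro!: mult_nonneg_nonpos)
        moreover have "\<forall>\<^sub>F n in sequentially. 1 \<le> m n * (x - p)" using 2 by (intro m_large) auto
        ultimately show ?thesis using 2 h(4,5) by (auto simp: B_def elim!: eventually_mono)
      next
        case 3
        have "\<forall>\<^sub>F n in sequentially. 1 \<le> m n * (x - p) \<and> 1 \<le> m n * (x - q)" 
          using 3 pq by (intro eventually_conj m_large) auto
        then show ?thesis using 3 h(5) by (auto simp: B_def elim!: eventually_mono)
      qed
    qed
    then show "AE x in lebesgue. (\<lambda>n. indicator U x *\<^sub>R (g x * B n x)) \<longlonglongrightarrow> indicator U x *\<^sub>R (g x * indicator {p<..q} x)"
      by (intro AE_I2 tendsto_intros)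
    have "\<bar>B n x\<bar> \<le> 1" for n x
      using h(6)[of "m n * (x - p)"] h(7)[of "m n * (x - p)"] h(6)[of "m n * (x - q)"] h(7)[of "m n * (x - q)"]
      by (auto simp: B_def)
    then show "AE x in lebesgue. norm (indicator U x *\<^sub>R (g x * B n x)) \<le> norm (indicator U x *\<^sub>R g x)" for n
      by (intro AE_I2) (auto simp: abs_mult indicator_def mult_left_le)
  qed
  have "(\<lambda>n. integral {p..p+1/m n} (\<lambda>x. f x * A p n x) - integral {q..q+1/m n} (\<lambda>x. f x * A q n x)) \<longlonglongrightarrow> f p - f q"
    by (intro tendsto_diff lim1) auto
  then have "f p - f q = - ?L"
    using tendsto_minus[OF lim2] LIMSEQ_unique unfolding eq by blast
  also have "?L = (LINT x:{p<..q}|lebesgue. g x)"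
    unfolding set_lebesgue_integral_def
    by (rule Bochner_Integration.integral_cong) (use pq in \<open>auto simp: indicator_def subset_iff\<close>)
  also have "\<dots> = integral {p<..q} g"
    by (rule set_lebesgue_integral_eq_integral, rule set_integrable_subset[OF gpq]) auto
  also have "\<dots> = integral {p..q} g"
    by (rule integral_subset_negligible) (use pq in \<open>auto intro: negligible_subset[OF negligible_sing[of p]]\<close>)
  finally show "integral {p..q} g = f q - f p" by simp
qed

lemma LINT_unit_interval:
  fixes f :: "real \<Rightarrow> real"
  assumes "set_integrable lebesgue {0<..<1} f"
  shows "f integrable_on {0..1::real}" "(LINT x:{0<..<1}|lebesgue. f x) = integral {0..1} f"
  using set_lebesgue_integral_eq_integral[OF assms] 
  by (auto simp: integrable_on_Icc_iff_Ioo integral_open_interval_real)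

text \<open>The Borel sets on which the integral vanishes form a Dynkin system containing the
  half-open intervals, an intersection-stable generator; uniqueness of densities then gives 0 almost
  everywhere.\<close>

lemma AE_zero_if_integrals_zero:
  fixes w :: "real \<Rightarrow> real"
  assumes w: "set_integrable lebesgue {0<..<1} w"
    and zero: "\<And>p q. 0 \<le> p \<Longrightarrow> p \<le> q \<Longrightarrow> q \<le> 1 \<Longrightarrow> integral {p..q} w = 0"
  shows "AE x in lebesgue. x \<in> {0<..<1} \<longrightarrow> w x = 0"
proof -
  let ?w = "\<lambda>x. indicat_real {0<..<1} x *\<^sub>R w x"
  have iw: "integrable lebesgue ?w" using w by (simp add: set_integrable_def)
  then have "?w \<in> borel_measurable lebesgue" by simp
  \<comment> \<open>The extended function is only Lebesgue measurable; the induction over Borel sets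
    runs on a Borel version of it.\<close>
  then obtain w' where w': "w' \<in> borel_measurable lborel" "AE x in lborel. ?w x = w' x"
    using completion_ex_borel_measurable_real by blast
  have AEc: "AE x in lebesgue. ?w x = w' x" using w'(2) by (rule AE_completion)
  have m': "w' \<in> borel_measurable lebesgue" using w'(1) by (rule measurable_completion)
  have i': "integrable lebesgue w'" using integrable_cong_AE[OF _ m' AEc] iw by auto
  then have i: "integrable lborel w'" using integrable_completion[OF w'(1)] by simp
  have tr: "(LINT x:A|lborel. w' x) = (LINT x:A|lebesgue. ?w x)" if A: "A \<in> sets borel" for A
  proof -
    have mm: "(\<lambda>x. indicat_real A x *\<^sub>R w' x) \<in> borel_measurable lborel"
      using A w'(1) by (intro borel_measurable_scaleR borel_measurable_indicator) auto
    have "(LINT x:A|lborel. w' x) = (LINT x:A|lebesgue. w' x)"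
      unfolding set_lebesgue_integral_def using integral_completion[OF mm] by simp
    also have "\<dots> = (LINT x:A|lebesgue. ?w x)"
      unfolding set_lebesgue_integral_def
    proof (rule integral_cong_AE)
      show "(\<lambda>x. indicat_real A x *\<^sub>R w' x) \<in> borel_measurable lebesgue"
        using mm by (rule measurable_completion)
      show "(\<lambda>x. indicat_real A x *\<^sub>R ?w x) \<in> borel_measurable lebesgue"
        by (rule borel_measurable_scaleR[OF borel_measurable_indicator borel_measurable_integrable[OF iw]])
           (use A in auto)
      show "AE x in lebesgue. indicat_real A x *\<^sub>R w' x = indicat_real A x *\<^sub>R ?w x"
        using AEc by eventually_elim simp
    qed
    finally show ?thesis .
  qed
  have Ioc: "(LINT x:{a<..b}|lebesgue. ?w x) = 0" for a b
  proof -
    \<comment> \<open>Clamping both ends to {0..1}, with \<open>?q\<close> at least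
      \<open>?p\<close>, treats empty and partial overlaps by one formula.\<close>
    let ?p = "max 0 (min a 1)" and ?q = "max (max 0 (min a 1)) (min b 1)"
    have "(LINT x:{a<..b}|lebesgue. ?w x) = (LINT x:{a<..b} \<inter> {0<..<1}|lebesgue. w x)"
      unfolding set_lebesgue_integral_def
      by (rule Bochner_Integration.integral_cong) (auto simp: indicator_def)
    also have "\<dots> = integral ({a<..b} \<inter> {0<..<1}) w"
      by (rule set_lebesgue_integral_eq_integral, rule set_integrable_subset[OF w]) auto
    also have "\<dots> = integral {?p..?q} w"
    proof (cases "{a<..b} \<inter> {0<..<1} = {}")
      case True
      have "?p = ?q"
      proof (rule ccontr)
        assume "?p \<noteq> ?q"
        then have "?p < ?q" by auto
        then have "(?p + ?q) / 2 \<in> {a<..b} \<inter> {0<..<1}" by (auto simp: max_def min_def split: if_splits)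
        then show False using True by blast
      qed
      then show ?thesis unfolding True by simp
    next
      case False
      show ?thesis
      proof (rule integral_subset_negligible)
        show "{a<..b} \<inter> {0<..<1} \<subseteq> {?p..?q}" by auto
        have "{?p..?q} - {a<..b} \<inter> {0<..<1} \<subseteq> {?p, ?q}" using False by auto
        then show "negligible ({?p..?q} - {a<..b} \<inter> {0<..<1})"
          by (rule negligible_subset[rotated]) simp
      qed
    qed
    also have "\<dots> = 0" by (rule zero) auto
    finally show ?thesis .
  qed
  have total: "(LINT x|lborel. w' x) = 0"
  proof -
    have "(LINT x:UNIV|lborel. w' x) = (LINT x:UNIV|lebesgue. ?w x)" by (rule tr) simp
    also have "\<dots> = (LINT x:{0<..<1}|lebesgue. w x)" by (simp add: set_lebesgue_integral_def)
    also have "\<dots> = integral {0..1} w" by (rule LINT_unit_interval[OF w])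
    also have "\<dots> = 0" by (rule zero) auto
    finally show ?thesis by (simp add: set_lebesgue_integral_def)
  qed
  have si: "set_integrable lborel A w'" if "A \<in> sets borel" for A
    using i that unfolding set_integrable_def by (intro integrable_mult_indicator) auto
  have "(LINT x:A|lborel. w' x) = 0" if "A \<in> sets borel" for A
  proof -
    let ?G = "range (\<lambda>(a, b). {a <.. b::real})"
    have sb: "sets borel = sigma_sets UNIV ?G" by (subst borel_sigma_sets_Ioc) simp
    have "Int_stable ?G"
    proof (rule Int_stableI)
      fix A B assume "A \<in> ?G" "B \<in> ?G"
      then obtain a b c d where "A = {a<..b}" "B = {c<..d}" by auto
      then have "A \<inter> B = {max a c<..min b d}" by auto
      then show "A \<inter> B \<in> ?G" by auto
    qed
    moreover have "?G \<subseteq> Pow UNIV" by simp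
    ultimately show ?thesis
      using that[unfolded sb]
    proof (induction rule: sigma_sets_induct_disjoint)
      case (basic A)
      then show ?case using Ioc tr by auto
    next
      case empty
      then show ?case by (simp add: set_lebesgue_integral_def)
    next
      case (compl A)
      have A: "A \<in> sets borel" using compl sb by auto
      have "(LINT x:A \<union> (UNIV - A)|lborel. w' x) = (LINT x:A|lborel. w' x) + (LINT x:(UNIV - A)|lborel. w' x)"
        by (rule set_integral_Un) (use A si in auto)
      moreover have "A \<union> (UNIV - A) = UNIV" by auto
      ultimately show ?case using compl total by (simp add: set_lebesgue_integral_def)
    next
      case (union A)
      have A: "A i \<in> sets borel" for i using union sb by auto
      have "(LINT x:(\<Union>i. A i)|lborel. w' x) = (\<Sum>i. (LINT x:(A i)|lborel. w' x))"
        by (rule lebesgue_integral_countable_add)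
           (use A si union in \<open>auto simp: disjoint_family_on_def\<close>)
      then show ?case using union by simp
    qed
  qed
  then have "AE x in lborel. w' x = 0"
    by (intro density_unique_real i) (auto simp: set_lebesgue_integral_def)
  then have "AE x in lebesgue. w' x = 0" by (rule AE_completion)
  with AEc show ?thesis by eventually_elim (auto simp: indicator_def)
qed

lemma lmeasurable_subset_unit: "open U \<Longrightarrow> U \<subseteq> {0..1::real} \<Longrightarrow> U \<in> lmeasurable"
  by (rule lmeasurable_open) (auto intro: bounded_subset[OF bounded_closed_interval])

text \<open>\<open>H1_on_FTC\<close> reaches only compact subintervals of the open interval. There
  \<open>?F\<close> is constant, and being continuous on the closed interval it stays constant up to
  the end points, where the conditions at 0 and 1 are read off.\<close>

lemma H1_on_unit_FTC:
  assumes H: "H1_on {0<..<1} f g" and cont: "continuous_on {0..1} f" and pq: "0 \<le> p" "p \<le> q" "q \<le> 1"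
  shows "(g has_integral (f q - f p)) {p..q}"
proof -
  have "set_integrable lebesgue {0<..<1} g"
    using H by (intro L2_on_integrable lmeasurable_subset_unit) (auto simp: H1_on_def)
  then have int: "g integrable_on {0..1}" by (rule LINT_unit_interval)
  let ?F = "\<lambda>x. f x - integral {0..x} g"
  have contF: "continuous_on (closure {0<..<1}) ?F"
    using cont indefinite_integral_continuous_1[OF int] by (auto intro!: continuous_intros)
  have sub: "g integrable_on {a..b}" if "0 \<le> a" "b \<le> 1" for a b
    using int by (rule integrable_on_subinterval) (use that in auto)
  have in1: "?F x = ?F y" if "0 < x" "x < y" "y < 1" for x y
  proof -
    have "integral {x..y} g = f y - f x"
      by (rule H1_on_FTC[OF H]) (use that cont in \<open>auto intro: lmeasurable_subset_unit continuous_on_subset\<close>)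
    moreover have "integral {0..x} g + integral {x..y} g = integral {0..y} g"
      by (rule Henstock_Kurzweil_Integration.integral_combine) (use that sub in auto)
    ultimately show ?thesis by simp
  qed
  have c': "?F x = ?F (1/2)" if "x \<in> {0<..<1}" for x
  proof -
    consider "x = 1/2" | "x < 1/2" | "x > 1/2" by linarith
    then show ?thesis
    proof cases
      case 1
      show ?thesis unfolding 1 ..
    qed (use that in1[of x "1/2"] in1[of "1/2" x] in auto)
  qed
  have c: "?F x = ?F (1/2)" if "x \<in> {0..1}" for x
    by (rule continuous_constant_on_closure[OF contF c']) (use that in simp_all)
  have "integral {0..p} g + integral {p..q} g = integral {0..q} g"
    by (rule Henstock_Kurzweil_Integration.integral_combine) (use pq sub in auto)
  then have "integral {p..q} g = f q - f p" using c[of p] c[of q] pq by auto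
  then show ?thesis using sub[of p q] pq by (auto simp: has_integral_iff)
qed

text \<open>Both weak derivatives have the same integral over every subinterval, namely the
  increment of \<open>f\<close>.\<close>

lemma H1_on_unit_unique:
  assumes "H1_on {0<..<1} f g" "H1_on {0<..<1} f g'" "continuous_on {0..1} f"
  shows "AE x in lebesgue. x \<in> {0<..<1} \<longrightarrow> g x = g' x"
proof -
  have "AE x in lebesgue. x \<in> {0<..<1} \<longrightarrow> g x - g' x = 0"
  proof (rule AE_zero_if_integrals_zero)
    show "set_integrable lebesgue {0<..<1} (\<lambda>x. g x - g' x)"
      using assms by (intro set_integral_diff L2_on_integrable lmeasurable_subset_unit) (auto simp: H1_on_def)
    fix p q :: real assume "0 \<le> p" "p \<le> q" "q \<le> 1"
    then show "integral {p..q} (\<lambda>x. g x - g' x) = 0"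
      using has_integral_diff[OF H1_on_unit_FTC[OF assms(1,3)] H1_on_unit_FTC[OF assms(2,3)], of p q]
      by (auto dest: integral_unique)
  qed
  then show ?thesis by simp
qed

lemma set_borel_measurable_continuous:
  assumes "open U" "continuous_on U f"
  shows "set_borel_measurable lebesgue U (f :: real \<Rightarrow> real)"
  unfolding set_borel_measurable_def
  using borel_measurable_continuous_on_indicator[OF _ assms(2)] assms(1)
  by (intro measurable_completion) auto

lemma bounded_on_unit:
  assumes "continuous_on {0..1::real} f"
  obtains B where "B > 0" "\<And>x. x \<in> {0..1} \<Longrightarrow> \<bar>f x :: real\<bar> \<le> B"
  using compact_imp_bounded[OF compact_continuous_image[OF assms compact_Icc]]
  by (auto simp: bounded_pos)

lemma L2_on_unit_continuous:
  assumes "continuous_on {0..1} f" "open U" "U \<subseteq> {0..1}"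
  shows "L2_on U f"
proof -
  obtain B where "\<And>x. x \<in> {0..1} \<Longrightarrow> \<bar>f x :: real\<bar> \<le> B" using bounded_on_unit[OF assms(1)] by blast
  then show ?thesis
    using assms by (intro L2_on_bounded[of _ _ B] set_borel_measurable_continuous lmeasurable_subset_unit)
      (auto intro: continuous_on_subset)
qed

text \<open>The product of \<open>f\<close> with a test function has no boundary terms, so the
  fundamental theorem gives the weak identity. The finite exceptional set admits functions with a
  kink, such as the variation stopped at a point in the Euler-Lagrange argument.\<close>

lemma H1_on_unit_piecewise:
  fixes f g :: "real \<Rightarrow> real"
  assumes cont: "continuous_on {0..1} f" and S: "finite S" 
    and der: "\<And>x. x \<in> {0<..<1} - S \<Longrightarrow> (f has_real_derivative g x) (at x)"
    and g: "L2_on {0<..<1} g"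
  shows "H1_on {0<..<1} f g"
  unfolding H1_on_def
proof (intro conjI allI impI g)
  show f: "L2_on {0<..<1} f" by (rule L2_on_unit_continuous[OF cont]) auto
  fix D assume D: "test_fun {0<..<1} D"
  then have dD: "(D k has_real_derivative D (Suc k) x) (at x)" for k x by (auto simp: test_fun_def)
  have D01: "D 0 x = 0" if "x \<notin> {0<..<1}" for x
    using D that closure_subset[of "{x. D 0 x \<noteq> 0}"] by (auto simp: test_fun_def)
  have contD: "continuous_on A (D k)" for k A
    by (rule DERIV_continuous_on[OF has_field_derivative_at_within[OF dD]])
  have L2D: "L2_on {0<..<1} (D k)" for k by (rule L2_on_unit_continuous[OF contD]) auto
  have "((\<lambda>x. f x * D 1 x + g x * D 0 x) has_integral (f 1 * D 0 1 - f 0 * D 0 0)) {0..1}"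
  proof (rule fundamental_theorem_of_calculus_interior_strong[OF S])
    fix x assume "x \<in> {0<..<1} - S"
    from DERIV_mult[OF der[OF this] dD[of 0 x]]
    show "((\<lambda>x. f x * D 0 x) has_vector_derivative f x * D 1 x + g x * D 0 x) (at x)"
      by (simp add: has_real_derivative_iff_has_vector_derivative algebra_simps)
  qed (auto intro!: continuous_intros cont contD)
  then have *: "integral {0..1} (\<lambda>x. f x * D 1 x + g x * D 0 x) = 0" using D01 by (simp add: integral_unique)
  have i1: "set_integrable lebesgue {0<..<1} (\<lambda>x. f x * D 1 x)"
    and i2: "set_integrable lebesgue {0<..<1} (\<lambda>x. g x * D 0 x)"
    by (intro L2_on_mult_integrable f g L2D)+
  have "(LINT x:{0<..<1}|lebesgue. f x * D 1 x) + (LINT x:{0<..<1}|lebesgue. g x * D 0 x)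
      = (LINT x:{0<..<1}|lebesgue. f x * D 1 x + g x * D 0 x)"
    by (rule set_integral_add(2)[OF i1 i2, symmetric])
  also have "\<dots> = 0" using LINT_unit_interval(2)[OF set_integral_add(1)[OF i1 i2]] * by simp
  finally show "(LINT x:{0<..<1}|lebesgue. f x * D 1 x) = - (LINT x:{0<..<1}|lebesgue. g x * D 0 x)"
    by simp
qed

section \<open>The energy and its minimizers\<close>

lemma negligible_if_AE:
  assumes "AE x in lebesgue. P x"
  obtains N where "negligible N" "\<And>x. x \<notin> N \<Longrightarrow> P x"
proof -
  obtain N where "{x \<in> space lebesgue. \<not> P x} \<subseteq> N" "emeasure lebesgue N = 0" "N \<in> sets lebesgue"
    using AE_E[OF assms] .
  then show thesis by (intro that[of N]) (auto simp: negligible_iff_null_sets null_sets_def)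
qed

lemma H1_on_wderiv: "\<exists>g. H1_on U f g \<Longrightarrow> H1_on U f (wderiv U f)"
  unfolding wderiv_def by (erule someI_ex)

text \<open>\<open>wderiv\<close> is a \<open>SOME\<close> choice, hence known only up to a null
  set; the integrals in \<open>G\<close> do not see the difference.\<close>

lemma wderiv_spike:
  assumes "H1_on {0<..<1} f g" "continuous_on {0..1} f"
  obtains N where "negligible N" "\<And>x. x \<in> {0..1} - N \<Longrightarrow> wderiv {0<..<1} f x = g x"
proof -
  obtain N where "negligible N" "\<And>x. x \<notin> N \<Longrightarrow> x \<in> {0<..<1} \<longrightarrow> wderiv {0<..<1} f x = g x"
    using negligible_if_AE[OF H1_on_unit_unique[OF H1_on_wderiv assms(1,2)]] assms(1) by blast
  then show thesis by (intro that[of "N \<union> {0,1}"]) auto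
qed

lemma H1_on_unit_square_integrable:
  assumes "H1_on {0<..<1} f g"
  shows "(\<lambda>x. (g x)\<^sup>2) integrable_on {0..1}"
  using assms by (intro LINT_unit_interval) (auto simp: H1_on_def L2_on_def)

lemma set_integrable_continuous_mult:
  assumes "continuous_on {0..1} b" "set_integrable lebesgue U f" "open U" "U \<subseteq> {0..1::real}"
  shows "set_integrable lebesgue U (\<lambda>x. b x * f x :: real)"
proof -
  obtain B where "\<And>x. x \<in> {0..1} \<Longrightarrow> \<bar>b x\<bar> \<le> B" by (rule bounded_on_unit[OF assms(1)]) blast
  then show ?thesis using assms
    by (intro set_integrable_bounded_mult[where B = B] set_borel_measurable_continuous)
       (auto elim: continuous_on_subset)
qed

text \<open>The part of \<open>G\<close> without \<open>\<phi>\<close>: a Modica-Mortola energy with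
  wells at 1 and -1.\<close>

definition well_energy :: "real \<Rightarrow> (real \<Rightarrow> real) \<Rightarrow> real" where
  "well_energy \<epsilon> v = 1/2 * integral {0..1} (\<lambda>x. (wderiv {0<..<1} v x)\<^sup>2)
     + 1/(4*\<epsilon>\<^sup>2) * integral {0..1} (\<lambda>x. (1 - (v x)\<^sup>2)\<^sup>2)"

text \<open>Covers non-integrable squares as well, whose integral is 0 by convention.\<close>

lemma integral_square_nonneg:
  fixes f :: "real \<Rightarrow> real"
  shows "0 \<le> integral S (\<lambda>x. (f x)\<^sup>2)"
  using integral_nonneg[of "\<lambda>x. (f x)\<^sup>2" S] by (cases "(\<lambda>x. (f x)\<^sup>2) integrable_on S") (auto simp: not_integrable_integral)

lemma well_energy_nonneg: "well_energy \<epsilon> v \<ge> 0"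
  unfolding well_energy_def by (intro add_nonneg_nonneg mult_nonneg_nonneg integral_square_nonneg) auto

lemma open_good_set:
  assumes "continuous_on {0..1} v"
  shows "open (good_set v)"
proof -
  have "good_set v = {0<..<1} \<inter> v -` (- {0})" by (auto simp: good_set_def zero_set_def)
  moreover have "open ({0<..<1} \<inter> v -` (- {0}))"
    by (rule continuous_open_preimage) (use assms in \<open>auto intro: continuous_on_subset\<close>)
  ultimately show ?thesis by simp
qed

lemma LINT_unit_interval_continuous:
  fixes f :: "real \<Rightarrow> real"
  assumes "continuous_on {0..1} f"
  shows "set_integrable lebesgue {0<..<1} f" "(LINT x:{0<..<1}|lebesgue. f x) = integral {0..1} f"
proof -
  show "set_integrable lebesgue {0<..<1} f"
    using absolutely_integrable_continuous_real[OF assms] by (rule set_integrable_subset) auto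
  then show "(LINT x:{0<..<1}|lebesgue. f x) = integral {0..1} f" by (rule LINT_unit_interval)
qed

text \<open>Completes the square to \<open>(v * (\<phi>' - 2 * \<kappa>))\<^sup>2 / 8\<close>; the
  unit mass makes the price exactly \<open>\<kappa>\<^sup>2 / 2\<close>. The estimate must work
  before \<open>v\<close> is known to be positive, hence the integrals over
  \<open>good_set v\<close>, off which \<open>v\<^sup>2\<close> carries no mass.\<close>

lemma G_lower_bound:
  assumes adm: "admissible v \<phi>" and "\<delta> \<ge> 0"
  shows "well_energy \<epsilon> v - \<kappa>\<^sup>2 / 2 \<le> G \<epsilon> \<delta> \<kappa> v \<phi>"
proof -
  let ?U = "good_set v" and ?d = "wderiv (good_set v) \<phi>"
  have cv: "continuous_on {0..1} v" and Hv: "H1_on {0<..<1} v (wderiv {0<..<1} v)"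
    and Hp: "H1_on ?U \<phi> ?d" and mass: "(LINT x:{0<..<1}|lebesgue. (v x)\<^sup>2) = 1"
    using adm by (auto simp: admissible_def intro: H1_on_wderiv)
  have U: "open ?U" "?U \<subseteq> {0..1}" "?U \<in> lmeasurable" "?U \<subseteq> {0<..<1}"
    using open_good_set[OF cv] by (auto simp: good_set_def intro!: lmeasurable_subset_unit)
  have L2d: "L2_on ?U ?d" using Hp by (simp add: H1_on_def)
  have cv2: "continuous_on {0..1} (\<lambda>x. (v x)\<^sup>2)" by (intro continuous_intros cv)
  have i1: "set_integrable lebesgue ?U (\<lambda>x. (v x)\<^sup>2 * (?d x)\<^sup>2)"
    by (rule set_integrable_continuous_mult[OF cv2 _ U(1,2)]) (use L2d in \<open>simp add: L2_on_def\<close>)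
  have i2: "set_integrable lebesgue ?U (\<lambda>x. (v x)\<^sup>2 * ?d x)"
    by (rule set_integrable_continuous_mult[OF cv2 _ U(1,2)]) (use L2_on_integrable[OF U(3) L2d] in simp)
  have i3: "set_integrable lebesgue ?U (\<lambda>x. (v x)\<^sup>2)"
    using LINT_unit_interval_continuous(1)[OF cv2] by (rule set_integrable_subset) (use U in auto)
  have "0 \<le> (LINT x:?U|lebesgue. 1/8 * ((v x)\<^sup>2 * (?d x)\<^sup>2) - \<kappa>/2 * ((v x)\<^sup>2 * ?d x) + \<kappa>\<^sup>2/2 * (v x)\<^sup>2)"
    unfolding set_lebesgue_integral_def
  proof (rule Bochner_Integration.integral_nonneg)
    fix x
    have sq: "1/8 * ((v x)\<^sup>2 * (?d x)\<^sup>2) - \<kappa>/2 * ((v x)\<^sup>2 * ?d x) + \<kappa>\<^sup>2/2 * (v x)\<^sup>2 = 1/8 * (v x * (?d x - 2*\<kappa>))\<^sup>2"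
      by (simp add: power2_eq_square algebra_simps)
    show "0 \<le> indicat_real ?U x *\<^sub>R (1/8 * ((v x)\<^sup>2 * (?d x)\<^sup>2) - \<kappa>/2 * ((v x)\<^sup>2 * ?d x) + \<kappa>\<^sup>2/2 * (v x)\<^sup>2)"
      unfolding sq by simp
  qed
  also have "\<dots> = 1/8 * (LINT x:?U|lebesgue. (v x)\<^sup>2 * (?d x)\<^sup>2) - \<kappa>/2 * (LINT x:?U|lebesgue. (v x)\<^sup>2 * ?d x)
      + \<kappa>\<^sup>2/2 * (LINT x:?U|lebesgue. (v x)\<^sup>2)"
  proof -
    note j = set_integrable_mult_right[OF i1, of "1/8"] set_integrable_mult_right[OF i2, of "\<kappa>/2"] set_integrable_mult_right[OF i3, of "\<kappa>\<^sup>2/2"]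
    show ?thesis
      unfolding set_integral_add(2)[OF set_integral_diff(1)[OF j(1,2)] j(3)] set_integral_diff(2)[OF j(1,2)]
      by (simp add: set_integral_mult_right)
  qed
  also have "(LINT x:?U|lebesgue. (v x)\<^sup>2) = (LINT x:{0<..<1}|lebesgue. (v x)\<^sup>2)"
    by (rule set_lebesgue_integral_subset[symmetric, OF U(4)]) (simp add: good_set_def zero_set_def)
  finally have *: "0 \<le> 1/8 * (LINT x:?U|lebesgue. (v x)\<^sup>2 * (?d x)\<^sup>2) - \<kappa>/2 * (LINT x:?U|lebesgue. (v x)\<^sup>2 * ?d x) + \<kappa>\<^sup>2/2"
    unfolding mass by simp
  have "0 \<le> (LINT x:?U|lebesgue. (v x)^4 * (sin (\<phi> x))\<^sup>2)"
    unfolding set_lebesgue_integral_def by (rule Bochner_Integration.integral_nonneg) auto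
  then have **: "0 \<le> \<delta>/(8*\<epsilon>\<^sup>2) * (LINT x:?U|lebesgue. (v x)^4 * (sin (\<phi> x))\<^sup>2)"
    using \<open>\<delta> \<ge> 0\<close> by simp
  have e: "(LINT x:{0<..<1}|lebesgue. (wderiv {0<..<1} v x)\<^sup>2) = integral {0..1} (\<lambda>x. (wderiv {0<..<1} v x)\<^sup>2)"
    "(LINT x:{0<..<1}|lebesgue. (1 - (v x)\<^sup>2)\<^sup>2) = integral {0..1} (\<lambda>x. (1 - (v x)\<^sup>2)\<^sup>2)"
    by (rule LINT_unit_interval(2), use Hv in \<open>simp add: H1_on_def L2_on_def\<close>)
       (intro LINT_unit_interval_continuous(2) continuous_intros cv)
  show ?thesis using * ** unfolding G_def well_energy_def Let_def e by linarith
qed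

text \<open>Lets computations use a concrete weak derivative \<open>g\<close> in place of the
  \<open>SOME\<close> choice once \<open>v\<close> has no zeros.\<close>

lemma G_unit:
  assumes cv: "continuous_on {0..1} v" and Hv: "\<exists>g. H1_on {0<..<1} v g"
    and good: "good_set v = {0<..<1}"
    and cp: "continuous_on {0..1} \<phi>" and Hp: "H1_on {0<..<1} \<phi> g"
  shows "G \<epsilon> \<delta> \<kappa> v \<phi> = well_energy \<epsilon> v + 1/8 * integral {0..1} (\<lambda>x. (v x)\<^sup>2 * (g x)\<^sup>2)
    + \<delta>/(8*\<epsilon>\<^sup>2) * integral {0..1} (\<lambda>x. (v x)^4 * (sin (\<phi> x))\<^sup>2)
    - \<kappa>/2 * integral {0..1} (\<lambda>x. (v x)\<^sup>2 * g x)"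
    (is ?eq)
    and "(\<lambda>x. (v x)\<^sup>2 * (g x)\<^sup>2) integrable_on {0..1}" (is ?i1)
    and "(\<lambda>x. (v x)\<^sup>2 * g x) integrable_on {0..1}" (is ?i2)
proof -
  let ?d = "wderiv {0<..<1} \<phi>"
  have Hv': "H1_on {0<..<1} v (wderiv {0<..<1} v)" using Hv by (rule H1_on_wderiv)
  have cv2: "continuous_on {0..1} (\<lambda>x. (v x)\<^sup>2)" by (intro continuous_intros cv)
  have Hd: "H1_on {0<..<1} \<phi> ?d" using Hp by (intro H1_on_wderiv) blast
  have i1: "set_integrable lebesgue {0<..<1} (\<lambda>x. (v x)\<^sup>2 * (g x)\<^sup>2)" if "H1_on {0<..<1} \<phi> g" for g
    by (rule set_integrable_continuous_mult[OF cv2]) (use that in \<open>auto simp: H1_on_def L2_on_def\<close>)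
  have i2: "set_integrable lebesgue {0<..<1} (\<lambda>x. (v x)\<^sup>2 * g x)" if "H1_on {0<..<1} \<phi> g" for g
    by (rule set_integrable_continuous_mult[OF cv2 L2_on_integrable]) 
       (use that in \<open>auto simp: H1_on_def intro: lmeasurable_subset_unit\<close>)
  show ?i1 ?i2 using LINT_unit_interval(1) i1[OF Hp] i2[OF Hp] by blast+
  obtain N where N: "negligible N" "\<And>x. x \<in> {0..1} - N \<Longrightarrow> ?d x = g x"
    by (rule wderiv_spike[OF Hp cp]) blast
  have e: "(LINT x:{0<..<1}|lebesgue. (wderiv {0<..<1} v x)\<^sup>2) = integral {0..1} (\<lambda>x. (wderiv {0<..<1} v x)\<^sup>2)"
    "(LINT x:{0<..<1}|lebesgue. (1 - (v x)\<^sup>2)\<^sup>2) = integral {0..1} (\<lambda>x. (1 - (v x)\<^sup>2)\<^sup>2)"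
    "(LINT x:{0<..<1}|lebesgue. (v x)^4 * (sin (\<phi> x))\<^sup>2) = integral {0..1} (\<lambda>x. (v x)^4 * (sin (\<phi> x))\<^sup>2)"
    by (rule LINT_unit_interval(2), use Hv' in \<open>simp add: H1_on_def L2_on_def\<close>)
       (intro LINT_unit_interval_continuous(2) continuous_intros cv cp)+
  have "(LINT x:{0<..<1}|lebesgue. (v x)\<^sup>2 * (?d x)\<^sup>2) = integral {0..1} (\<lambda>x. (v x)\<^sup>2 * (?d x)\<^sup>2)"
    by (rule LINT_unit_interval(2)[OF i1[OF Hd]])
  also have "\<dots> = integral {0..1} (\<lambda>x. (v x)\<^sup>2 * (g x)\<^sup>2)"
    by (rule integral_spike[OF N(1)]) (use N(2) in auto)
  finally have e1: "(LINT x:{0<..<1}|lebesgue. (v x)\<^sup>2 * (?d x)\<^sup>2) = integral {0..1} (\<lambda>x. (v x)\<^sup>2 * (g x)\<^sup>2)" .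
  have "(LINT x:{0<..<1}|lebesgue. (v x)\<^sup>2 * ?d x) = integral {0..1} (\<lambda>x. (v x)\<^sup>2 * ?d x)"
    by (rule LINT_unit_interval(2)[OF i2[OF Hd]])
  also have "\<dots> = integral {0..1} (\<lambda>x. (v x)\<^sup>2 * g x)"
    by (rule integral_spike[OF N(1)]) (use N(2) in auto)
  finally have e2: "(LINT x:{0<..<1}|lebesgue. (v x)\<^sup>2 * ?d x) = integral {0..1} (\<lambda>x. (v x)\<^sup>2 * g x)" .
  show ?eq unfolding G_def Let_def good e e1 e2 well_energy_def by simp
qed

lemma good_set_pos:
  assumes "\<And>x. x \<in> {0..1} \<Longrightarrow> v x > 0"
  shows "good_set v = {0<..<1}" "{0..1} - zero_set v = {0..1}"
  using assms by (force simp: good_set_def zero_set_def)+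

lemma well_energy_1: "well_energy \<epsilon> (\<lambda>_. 1) = 0"
proof -
  have "H1_on {0<..<1} (\<lambda>_. 1) (\<lambda>_. 0)"
    by (rule H1_on_unit_piecewise[where S = "{}"]) (auto intro: L2_on_const lmeasurable_subset_unit)
  then obtain N where N: "negligible N" "\<And>x. x \<in> {0..1} - N \<Longrightarrow> wderiv {0<..<1} (\<lambda>_. 1) x = 0"
    using wderiv_spike[of "\<lambda>_. 1" "\<lambda>_. 0"] by auto
  have "integral {0..1} (\<lambda>x. (wderiv {0<..<1} (\<lambda>_. 1) x)\<^sup>2) = integral {0..1} (\<lambda>x::real. 0::real)"
    by (rule integral_spike[OF N(1)]) (use N(2) in auto)
  then show ?thesis by (simp add: well_energy_def)
qed

text \<open>The competitor is the pair \<open>(1, \<psi>)\<close>: modulus 1 has unit mass and no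
  well energy, so only the phase integrals remain.\<close>

lemma minimizer_upper_bound:
  assumes min: "is_minimizer \<epsilon> \<delta> \<kappa> v \<phi>"
    and der: "\<And>x. x \<in> {0..1} \<Longrightarrow> (\<psi> has_real_derivative \<psi>' x) (at x)"
    and cont: "continuous_on {0..1} \<psi>'" and "\<psi> 0 = 0"
  shows "G \<epsilon> \<delta> \<kappa> v \<phi> \<le> integral {0..1} (\<lambda>x. 1/8 * (\<psi>' x)\<^sup>2 + \<delta>/(8*\<epsilon>\<^sup>2) * (sin (\<psi> x))\<^sup>2 - \<kappa>/2 * \<psi>' x)"
proof -
  have cp: "continuous_on {0..1} \<psi>"
    by (rule DERIV_continuous_on[OF has_field_derivative_at_within[OF der]])
  have H1: "H1_on {0<..<1} (\<lambda>_. 1) (\<lambda>_. 0)"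
    by (rule H1_on_unit_piecewise[where S = "{}"]) (auto intro: L2_on_const lmeasurable_subset_unit)
  have H: "H1_on {0<..<1} \<psi> \<psi>'"
    by (rule H1_on_unit_piecewise[where S = "{}"]) (use cp der cont in \<open>auto intro: L2_on_unit_continuous\<close>)
  have good: "good_set (\<lambda>_. 1) = {0<..<1}" "{0..1} - zero_set (\<lambda>_. 1) = {0..1}"
    using good_set_pos[of "\<lambda>_. 1"] by simp_all
  have "(LINT x:{0<..<1::real}|lebesgue. (1::real)\<^sup>2) = 1"
    using LINT_unit_interval_continuous(2)[of "\<lambda>_. 1"] by simp
  then have "admissible (\<lambda>_. 1) \<psi>"
    using cp H1 H \<open>\<psi> 0 = 0\<close> unfolding admissible_def good by (auto simp del: One_nat_def)
  then have "G \<epsilon> \<delta> \<kappa> v \<phi> \<le> G \<epsilon> \<delta> \<kappa> (\<lambda>_. 1) \<psi>" using min by (auto simp: is_minimizer_def)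
  also have "\<dots> = 1/8 * integral {0..1} (\<lambda>x. (\<psi>' x)\<^sup>2)
    + \<delta>/(8*\<epsilon>\<^sup>2) * integral {0..1} (\<lambda>x. (sin (\<psi> x))\<^sup>2) - \<kappa>/2 * integral {0..1} \<psi>'"
    by (subst G_unit[OF _ _ good(1) cp H]) (use H1 in \<open>auto simp: well_energy_1\<close>)
  also have "\<dots> = integral {0..1} (\<lambda>x. 1/8 * (\<psi>' x)\<^sup>2 + \<delta>/(8*\<epsilon>\<^sup>2) * (sin (\<psi> x))\<^sup>2 - \<kappa>/2 * \<psi>' x)"
    by (subst Henstock_Kurzweil_Integration.integral_diff,
        (intro integrable_continuous_real continuous_intros cp cont)+,
        subst Henstock_Kurzweil_Integration.integral_add,
        (intro integrable_continuous_real continuous_intros cp cont)+) simp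
  finally show ?thesis .
qed

section \<open>Uniform closeness of the modulus to 1\<close>

lemma Cauchy_Schwarz_unit_weight:
  fixes g :: "real \<Rightarrow> real"
  assumes "(g has_integral I) {p..q}" "(\<lambda>x. (g x)\<^sup>2) integrable_on {p..q}" "p < q"
  shows "I\<^sup>2 \<le> (q - p) * integral {p..q} (\<lambda>x. (g x)\<^sup>2)"
proof -
  \<comment> \<open>\<open>c\<close> is the mean of \<open>g\<close>; the inequality is the
    integrated form of \<open>(g x - c)\<^sup>2 \<ge> 0\<close>.\<close>
  define c where "c = I / (q - p)"
  have hi: "((\<lambda>x. (g x)\<^sup>2 - 2 * c * g x + c\<^sup>2) has_integral 
      (integral {p..q} (\<lambda>x. (g x)\<^sup>2) - 2 * c * I + (q - p) * c\<^sup>2)) {p..q}"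
    using has_integral_const_real[of "c\<^sup>2" p q] assms
    by (intro has_integral_add has_integral_diff has_integral_mult_right integrable_integral) auto
  have "(g x)\<^sup>2 - 2 * c * g x + c\<^sup>2 = (g x - c)\<^sup>2" for x
    by (simp add: power2_eq_square algebra_simps)
  then have "0 \<le> (g x)\<^sup>2 - 2 * c * g x + c\<^sup>2" for x by simp
  then have "0 \<le> integral {p..q} (\<lambda>x. (g x)\<^sup>2) - 2 * c * I + (q - p) * c\<^sup>2"
    by (rule has_integral_nonneg[OF hi])
  then have "0 \<le> (q - p) * (integral {p..q} (\<lambda>x. (g x)\<^sup>2) - 2 * c * I + (q - p) * c\<^sup>2)"
    using assms by simp
  also have "\<dots> = (q - p) * integral {p..q} (\<lambda>x. (g x)\<^sup>2) - I\<^sup>2"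
  proof -
    have I: "I = c * (q - p)" using assms(3) by (simp add: c_def)
    show ?thesis unfolding I by (simp add: power2_eq_square algebra_simps)
  qed
  finally show ?thesis by simp
qed

lemma H1_on_unit_Hoelder:
  assumes H: "H1_on {0<..<1} f g" "continuous_on {0..1} f" and "x \<in> {0..1}" "y \<in> {0..1}"
  shows "(f y - f x)\<^sup>2 \<le> \<bar>y - x\<bar> * integral {0..1} (\<lambda>x. (g x)\<^sup>2)"
proof -
  have *: "(f q - f p)\<^sup>2 \<le> (q - p) * integral {0..1} (\<lambda>x. (g x)\<^sup>2)" if "0 \<le> p" "p < q" "q \<le> 1" for p q
  proof -
    note sq = H1_on_unit_square_integrable[OF H(1)]
    have sqpq: "(\<lambda>x. (g x)\<^sup>2) integrable_on {p..q}"
      using sq by (rule integrable_on_subinterval) (use that in auto)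
    have "(f q - f p)\<^sup>2 \<le> (q - p) * integral {p..q} (\<lambda>x. (g x)\<^sup>2)"
      using H1_on_unit_FTC[OF H, of p q] that sqpq by (intro Cauchy_Schwarz_unit_weight) auto
    also have "\<dots> \<le> (q - p) * integral {0..1} (\<lambda>x. (g x)\<^sup>2)"
      using that sq sqpq by (intro mult_left_mono integral_subset_le) auto
    finally show ?thesis .
  qed
  show ?thesis
    using *[of x y] *[of y x] assms by (cases "x = y"; cases "x < y") (auto simp: power2_commute)
qed

text \<open>If \<open>v\<close> is off 1 by \<open>m\<close> at \<open>x\<close>, the Hoelder
  estimate with \<open>A\<close> the integral of \<open>v'\<^sup>2\<close> keeps it off by
  \<open>m / 2\<close> on an interval of length \<open>m\<^sup>2 / (4 * A)\<close>. This costs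
  potential energy: \<open>m^4 \<le> 16 * A * B\<close>. Bounding \<open>A\<close> and
  \<open>B\<close> by the well energy gives the claim.\<close>

lemma sup_bound_by_well_energy:
  assumes adm: "admissible v \<phi>" and nn: "\<And>x. x \<in> {0..1} \<Longrightarrow> v x \<ge> 0" and "\<epsilon> > 0" and x: "x \<in> {0..1}"
  shows "(v x - 1)\<^sup>2 \<le> 12 * \<epsilon> * well_energy \<epsilon> v"
proof (cases "v x = 1")
  case True
  then show ?thesis using \<open>\<epsilon> > 0\<close> well_energy_nonneg by simp
next
  case False
  let ?g = "wderiv {0<..<1} v"
  define A where "A = integral {0..1} (\<lambda>x. (?g x)\<^sup>2)"
  define B where "B = integral {0..1} (\<lambda>x. (1 - (v x)\<^sup>2)\<^sup>2)"
  have cv: "continuous_on {0..1} v" and H: "H1_on {0<..<1} v ?g" 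
    and mass: "(LINT x:{0<..<1}|lebesgue. (v x)\<^sup>2) = 1"
    using adm by (auto simp: admissible_def intro: H1_on_wderiv)
  have cv2: "continuous_on {0..1} (\<lambda>x. (v x)\<^sup>2)" by (intro continuous_intros cv)
  then have mass': "integral {0..1} (\<lambda>x. (v x)\<^sup>2) = 1" using mass LINT_unit_interval_continuous(2) by metis
  note Hoe = H1_on_unit_Hoelder[OF H cv, folded A_def]
  \<comment> \<open>Unit mass puts 1 between the minimum and the maximum of
    \<open>v\<close>.\<close>
  obtain x0 where x0: "x0 \<in> {0..1}" "v x0 = 1"
  proof -
    obtain a where a: "a \<in> {0..1}" "\<And>x. x \<in> {0..1} \<Longrightarrow> v a \<le> v x"
      using continuous_attains_inf[OF compact_Icc _ cv] by auto
    obtain b where b: "b \<in> {0..1}" "\<And>x. x \<in> {0..1} \<Longrightarrow> v x \<le> v b"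
      using continuous_attains_sup[OF compact_Icc _ cv] by auto
    have "integral {0..1} (\<lambda>x::real. (v a)\<^sup>2) \<le> integral {0..1} (\<lambda>x. (v x)\<^sup>2)"
      by (rule integral_le[OF _ integrable_continuous_real[OF cv2]]) (use a nn in \<open>auto intro: power_mono\<close>)
    then have "v a \<le> 1" using mass' nn[OF a(1)] by (simp add: power2_le_iff_abs_le abs_square_le_1)
    have "integral {0..1} (\<lambda>x. (v x)\<^sup>2) \<le> integral {0..1} (\<lambda>x::real. (v b)\<^sup>2)"
      by (rule integral_le[OF integrable_continuous_real[OF cv2]]) (use b nn in \<open>auto intro: power_mono\<close>)
    then have "1 \<le> (v b)\<^sup>2" using mass' by simp
    then have "1 \<le> v b" using nn[OF b(1)] by (metis abs_1 abs_le_square_iff abs_of_nonneg one_power2)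
    have "connected (v ` {0..1})" by (intro connected_continuous_image cv) auto
    then have "{v a..v b} \<subseteq> v ` {0..1}"
      using a(1) b(1) by (intro connected_contains_Icc) auto
    then have "1 \<in> v ` {0..1}" using \<open>v a \<le> 1\<close> \<open>1 \<le> v b\<close> by auto
    then show thesis using that by force
  qed
  define m where "m = \<bar>v x - 1\<bar>"
  have m: "m > 0" using False by (simp add: m_def)
  have "m\<^sup>2 \<le> \<bar>x0 - x\<bar> * A" using Hoe[OF x x0(1)] x0(2) by (simp add: m_def power2_commute)
  moreover have "A \<ge> 0" unfolding A_def by (rule integral_nonneg) (use H1_on_unit_square_integrable[OF H] in auto)
  ultimately have A: "A > 0" using m by (cases "A = 0") auto
  define l where "l = m\<^sup>2 / (4 * A)"
  have lA: "l * A = m\<^sup>2 / 4" using A by (simp add: l_def)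
  then have "l * A \<le> \<bar>x0 - x\<bar> * A" using \<open>m\<^sup>2 \<le> \<bar>x0 - x\<bar> * A\<close> zero_le_power2[of m] by linarith
  then have "l \<le> \<bar>x0 - x\<bar>" using A by (rule mult_right_le_imp_le)
  moreover have "l > 0" using A m by (simp add: l_def)
  ultimately have l: "l > 0" "l \<le> \<bar>x0 - x\<bar>" by auto
  \<comment> \<open>The interval of length \<open>l\<close> is laid from \<open>x\<close> towards
    \<open>x0\<close>, so it stays inside {0..1}.\<close>
  define p where "p = (if x0 \<ge> x then x else x - l)"
  have p: "0 \<le> p" "p + l \<le> 1" "\<And>y. y \<in> {p..p+l} \<Longrightarrow> \<bar>y - x\<bar> \<le> l"
    using l x x0 by (auto simp: p_def split: if_splits)
  have low: "m\<^sup>2 / 4 \<le> (1 - (v y)\<^sup>2)\<^sup>2" if "y \<in> {p..p+l}" for y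
  proof -
    have y: "y \<in> {0..1}" using that p by auto
    have "(v y - v x)\<^sup>2 \<le> \<bar>y - x\<bar> * A" by (rule Hoe[OF x y])
    also have "\<dots> \<le> l * A" using p(3)[OF that] A by simp
    also have "\<dots> = (m / 2)\<^sup>2" unfolding lA by (simp add: power2_eq_square)
    finally have "\<bar>v y - v x\<bar> \<le> m / 2" using m by (simp add: power2_le_iff_abs_le)
    moreover have "\<bar>v x - 1\<bar> \<le> \<bar>v y - v x\<bar> + \<bar>v y - 1\<bar>"
      using abs_triangle_ineq[of "v x - v y" "v y - 1"] by (simp add: abs_minus_commute)
    moreover have "a \<le> m / 2 \<Longrightarrow> m \<le> a + b \<Longrightarrow> m / 2 \<le> b" for a b by linarith
    ultimately have h: "m / 2 \<le> \<bar>v y - 1\<bar>" unfolding m_def by blast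
    have "m\<^sup>2 / 4 = (m / 2)\<^sup>2" by (simp add: power2_eq_square)
    also have "\<dots> \<le> \<bar>v y - 1\<bar>\<^sup>2" using h m by (intro power_mono) auto
    \<comment> \<open>Here \<open>v \<ge> 0\<close> enters: it excludes the well at -1 by making
      \<open>1 + v\<close> at least 1.\<close>
    also have "\<dots> \<le> (\<bar>v y - 1\<bar> * (1 + v y))\<^sup>2"
      using nn[OF y] by (intro power_mono) (auto simp: algebra_simps)
    also have "\<dots> = (1 - (v y)\<^sup>2)\<^sup>2" by (simp add: power_mult_distrib power2_eq_square algebra_simps)
    finally show ?thesis .
  qed
  have cB: "continuous_on {0..1} (\<lambda>x. (1 - (v x)\<^sup>2)\<^sup>2)" by (intro continuous_intros cv)
  have cBp: "continuous_on {p..p+l} (\<lambda>x. (1 - (v x)\<^sup>2)\<^sup>2)"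
    using cB by (rule continuous_on_subset) (use p in auto)
  have "l * (m\<^sup>2 / 4) = integral {p..p+l} (\<lambda>x::real. m\<^sup>2 / 4)" using l by simp
  also have "\<dots> \<le> integral {p..p+l} (\<lambda>x. (1 - (v x)\<^sup>2)\<^sup>2)"
    by (rule integral_le[OF _ integrable_continuous_real[OF cBp]]) (use low in auto)
  also have "\<dots> \<le> B" unfolding B_def
    using p by (intro integral_subset_le integrable_continuous_real cB cBp) auto
  finally have "l * (m\<^sup>2 / 4) \<le> B" .
  then have "(l * (m\<^sup>2 / 4)) * A \<le> B * A" using A by (intro mult_right_mono) auto
  also have "(l * (m\<^sup>2 / 4)) * A = (m\<^sup>2 / 4) * (m\<^sup>2 / 4)" using lA by (metis mult.assoc mult.commute)
  finally have mAB: "m\<^sup>2 * m\<^sup>2 \<le> 16 * A * B" by (simp add: algebra_simps)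
  have "B \<ge> 0" unfolding B_def by (rule integral_nonneg) (auto intro: integrable_continuous_real cB)
  have E: "well_energy \<epsilon> v = A / 2 + B / (4 * \<epsilon>\<^sup>2)" by (simp add: well_energy_def A_def B_def)
  have "A \<le> 2 * well_energy \<epsilon> v" using E \<open>B \<ge> 0\<close> by simp
  moreover have "B \<le> 4 * \<epsilon>\<^sup>2 * well_energy \<epsilon> v" using E A \<open>\<epsilon> > 0\<close> by (simp add: field_simps)
  ultimately have "A * B \<le> (2 * well_energy \<epsilon> v) * (4 * \<epsilon>\<^sup>2 * well_energy \<epsilon> v)"
    using A \<open>B \<ge> 0\<close> by (intro mult_mono) auto
  then have "(m\<^sup>2)\<^sup>2 \<le> 128 * (\<epsilon> * well_energy \<epsilon> v)\<^sup>2"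
    using mAB by (simp add: power2_eq_square algebra_simps)
  \<comment> \<open>The constant 12 comes from \<open>128 \<le> 12\<^sup>2\<close>, where 128 is 16
    times 2 times 4.\<close>
  also have "\<dots> \<le> (12 * \<epsilon> * well_energy \<epsilon> v)\<^sup>2"
    using zero_le_power2[of "\<epsilon> * well_energy \<epsilon> v"] by (simp add: power_mult_distrib)
  finally have "m\<^sup>2 \<le> 12 * \<epsilon> * well_energy \<epsilon> v"
    by (rule power2_le_imp_le) (use \<open>\<epsilon> > 0\<close> well_energy_nonneg in simp)
  then show ?thesis by (simp add: m_def)
qed

section \<open>First variation in the phase\<close>

lemma sin_Lipschitz: "\<bar>sin x - sin y\<bar> \<le> \<bar>x - y\<bar>" for x y :: real
proof -
  have "\<bar>sin x - sin y\<bar> = 2 * \<bar>sin ((x - y) / 2)\<bar> * \<bar>cos ((x + y) / 2)\<bar>"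
    by (simp add: sin_diff_sin abs_mult)
  also have "\<dots> \<le> 2 * \<bar>(x - y) / 2\<bar> * 1"
    by (intro mult_mono abs_sin_x_le_abs_x abs_cos_le_one) auto
  finally show ?thesis by simp
qed

text \<open>The second derivative of the squared sine is at most 2; in the proof the difference of
  the two sides has a derivative with the sign of \<open>b\<close>. This one-sided expansion bounds
  the energy of \<open>\<phi> + t * \<zeta>\<close> by a quadratic polynomial in \<open>t\<close>,
  which replaces differentiation under the integral.\<close>

lemma sin_square_second_order:
  fixes a b :: real
  shows "(sin (a + b))\<^sup>2 \<le> (sin a)\<^sup>2 + b * sin (2 * a) + b\<^sup>2"
proof -
  let ?h = "\<lambda>b. (sin a)\<^sup>2 + b * sin (2 * a) + b\<^sup>2 - (sin (a + b))\<^sup>2"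
  have d: "(?h has_real_derivative sin (2 * a) + 2 * b - sin (2 * (a + b))) (at b)" for b
    unfolding sin_double[of "a + b"]
    by (auto intro!: derivative_eq_intros simp: power2_eq_square)
  have L: "\<bar>sin (2 * (a + b)) - sin (2 * a)\<bar> \<le> 2 * \<bar>b\<bar>" for b
    using sin_Lipschitz[of "2 * (a + b)" "2 * a"] by simp
  have "?h 0 \<le> ?h b"
  proof (cases "b \<ge> 0")
    case True
    show ?thesis
    proof (rule DERIV_nonneg_imp_nondecreasing[OF True])
      fix x assume "0 \<le> x" "x \<le> b"
      then have "0 \<le> sin (2 * a) + 2 * x - sin (2 * (a + x))" using L[of x] by linarith
      then show "\<exists>y. (?h has_real_derivative y) (at x) \<and> 0 \<le> y" using d[of x] by blast
    qed
  next
    case False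
    then have "b \<le> 0" by simp
    then show ?thesis
    proof (rule DERIV_nonpos_imp_nonincreasing)
      fix x assume "b \<le> x" "x \<le> 0"
      then have "sin (2 * a) + 2 * x - sin (2 * (a + x)) \<le> 0" using L[of x] by linarith
      then show "\<exists>y. (?h has_real_derivative y) (at x) \<and> y \<le> 0" using d[of x] by blast
    qed
  qed
  then show ?thesis by simp
qed

lemma linear_coefficient_zero:
  fixes P Q :: real
  assumes "\<And>t. 0 \<le> t * P + t\<^sup>2 * Q"
  shows "P = 0"
proof (rule ccontr)
  assume "P \<noteq> 0"
  \<comment> \<open>At \<open>t = - (s * P)\<close> the linear term beats the quadratic one because
    \<open>s * \<bar>Q\<bar> < 1\<close>.\<close>
  define s where "s = 1 / (\<bar>Q\<bar> + 1)"
  have s: "s > 0" "s * \<bar>Q\<bar> < 1" by (auto simp: s_def field_simps)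
  have "0 \<le> (- (s * P)) * P + (- (s * P))\<^sup>2 * Q" by (rule assms)
  also have "\<dots> = s * P\<^sup>2 * (s * Q - 1)" by (simp add: power2_eq_square algebra_simps)
  also have "\<dots> < 0"
  proof -
    have "s * Q \<le> s * \<bar>Q\<bar>" using s by (intro mult_left_mono) auto
    then have "s * Q - 1 < 0" using s by linarith
    then show ?thesis using s \<open>P \<noteq> 0\<close> by (intro mult_pos_neg) auto
  qed
  finally show False by simp
qed

lemma H1_on_unit_add_scaled:
  assumes "H1_on {0<..<1} f g" "H1_on {0<..<1} f' g'"
  shows "H1_on {0<..<1} (\<lambda>x. f x + t * f' x) (\<lambda>x. g x + t * g' x)"
proof -
  have L2: "L2_on {0<..<1} (\<lambda>x. p x + t * q x)" if p: "L2_on {0<..<1} p" and q: "L2_on {0<..<1} q" for p q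
  proof -
    have "set_borel_measurable lebesgue {0<..<1} (\<lambda>x. p x + t * q x)"
    proof -
      have "(\<lambda>x. indicat_real {0<..<1} x *\<^sub>R p x + t * (indicat_real {0<..<1} x *\<^sub>R q x)) \<in> borel_measurable lebesgue"
        using p q unfolding L2_on_def set_borel_measurable_def by (intro borel_measurable_add borel_measurable_times) auto
      moreover have "(\<lambda>x. indicat_real {0<..<1} x *\<^sub>R p x + t * (indicat_real {0<..<1} x *\<^sub>R q x))
          = (\<lambda>x. indicat_real {0<..<1} x *\<^sub>R (p x + t * q x))" by (simp add: fun_eq_iff algebra_simps)
      ultimately show ?thesis unfolding set_borel_measurable_def by simp
    qed
    moreover have "set_integrable lebesgue {0<..<1} (\<lambda>x. (p x)\<^sup>2 + 2 * t * (p x * q x) + t\<^sup>2 * (q x)\<^sup>2)"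
      using p q L2_on_mult_integrable[OF p q]
      by (intro set_integral_add(1) set_integrable_mult_right) (auto simp: L2_on_def)
    moreover have "(p x)\<^sup>2 + 2 * t * (p x * q x) + t\<^sup>2 * (q x)\<^sup>2 = (p x + t * q x)\<^sup>2" for x
      by (simp add: power2_eq_square algebra_simps)
    ultimately show ?thesis by (simp add: L2_on_def)
  qed
  have "(LINT x:{0<..<1}|lebesgue. (f x + t * f' x) * D 1 x) = - (LINT x:{0<..<1}|lebesgue. (g x + t * g' x) * D 0 x)"
    if D: "test_fun {0<..<1} D" for D
  proof -
    have dD: "(D k has_real_derivative D (Suc k) x) (at x)" for k x using D by (auto simp: test_fun_def)
    have LD: "L2_on {0<..<1} (D k)" for k
      by (rule L2_on_unit_continuous[OF DERIV_continuous_on[OF has_field_derivative_at_within[OF dD]]]) auto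
    have split: "(LINT x:{0<..<1}|lebesgue. (p x + t * q x) * D k x) =
        (LINT x:{0<..<1}|lebesgue. p x * D k x) + t * (LINT x:{0<..<1}|lebesgue. q x * D k x)"
      if p: "L2_on {0<..<1} p" and q: "L2_on {0<..<1} q" for p q k
    proof -
      have "(LINT x:{0<..<1}|lebesgue. (p x + t * q x) * D k x) =
        (LINT x:{0<..<1}|lebesgue. p x * D k x + t * (q x * D k x))" by (simp add: algebra_simps)
      also have "\<dots> = (LINT x:{0<..<1}|lebesgue. p x * D k x) + (LINT x:{0<..<1}|lebesgue. t * (q x * D k x))"
        by (intro set_integral_add(2) set_integrable_mult_right L2_on_mult_integrable p q LD)
      finally show ?thesis by simp
    qed
    show ?thesis using assms D by (simp add: H1_on_def split[of f f'] split[of g g'])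
  qed
  then show ?thesis using assms by (auto simp: H1_on_def intro: L2)
qed

text \<open>For each \<open>x\<close> one explicit variation is used, with derivative
  \<open>1 / v\<^sup>2\<close> on {0..x} and 0 beyond. This weight cancels the factor
  \<open>v\<^sup>2\<close>, so the gradient term of the first variation evaluates to
  \<open>\<phi> x\<close> by the fundamental theorem: the integrated equation comes out pointwise,
  without regularity of the weak derivative of \<open>\<phi>\<close>, and can then be
  differentiated.\<close>

lemma minimizer_Euler_Lagrange:
  assumes min: "is_minimizer \<epsilon> \<delta> \<kappa> v \<phi>" and \<epsilon>: "\<epsilon> > 0" and \<delta>: "\<delta> > 0"
    and pos: "\<And>x. x \<in> {0..1} \<Longrightarrow> v x > 0"
  obtains M where "M 1 = 0"
    "\<And>x. x \<in> {0..1} \<Longrightarrow> (M has_real_derivative - (\<delta>/\<epsilon>\<^sup>2 * (v x)^4 * (sin (\<phi> x) * cos (\<phi> x)))) (at x within {0..1})"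
    "\<And>x. x \<in> {0..1} \<Longrightarrow> (\<phi> has_real_derivative 2 * \<kappa> - M x / (v x)\<^sup>2) (at x within {0..1})"
proof -
  have good: "good_set v = {0<..<1}" "{0..1} - zero_set v = {0..1}"
    using good_set_pos[of v] pos by auto
  have adm: "admissible v \<phi>" using min by (simp add: is_minimizer_def)
  have cv: "continuous_on {0..1} v" and Hv: "\<exists>g. H1_on {0<..<1} v g" and cp: "continuous_on {0..1} \<phi>"
    and p0: "\<phi> 0 = 0" and mass: "(LINT x:{0<..<1}|lebesgue. (v x)\<^sup>2) = 1"
    and Hp: "\<exists>g. H1_on {0<..<1} \<phi> g"
    using adm good by (simp_all add: admissible_def)
  then obtain g where g: "H1_on {0<..<1} \<phi> g" by blast
  define c where "c = \<delta> / (8 * \<epsilon>\<^sup>2)"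
  define m where "m = (\<lambda>x. (v x)^4 * sin (2 * \<phi> x))"
  have cm: "continuous_on {0..1} m" unfolding m_def by (intro continuous_intros cv cp)
  \<comment> \<open>A tail integral, so that \<open>Mm 1 = 0\<close>: the natural boundary condition
    at the free end 1.\<close>
  define Mm where "Mm = (\<lambda>x. integral {0..1} m - integral {0..x} m)"
  have dMm: "(Mm has_real_derivative - m x) (at x within {0..1})" if "x \<in> {0..1}" for x
    unfolding Mm_def by (auto intro!: derivative_eq_intros integral_has_real_derivative[OF cm] that)
  have cMm: "continuous_on {0..1} Mm" by (rule DERIV_continuous_on[OF dMm])
  define V where "V = (\<lambda>x. integral {0..x} (\<lambda>y. 1 / (v y)\<^sup>2))"
  have v0: "v x \<noteq> 0" if "x \<in> {0..1}" for x using pos[OF that] by simp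
  have civ: "continuous_on {0..1} (\<lambda>y. 1 / (v y)\<^sup>2)" using v0 by (auto intro!: continuous_intros cv)
  have dV: "(V has_real_derivative 1 / (v x)\<^sup>2) (at x within {0..1})" if "x \<in> {0..1}" for x
    unfolding V_def by (rule integral_has_real_derivative[OF civ that])
  have cV: "continuous_on {0..1} V" by (rule DERIV_continuous_on[OF dV])
  have interior: "at y within {0..1} = at y" if "0 < y" "y < 1" for y :: real
    by (rule at_within_interior) (use that in auto)
  have V0: "V 0 = 0" by (simp add: V_def)
  have main: "\<phi> x / 4 + c * integral {0..x} (\<lambda>y. Mm y / (v y)\<^sup>2) - \<kappa> * x / 2 = 0" if x: "x \<in> {0..1}" for x
  proof -
    define z where "z = (\<lambda>y. if y \<in> {0..x} then 1 / (v y)\<^sup>2 else 0)"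
    define \<zeta> where "\<zeta> = (\<lambda>y. V (min y x))"
    have c\<zeta>: "continuous_on {0..1} \<zeta>" unfolding \<zeta>_def
      by (rule continuous_on_compose2[OF cV]) (use x in \<open>auto intro!: continuous_intros\<close>)
    have \<zeta>0: "\<zeta> 0 = 0" using x by (simp add: \<zeta>_def V0)
    have d\<zeta>: "(\<zeta> has_real_derivative z y) (at y)" if y: "y \<in> {0<..<1} - {x}" for y
    proof (cases "y < x")
      case True
      have "(V has_real_derivative 1 / (v y)\<^sup>2) (at y)" using dV[of y] y interior[of y] by auto
      then have "(\<zeta> has_real_derivative 1 / (v y)\<^sup>2) (at y)"
        by (rule has_field_derivative_transform_within_open[of _ _ _ "{..<x}"]) (use True in \<open>auto simp: \<zeta>_def min_def\<close>)
      then show ?thesis using True y by (simp add: z_def)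
    next
      case False
      have "((\<lambda>_. V x) has_real_derivative 0) (at y)" by simp
      then have "(\<zeta> has_real_derivative 0) (at y)"
        by (rule has_field_derivative_transform_within_open[of _ _ _ "{x<..}"]) (use False y in \<open>auto simp: \<zeta>_def min_def\<close>)
      then show ?thesis using False y by (simp add: z_def)
    qed
    obtain B where B: "\<And>y. y \<in> {0..1} \<Longrightarrow> \<bar>1 / (v y)\<^sup>2\<bar> \<le> B" by (rule bounded_on_unit[OF civ]) blast
    have L2z: "L2_on {0<..<1} z"
    proof (rule L2_on_bounded[where B = B])
      have "(\<lambda>y. indicat_real ({0<..<1} \<inter> {0..x}) y *\<^sub>R (1 / (v y)\<^sup>2)) \<in> borel_measurable borel"
        by (rule borel_measurable_continuous_on_indicator) (auto intro: continuous_on_subset[OF civ])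
      then have "(\<lambda>y. indicat_real ({0<..<1} \<inter> {0..x}) y *\<^sub>R (1 / (v y)\<^sup>2)) \<in> borel_measurable lebesgue"
        by (intro measurable_completion) simp
      moreover have "(\<lambda>y. indicat_real ({0<..<1} \<inter> {0..x}) y *\<^sub>R (1 / (v y)\<^sup>2)) = (\<lambda>y. indicat_real {0<..<1} y *\<^sub>R z y)"
        by (auto simp: z_def indicator_def fun_eq_iff)
      ultimately show "set_borel_measurable lebesgue {0<..<1} z" by (simp add: set_borel_measurable_def)
      show "\<bar>z y\<bar> \<le> B" if "y \<in> {0<..<1}" for y
        using B[of y] that order_trans[OF abs_ge_zero B[of y]] by (auto simp: z_def)
    qed (auto intro: lmeasurable_subset_unit)
    have Hz: "H1_on {0<..<1} \<zeta> z"
      by (rule H1_on_unit_piecewise[where S = "{x}"]) (use c\<zeta> d\<zeta> L2z in auto)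
    have sub: "{0..x} \<subseteq> {0..1}" using x by auto
    have restr: "((\<lambda>y. if y \<in> {0..x} then f y else 0) has_integral i) {0..1} \<longleftrightarrow> (f has_integral i) {0..x}"
      for f :: "real \<Rightarrow> real" and i by (rule has_integral_restrict[OF sub])
    have i2: "((\<lambda>y. (v y)\<^sup>2 * (g y * z y)) has_integral \<phi> x) {0..1}"
    proof -
      have "(g has_integral \<phi> x) {0..x}" using H1_on_unit_FTC[OF g cp, of 0 x] x p0 by simp
      then have "((\<lambda>y. if y \<in> {0..x} then g y else 0) has_integral \<phi> x) {0..1}" by (simp only: restr)
      then show ?thesis
        by (rule has_integral_eq[rotated]) (use v0 in \<open>auto simp: z_def\<close>)
    qed
    have i3: "((\<lambda>y. (v y)\<^sup>2 * (z y)\<^sup>2) has_integral V x) {0..1}"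
    proof -
      have "((\<lambda>y. 1 / (v y)\<^sup>2) has_integral V x) {0..x}" unfolding V_def
        by (intro integrable_integral integrable_continuous_real continuous_on_subset[OF civ] sub)
      then have "((\<lambda>y. if y \<in> {0..x} then 1 / (v y)\<^sup>2 else 0) has_integral V x) {0..1}" by (simp only: restr)
      then show ?thesis
        by (rule has_integral_eq[rotated]) (use v0 in \<open>auto simp: z_def power2_eq_square\<close>)
    qed
    have i4: "((\<lambda>y. (v y)\<^sup>2 * z y) has_integral x) {0..1}"
    proof -
      have "((\<lambda>y. 1) has_integral x) {0..x}" using has_integral_const_real[of "1::real" 0 x] x by simp
      then have "((\<lambda>y. if y \<in> {0..x} then 1 else 0) has_integral x) {0..1}" by (simp only: restr)
      then show ?thesis
        by (rule has_integral_eq[rotated]) (use v0 in \<open>auto simp: z_def\<close>)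
    qed
    \<comment> \<open>Integration by parts moves \<open>m\<close> to its primitive;
      \<open>Mm 1 = 0\<close> and \<open>\<zeta> 0 = 0\<close> remove the boundary terms.\<close>
    have i5: "((\<lambda>y. m y * \<zeta> y) has_integral integral {0..x} (\<lambda>y. Mm y / (v y)\<^sup>2)) {0..1}"
    proof -
      have "((\<lambda>y. Mm y * z y - m y * \<zeta> y) has_integral (Mm 1 * \<zeta> 1 - Mm 0 * \<zeta> 0)) {0..1}"
      proof (rule fundamental_theorem_of_calculus_interior_strong[of "{x}"])
        fix y assume y: "y \<in> {0<..<1} - {x}"
        have "(Mm has_real_derivative - m y) (at y)" using dMm[of y] y interior[of y] by auto
        from DERIV_mult[OF this d\<zeta>[OF y]]
        show "((\<lambda>y. Mm y * \<zeta> y) has_vector_derivative Mm y * z y - m y * \<zeta> y) (at y)"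
          by (simp add: has_real_derivative_iff_has_vector_derivative algebra_simps)
      qed (auto intro!: continuous_intros cMm c\<zeta>)
      then have a: "((\<lambda>y. Mm y * z y - m y * \<zeta> y) has_integral 0) {0..1}" using \<zeta>0 by (simp add: Mm_def)
      have "((\<lambda>y. Mm y / (v y)\<^sup>2) has_integral integral {0..x} (\<lambda>y. Mm y / (v y)\<^sup>2)) {0..x}"
        by (intro integrable_integral integrable_continuous_real continuous_on_subset[OF _ sub])
           (use v0 in \<open>auto intro!: continuous_intros cMm cv\<close>)
      then have "((\<lambda>y. if y \<in> {0..x} then Mm y / (v y)\<^sup>2 else 0) has_integral integral {0..x} (\<lambda>y. Mm y / (v y)\<^sup>2)) {0..1}"
        by (simp only: restr)
      then have "((\<lambda>y. Mm y * z y) has_integral integral {0..x} (\<lambda>y. Mm y / (v y)\<^sup>2)) {0..1}"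
        by (rule has_integral_eq[rotated]) (auto simp: z_def)
      from has_integral_diff[OF this a] show ?thesis by simp
    qed
    define m2 where "m2 = integral {0..1} (\<lambda>y. (v y)^4 * (\<zeta> y)\<^sup>2)"
    have i6: "((\<lambda>y. (v y)^4 * (\<zeta> y)\<^sup>2) has_integral m2) {0..1}" unfolding m2_def
      by (intro integrable_integral integrable_continuous_real continuous_intros cv c\<zeta>)
    note Gt = G_unit[OF cv Hv good(1)]
    have "0 \<le> t * (\<phi> x / 4 + c * integral {0..x} (\<lambda>y. Mm y / (v y)\<^sup>2) - \<kappa> * x / 2) + t\<^sup>2 * (V x / 8 + c * m2)" for t
    proof -
      let ?\<phi> = "\<lambda>y. \<phi> y + t * \<zeta> y" and ?g = "\<lambda>y. g y + t * z y"
      have Ht: "H1_on {0<..<1} ?\<phi> ?g" by (rule H1_on_unit_add_scaled[OF g Hz])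
      have ct: "continuous_on {0..1} ?\<phi>" by (intro continuous_intros cp c\<zeta>)
      have "admissible v ?\<phi>"
        using cv Hv ct Ht p0 \<zeta>0 mass unfolding admissible_def good by auto
      then have le: "G \<epsilon> \<delta> \<kappa> v \<phi> \<le> G \<epsilon> \<delta> \<kappa> v ?\<phi>" using min by (simp add: is_minimizer_def)
      have "((\<lambda>y. (v y)\<^sup>2 * (g y)\<^sup>2 + (2 * t) * ((v y)\<^sup>2 * (g y * z y)) + t\<^sup>2 * ((v y)\<^sup>2 * (z y)\<^sup>2)) has_integral
          (integral {0..1} (\<lambda>x. (v x)\<^sup>2 * (g x)\<^sup>2) + (2 * t) * \<phi> x + t\<^sup>2 * V x)) {0..1}"
        by (intro has_integral_add has_integral_mult_right integrable_integral Gt(2)[OF cp g] i2 i3)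
      moreover have "(v y)\<^sup>2 * (g y)\<^sup>2 + (2 * t) * ((v y)\<^sup>2 * (g y * z y)) + t\<^sup>2 * ((v y)\<^sup>2 * (z y)\<^sup>2) = (v y)\<^sup>2 * (?g y)\<^sup>2" for y
        by (simp add: power2_eq_square algebra_simps)
      ultimately have e1: "integral {0..1} (\<lambda>y. (v y)\<^sup>2 * (?g y)\<^sup>2) = integral {0..1} (\<lambda>x. (v x)\<^sup>2 * (g x)\<^sup>2) + (2 * t) * \<phi> x + t\<^sup>2 * V x"
        by (simp add: integral_unique)
      have "((\<lambda>y. (v y)\<^sup>2 * g y + t * ((v y)\<^sup>2 * z y)) has_integral (integral {0..1} (\<lambda>x. (v x)\<^sup>2 * g x) + t * x)) {0..1}"
        by (intro has_integral_add has_integral_mult_right integrable_integral Gt(3)[OF cp g] i4)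
      moreover have "(v y)\<^sup>2 * g y + t * ((v y)\<^sup>2 * z y) = (v y)\<^sup>2 * ?g y" for y by (simp add: algebra_simps)
      ultimately have e2: "integral {0..1} (\<lambda>y. (v y)\<^sup>2 * ?g y) = integral {0..1} (\<lambda>x. (v x)\<^sup>2 * g x) + t * x"
        by (simp add: integral_unique)
      have h: "((\<lambda>y. (v y)^4 * (sin (\<phi> y))\<^sup>2 + t * (m y * \<zeta> y) + t\<^sup>2 * ((v y)^4 * (\<zeta> y)\<^sup>2)) has_integral
          (integral {0..1} (\<lambda>y. (v y)^4 * (sin (\<phi> y))\<^sup>2) + t * integral {0..x} (\<lambda>y. Mm y / (v y)\<^sup>2) + t\<^sup>2 * m2)) {0..1}"
        by (intro has_integral_add has_integral_mult_right i5 i6 integrable_integral integrable_continuous_real continuous_intros cv cp)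
      have "integral {0..1} (\<lambda>y. (v y)^4 * (sin (?\<phi> y))\<^sup>2) \<le> 
         integral {0..1} (\<lambda>y. (v y)^4 * (sin (\<phi> y))\<^sup>2) + t * integral {0..x} (\<lambda>y. Mm y / (v y)\<^sup>2) + t\<^sup>2 * m2"
        unfolding integral_unique[OF h, symmetric]
      proof (rule integral_le)
        fix y :: real
        have "(v y)^4 * (sin (?\<phi> y))\<^sup>2 \<le> (v y)^4 * ((sin (\<phi> y))\<^sup>2 + t * \<zeta> y * sin (2 * \<phi> y) + (t * \<zeta> y)\<^sup>2)"
          by (intro mult_left_mono sin_square_second_order) auto
        then show "(v y)^4 * (sin (?\<phi> y))\<^sup>2 \<le> (v y)^4 * (sin (\<phi> y))\<^sup>2 + t * (m y * \<zeta> y) + t\<^sup>2 * ((v y)^4 * (\<zeta> y)\<^sup>2)"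
          by (simp add: m_def power_mult_distrib algebra_simps)
      qed (auto intro!: integrable_continuous_real continuous_intros cv cp cm c\<zeta>)
      then have e3: "c * integral {0..1} (\<lambda>y. (v y)^4 * (sin (?\<phi> y))\<^sup>2) \<le> c * (
         integral {0..1} (\<lambda>y. (v y)^4 * (sin (\<phi> y))\<^sup>2) + t * integral {0..x} (\<lambda>y. Mm y / (v y)\<^sup>2) + t\<^sup>2 * m2)"
        using \<delta> by (intro mult_left_mono) (auto simp: c_def)
      show ?thesis
        using le e3 unfolding Gt(1)[OF cp g] Gt(1)[OF ct Ht] e1 e2 c_def[symmetric]
        by (simp add: algebra_simps)
    qed
    then show ?thesis by (rule linear_coefficient_zero)
  qed
  \<comment> \<open>The factor 4 clears the \<open>\<phi> x / 4\<close> in \<open>main\<close>;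
    together with the 2 from the double-angle formula for the sine in \<open>m\<close>, the
    coefficient becomes \<open>\<delta> / \<epsilon>\<^sup>2\<close>.\<close>
  define M where "M = (\<lambda>x. 4 * c * Mm x)"
  show thesis
  proof (rule that[of M])
    show "M 1 = 0" by (simp add: M_def Mm_def)
    fix x :: real assume x: "x \<in> {0..1}"
    show "(M has_real_derivative - (\<delta>/\<epsilon>\<^sup>2 * (v x)^4 * (sin (\<phi> x) * cos (\<phi> x)))) (at x within {0..1})"
      unfolding M_def by (rule DERIV_cong[OF DERIV_cmult[OF dMm[OF x]]]) (simp add: c_def m_def sin_double)
    have cc: "continuous_on {0..1} (\<lambda>y. Mm y / (v y)\<^sup>2)" using v0 by (auto intro!: continuous_intros cMm cv)
    have "((\<lambda>x. 2 * \<kappa> * x - 4 * c * integral {0..x} (\<lambda>y. Mm y / (v y)\<^sup>2)) has_real_derivative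
        2 * \<kappa> - M x / (v x)\<^sup>2) (at x within {0..1})"
      by (rule DERIV_cong, rule DERIV_diff, rule DERIV_cmult, rule DERIV_ident, rule DERIV_cmult,
          rule integral_has_real_derivative[OF cc x]) (simp add: M_def)
    then show "(\<phi> has_real_derivative 2 * \<kappa> - M x / (v x)\<^sup>2) (at x within {0..1})"
      by (rule has_field_derivative_transform_within[OF _ zero_less_one x]) (use main in \<open>force simp: field_simps\<close>)
  qed
qed

text \<open>The coupling of indefinite sign is
  \<open>\<kappa> / 2 * (1 - v\<^sup>2) * \<phi>'\<close>. Young's inequality, weighted by
  \<epsilon>, splits it into a fraction \<open>\<kappa> * \<epsilon>\<close> of the potential energy
  and a fraction \<open>2 * \<kappa> * \<epsilon>\<close> of the term in
  \<open>\<phi>'\<^sup>2\<close>; the remaining weights \<open>v\<^sup>2\<close> and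
  \<open>v^4\<close> are at least \<open>1 - 4 * \<eta>\<close>.\<close>

lemma minimizer_energy_lower_bound:
  assumes min: "is_minimizer \<epsilon> \<delta> \<kappa> v \<phi>" and pos: "\<epsilon> > 0" "\<delta> > 0" "\<kappa> > 0"
    and \<eta>: "\<And>x. x \<in> {0..1} \<Longrightarrow> \<bar>v x - 1\<bar> \<le> \<eta>" "\<eta> \<le> 1/2"
    and der: "\<And>x. x \<in> {0..1} \<Longrightarrow> (\<phi> has_real_derivative \<phi>' x) (at x within {0..1})"
    and cont: "continuous_on {0..1} \<phi>'"
  shows "(1 - \<kappa> * \<epsilon>) * well_energy \<epsilon> v
      + (1 - 4 * \<eta> - 2 * \<kappa> * \<epsilon>) * integral {0..1} (\<lambda>x. 1/8 * (\<phi>' x)\<^sup>2 + \<delta>/(8*\<epsilon>\<^sup>2) * (sin (\<phi> x))\<^sup>2)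
      - \<kappa>/2 * \<phi> 1 \<le> G \<epsilon> \<delta> \<kappa> v \<phi>"
proof -
  have vpos: "v x > 0" if "x \<in> {0..1}" for x using \<eta>(1)[OF that] \<eta>(2) by linarith
  have good: "good_set v = {0<..<1}" "{0..1} - zero_set v = {0..1}"
    using good_set_pos[of v] vpos by auto
  have adm: "admissible v \<phi>" using min by (simp add: is_minimizer_def)
  have cv: "continuous_on {0..1} v" and Hv: "\<exists>g. H1_on {0<..<1} v g" and cp: "continuous_on {0..1} \<phi>"
    and p0: "\<phi> 0 = 0"
    using adm good by (simp_all add: admissible_def)
  have H: "H1_on {0<..<1} \<phi> \<phi>'"
  proof (rule H1_on_unit_piecewise[where S = "{}"])
    fix x :: real assume "x \<in> {0<..<1} - {}"
    then show "(\<phi> has_real_derivative \<phi>' x) (at x)"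
      using der[of x] at_within_interior[of x "{0..1}"] by auto
  qed (auto intro: cp L2_on_unit_continuous[OF cont])
  define c where "c = \<delta> / (8 * \<epsilon>\<^sup>2)"
  have c: "c > 0" using pos by (simp add: c_def)
  define \<theta> where "\<theta> = 1 - 4 * \<eta> - 2 * \<kappa> * \<epsilon>"
  define A where "A = integral {0..1} (\<lambda>x. (wderiv {0<..<1} v x)\<^sup>2)"
  define B where "B = integral {0..1} (\<lambda>x. (1 - (v x)\<^sup>2)\<^sup>2)"
  have E: "well_energy \<epsilon> v = 1/2 * A + 1/(4*\<epsilon>\<^sup>2) * B" by (simp add: well_energy_def A_def B_def)
  have A: "A \<ge> 0" unfolding A_def by (rule integral_square_nonneg)
  define P1 where "P1 = integral {0..1} (\<lambda>x. (v x)\<^sup>2 * (\<phi>' x)\<^sup>2)"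
  define P2 where "P2 = integral {0..1} (\<lambda>x. (v x)^4 * (sin (\<phi> x))\<^sup>2)"
  define P3 where "P3 = integral {0..1} (\<lambda>x. (v x)\<^sup>2 * \<phi>' x)"
  define J where "J = integral {0..1} (\<lambda>x. 1/8 * (\<phi>' x)\<^sup>2 + c * (sin (\<phi> x))\<^sup>2)"
  have hphi: "(\<phi>' has_integral \<phi> 1) {0..1}"
    using fundamental_theorem_of_calculus[of 0 1 \<phi> \<phi>'] der p0
    by (simp flip: has_real_derivative_iff_has_vector_derivative)
  have i1: "((\<lambda>x. 1/8 * ((v x)\<^sup>2 * (\<phi>' x)\<^sup>2) + c * ((v x)^4 * (sin (\<phi> x))\<^sup>2) - \<kappa>/2 * ((v x)\<^sup>2 * \<phi>' x) + \<kappa>/(4*\<epsilon>) * (1 - (v x)\<^sup>2)\<^sup>2)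
      has_integral (1/8 * P1 + c * P2 - \<kappa>/2 * P3 + \<kappa>/(4*\<epsilon>) * B)) {0..1}"
    unfolding P1_def P2_def P3_def B_def
    by (intro has_integral_add has_integral_diff has_integral_mult_right integrable_integral
        integrable_continuous_real continuous_intros cv cp cont)
  have i2: "((\<lambda>x. \<theta> * (1/8 * (\<phi>' x)\<^sup>2 + c * (sin (\<phi> x))\<^sup>2) - \<kappa>/2 * \<phi>' x) has_integral (\<theta> * J - \<kappa>/2 * \<phi> 1)) {0..1}"
    unfolding J_def
    by (intro has_integral_diff has_integral_mult_right hphi integrable_integral
        integrable_continuous_real continuous_intros cp cont)
  have "\<theta> * J - \<kappa>/2 * \<phi> 1 \<le> 1/8 * P1 + c * P2 - \<kappa>/2 * P3 + \<kappa>/(4*\<epsilon>) * B"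
  proof (rule has_integral_le[OF i2 i1])
    fix x :: real assume x: "x \<in> {0..1}"
    define w where "w = (v x)\<^sup>2"
    have \<eta>0: "0 \<le> \<eta>" using \<eta>(1)[OF x] abs_ge_zero order_trans by blast
    have "1 - \<eta> \<le> v x" using \<eta>(1)[OF x] by linarith
    then have "(1 - \<eta>)\<^sup>2 \<le> w" unfolding w_def using \<eta>(2) by (intro power_mono) auto
    moreover have "(1 - \<eta>)\<^sup>2 = 1 - 2 * \<eta> + \<eta>\<^sup>2" by (simp add: power2_eq_square algebra_simps)
    ultimately have w: "1 - 2 * \<eta> \<le> w" using zero_le_power2[of \<eta>] by linarith
    then have "(1 - 2 * \<eta>)\<^sup>2 \<le> w\<^sup>2" using \<eta>(2) by (intro power_mono) auto
    moreover have "(1 - 2 * \<eta>)\<^sup>2 = 1 - 4 * \<eta> + 4 * \<eta>\<^sup>2" by (simp add: power2_eq_square algebra_simps)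
    ultimately have "1 - 4 * \<eta> \<le> w\<^sup>2" using zero_le_power2[of \<eta>] by linarith
    moreover have "0 < \<kappa> * \<epsilon>" using pos by simp
    ultimately have w2: "0 \<le> w\<^sup>2 - \<theta>" "0 \<le> w - 2 * \<kappa> * \<epsilon> - \<theta>" 
      using w \<eta>0 by (simp_all add: \<theta>_def)
    have "0 \<le> 1/8 * (\<phi>' x)\<^sup>2 * (w - 2 * \<kappa> * \<epsilon> - \<theta>) + c * (sin (\<phi> x))\<^sup>2 * (w\<^sup>2 - \<theta>) + \<kappa>/(4*\<epsilon>) * ((1 - w) + \<epsilon> * \<phi>' x)\<^sup>2"
      using w2 c pos by (intro add_nonneg_nonneg mult_nonneg_nonneg) auto
    also have "\<dots> = (1/8 * (w * (\<phi>' x)\<^sup>2) + c * (w\<^sup>2 * (sin (\<phi> x))\<^sup>2) - \<kappa>/2 * (w * \<phi>' x) + \<kappa>/(4*\<epsilon>) * (1 - w)\<^sup>2)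
       - (\<theta> * (1/8 * (\<phi>' x)\<^sup>2 + c * (sin (\<phi> x))\<^sup>2) - \<kappa>/2 * \<phi>' x)"
      using pos by (simp add: power2_eq_square field_simps)
    finally show "\<theta> * (1/8 * (\<phi>' x)\<^sup>2 + c * (sin (\<phi> x))\<^sup>2) - \<kappa>/2 * \<phi>' x \<le>
       1/8 * ((v x)\<^sup>2 * (\<phi>' x)\<^sup>2) + c * ((v x)^4 * (sin (\<phi> x))\<^sup>2) - \<kappa>/2 * ((v x)\<^sup>2 * \<phi>' x) + \<kappa>/(4*\<epsilon>) * (1 - (v x)\<^sup>2)\<^sup>2"
      by (simp add: w_def flip: power_mult)
  qed
  moreover have "\<kappa>/(4*\<epsilon>) * B = \<kappa> * \<epsilon> * (1/(4*\<epsilon>\<^sup>2) * B)" using pos by (simp add: power2_eq_square)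
  moreover have "0 \<le> \<kappa> * \<epsilon> * (1/2 * A)" using A pos by simp
  moreover have "G \<epsilon> \<delta> \<kappa> v \<phi> = well_energy \<epsilon> v + 1/8 * P1 + c * P2 - \<kappa>/2 * P3"
    unfolding G_unit(1)[OF cv Hv good(1) cp H] P1_def P2_def P3_def c_def ..
  moreover have "(1 - \<kappa> * \<epsilon>) * well_energy \<epsilon> v = well_energy \<epsilon> v - (\<kappa> * \<epsilon> * (1/2 * A) + \<kappa> * \<epsilon> * (1/(4*\<epsilon>\<^sup>2) * B))"
  proof -
    have "(1 - k) * (p + q) = (p + q) - (k * p + k * q)" for k p q :: real by (simp add: algebra_simps)
    then show ?thesis unfolding E .
  qed
  ultimately show ?thesis unfolding \<theta>_def[symmetric] c_def[symmetric] J_def[symmetric] by linarith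
qed

lemma minimizer_nonpositive:
  assumes "is_minimizer \<epsilon> \<delta> \<kappa> v \<phi>"
  shows "G \<epsilon> \<delta> \<kappa> v \<phi> \<le> 0"
  using minimizer_upper_bound[OF assms, of "\<lambda>_. 0" "\<lambda>_. 0"] by simp

text \<open>\<open>G \<le> 0\<close> and the a priori bound give well energy at most
  \<open>\<kappa>\<^sup>2 / 2\<close>; this is the origin of the value
  \<open>sqrt (6 * \<epsilon>) * \<kappa>\<close> taken for \<open>\<eta>\<close> later.\<close>

lemma minimizer_sup_bound:
  assumes min: "is_minimizer \<epsilon> \<delta> \<kappa> v \<phi>" and "\<epsilon> > 0" "\<delta> > 0"
    and nn: "\<And>x. x \<in> {0..1} \<Longrightarrow> v x \<ge> 0" and x: "x \<in> {0..1}"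
  shows "(v x - 1)\<^sup>2 \<le> 6 * \<epsilon> * \<kappa>\<^sup>2"
proof -
  have adm: "admissible v \<phi>" using min by (simp add: is_minimizer_def)
  have "well_energy \<epsilon> v \<le> \<kappa>\<^sup>2 / 2"
    using G_lower_bound[OF adm, of \<delta> \<epsilon> \<kappa>] minimizer_nonpositive[OF min] assms by linarith
  then have "12 * \<epsilon> * well_energy \<epsilon> v \<le> 12 * \<epsilon> * (\<kappa>\<^sup>2 / 2)"
    using assms by (intro mult_left_mono) auto
  then show ?thesis using sup_bound_by_well_energy[OF adm nn \<open>\<epsilon> > 0\<close> x] by simp
qed

section \<open>The primitive of the modulus of the sine\<close>

text \<open>The Modica-Mortola distance to 0, with sign, for the squared sine as potential. A
  primitive, rather than \<open>1 - cos t\<close>, stays monotone beyond half a period, so windings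
  keep adding cost.\<close>

definition abs_sin_primitive :: "real \<Rightarrow> real" where
  "abs_sin_primitive = (SOME F. F 0 = 0 \<and> (\<forall>x. (F has_real_derivative \<bar>sin x\<bar>) (at x)))"

lemma abs_sin_primitive_0: "abs_sin_primitive 0 = 0"
  and abs_sin_primitive_deriv: "(abs_sin_primitive has_real_derivative \<bar>sin x\<bar>) (at x)"
proof -
  have "\<exists>F::real \<Rightarrow> real. F 0 = 0 \<and> (\<forall>x. (F has_real_derivative \<bar>sin x\<bar>) (at x))"
    by (rule antiderivative_UNIV[of "\<lambda>x. \<bar>sin x\<bar>"]) (auto intro!: continuous_intros)
  from someI_ex[OF this] show "abs_sin_primitive 0 = 0" 
    "(abs_sin_primitive has_real_derivative \<bar>sin x\<bar>) (at x)"
    by (auto simp: abs_sin_primitive_def)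
qed

lemma abs_sin_primitive_mono: "x \<le> y \<Longrightarrow> abs_sin_primitive x \<le> abs_sin_primitive y"
  by (rule DERIV_nonneg_imp_nondecreasing) (use abs_sin_primitive_deriv in \<open>auto intro!: exI\<close>)

lemma continuous_abs_sin_primitive: "continuous_on A abs_sin_primitive"
  by (rule DERIV_continuous_on[OF has_field_derivative_at_within[OF abs_sin_primitive_deriv]])

lemma constant_if_derivative_zero:
  fixes f :: "real \<Rightarrow> real"
  assumes "\<And>x. (f has_real_derivative 0) (at x)"
  shows "f x = f y"
  using DERIV_isconst_all[of f x y] assms by blast

lemma abs_sin_primitive_uminus: "abs_sin_primitive (- t) = - abs_sin_primitive t"
proof -
  let ?f = "\<lambda>t. abs_sin_primitive (- t) + abs_sin_primitive t"
  have "(?f has_real_derivative 0) (at t)" for t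
    by (rule DERIV_cong[OF DERIV_add[OF DERIV_chain2[OF abs_sin_primitive_deriv, of uminus "-1"] abs_sin_primitive_deriv]])
       (auto intro!: derivative_eq_intros)
  then have "?f t = ?f 0" by (rule constant_if_derivative_zero)
  then show ?thesis by (simp add: abs_sin_primitive_0)
qed

lemma abs_sin_primitive_eq:
  assumes "0 \<le> t" "t \<le> pi"
  shows "abs_sin_primitive t = 1 - cos t"
proof (cases "t = 0")
  case False
  let ?f = "\<lambda>t. abs_sin_primitive t - (1 - cos t)"
  have d: "(?f has_real_derivative \<bar>sin x\<bar> - sin x) (at x)" for x
    by (auto intro!: derivative_eq_intros abs_sin_primitive_deriv)
  have "?f t = ?f 0"
  proof (rule DERIV_isconst_end[where f = ?f])
    show "continuous_on {0..t} ?f" by (intro continuous_intros continuous_abs_sin_primitive)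
    fix x assume "0 < x" "x < t"
    then have "sin x > 0" using assms by (intro sin_gt_zero) auto
    then show "(?f has_real_derivative 0) (at x)" using d[of x] by simp
  qed (use assms False in auto)
  then show ?thesis by (simp add: abs_sin_primitive_0)
qed (simp add: abs_sin_primitive_0)

lemma abs_sin_primitive_add_pi: "abs_sin_primitive (t + pi) = abs_sin_primitive t + 2"
proof -
  let ?f = "\<lambda>t. abs_sin_primitive (t + pi) - abs_sin_primitive t"
  have "(?f has_real_derivative 0) (at t)" for t
    by (rule DERIV_cong[OF DERIV_diff[OF DERIV_chain2[OF abs_sin_primitive_deriv, of "\<lambda>t. t + pi" 1] abs_sin_primitive_deriv]])
       (auto intro!: derivative_eq_intros)
  then have "?f t = ?f 0" by (rule constant_if_derivative_zero)
  then show ?thesis using abs_sin_primitive_eq[of pi] by (simp add: abs_sin_primitive_0)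
qed

lemma abs_sin_primitive_add_pi_multiple:
  "abs_sin_primitive (t + real n * pi) = abs_sin_primitive t + 2 * real n"
proof (induction n)
  case (Suc n)
  have eq: "t + real (Suc n) * pi = (t + real n * pi) + pi" by (simp add: algebra_simps)
  show ?case unfolding eq abs_sin_primitive_add_pi Suc by simp
qed simp

lemma mod_pi:
  assumes "t \<ge> 0"
  obtains u n where "t = u + real n * pi" "0 \<le> u" "u < pi"
proof -
  define n where "n = nat \<lfloor>t / pi\<rfloor>"
  have "real n = of_int \<lfloor>t / pi\<rfloor>" using assms by (simp add: n_def)
  then have "real n \<le> t / pi" "t / pi < real n + 1" by linarith+
  then have "real n * pi \<le> t" "t < (real n + 1) * pi" by (simp_all add: field_simps)
  then show thesis by (intro that[of "t - real n * pi" n]) (auto simp: algebra_simps)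
qed

text \<open>\<open>2 / pi\<close> is the mean of \<open>\<bar>sin t\<bar>\<close>; the unfinished
  half period accounts for the loss of 2.\<close>

lemma abs_sin_primitive_linear_lower: 
  assumes "t \<ge> 0"
  shows "2 / pi * t - 2 \<le> abs_sin_primitive t"
proof -
  obtain u n where u: "t = u + real n * pi" "0 \<le> u" "u < pi" using mod_pi[OF assms] .
  have "0 \<le> abs_sin_primitive u" using abs_sin_primitive_mono[OF u(2)] abs_sin_primitive_0 by simp
  moreover have "2 / pi * u \<le> 2" using u(3) by (simp add: field_simps)
  moreover have "2 / pi * t = 2 / pi * u + 2 * real n" by (simp add: u(1) field_simps)
  ultimately show ?thesis unfolding u(1) abs_sin_primitive_add_pi_multiple by simp
qed

text \<open>The effective potential of the boundary value: the winding cost per half period is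
  \<^term>\<open>2\<close>, so for \<^term>\<open>c * pi < 2\<close> no winding occurs.\<close>

lemma boundary_potential_strict_min:
  assumes c: "0 < c" "c < 2 / pi" and t: "t \<noteq> arcsin c"
  shows "\<bar>abs_sin_primitive (arcsin c)\<bar> - c * arcsin c < \<bar>abs_sin_primitive t\<bar> - c * t"
proof -
  define s where "s = arcsin c"
  have "2 / pi < 1" using pi_gt3 by simp
  then have c1: "c < 1" using c by linarith
  have s: "0 < s" "s < pi / 2" "sin s = c"
  proof -
    show "sin s = c" using c c1 by (simp add: s_def)
    have "arcsin 0 < arcsin c" using c c1 by (intro arcsin_less_arcsin) auto
    then show "0 < s" by (simp add: s_def)
    show "s < pi / 2" unfolding s_def using arcsin_lt_bounded[of c] c c1 by auto
  qed
  define f where "f = (\<lambda>t. 1 - cos t - c * t)"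
  have df: "(f has_real_derivative sin t - c) (at t)" for t
    unfolding f_def by (auto intro!: derivative_eq_intros)
  have cf: "continuous_on A f" for A unfolding f_def by (intro continuous_intros)
  have dec: "f s < f t" if "0 \<le> t" "t < s" for t
  proof (rule DERIV_neg_imp_decreasing_open[OF that(2)])
    fix x assume x: "t < x" "x < s"
    then have "sin x < sin s" using that s by (intro sin_monotone_2pi) auto
    then show "\<exists>y. (f has_real_derivative y) (at x) \<and> y < 0" using df[of x] s(3) by auto
  qed (rule cf)
  have inc: "f s < f t" if "s < t" "t \<le> pi - s" for t
  proof (rule DERIV_pos_imp_increasing_open[OF that(1)])
    fix x assume x: "s < x" "x < t"
    have "sin s < sin x"
    proof (cases "x \<le> pi / 2")
      case True
      then show ?thesis using x s by (intro sin_monotone_2pi) auto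
    next
      case False
      then have "sin s < sin (pi - x)" using x s that by (intro sin_monotone_2pi) auto
      then show ?thesis by simp
    qed
    then show "\<exists>y. (f has_real_derivative y) (at x) \<and> 0 < y" using df[of x] s(3) by auto
  qed (rule cf)
  have "f s < 0" using dec[of 0] s by (simp add: f_def)
  \<comment> \<open>\<open>f pi = 2 - c * pi\<close> is the net price of half a turn, positive below
    the threshold. From \<open>pi - s\<close> on \<open>f\<close> decreases, but only down to this
    value.\<close>
  have fpi: "0 < f pi"
    using c by (simp add: f_def field_simps)
  have last: "f s < f t" if "pi - s \<le> t" "t \<le> pi" for t
  proof -
    have "f pi \<le> f t"
    proof (rule DERIV_nonpos_imp_nonincreasing[OF that(2)])
      fix x assume x: "t \<le> x" "x \<le> pi"
      have "sin (pi - x) \<le> sin s" using x s that by (intro sin_monotone_2pi_le) auto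
      then show "\<exists>y. (f has_real_derivative y) (at x) \<and> y \<le> 0" using df[of x] s(3) by auto
    qed
    then show ?thesis using fpi \<open>f s < 0\<close> by linarith
  qed
  have main: "f s \<le> f u" "u \<noteq> s \<Longrightarrow> f s < f u" if "0 \<le> u" "u \<le> pi" for u
    using dec[of u] inc[of u] last[of u] that by (cases "u = s"; force)+
  have eq: "\<bar>abs_sin_primitive u\<bar> - c * u = f u" if "0 \<le> u" "u \<le> pi" for u
    using abs_sin_primitive_eq[OF that] cos_le_one[of u] by (simp add: f_def)
  have "f s < \<bar>abs_sin_primitive t\<bar> - c * t"
  proof (cases "t < 0")
    case True
    then have "0 < - (c * t)" using c by (simp add: mult_pos_neg)
    then show ?thesis using \<open>f s < 0\<close> by linarith
  next
    case False
    then obtain u n where u: "t = u + real n * pi" "0 \<le> u" "u < pi" using mod_pi[of t] by auto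
    have u0: "0 \<le> abs_sin_primitive u" using abs_sin_primitive_mono[OF u(2)] abs_sin_primitive_0 by simp
    \<comment> \<open>Each of the \<open>n\<close> half turns adds the same net price.\<close>
    have "\<bar>abs_sin_primitive t\<bar> - c * t = f u + real n * (2 - c * pi)"
      using eq[of u] u u0 unfolding u(1) abs_sin_primitive_add_pi_multiple by (simp add: algebra_simps)
    moreover have "2 - c * pi > 0" using c by (simp add: field_simps)
    ultimately have e: "\<bar>abs_sin_primitive t\<bar> - c * t = f u + real n * (2 - c * pi)" and p: "2 - c * pi > 0" by auto
    show ?thesis
    proof (cases "n = 0")
      case True
      then show ?thesis using e main(2)[of u] u t by (simp add: s_def)
    next
      case False
      then have "real n * (2 - c * pi) > 0" using p by simp
      then show ?thesis using e main(1)[of u] u by linarith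
    qed
  qed
  then show ?thesis using eq[of s] s by (simp add: s_def[symmetric])
qed

text \<open>Quantifies the strict minimum: compactness handles a bounded range, linear growth the
  rest. The growth rate is \<open>c\<close> for negative \<open>t\<close>, where the linear term
  alone grows, and \<open>2 / pi - c\<close> for positive \<open>t\<close>; the minimum of the two
  serves both sides.\<close>

lemma boundary_potential_gap:
  assumes c: "0 < c" "c < 2 / pi" and "\<mu> > 0"
  obtains d where "d > 0" "\<And>t. \<mu> \<le> \<bar>t - arcsin c\<bar> \<Longrightarrow>
    \<bar>abs_sin_primitive (arcsin c)\<bar> - c * arcsin c + d \<le> \<bar>abs_sin_primitive t\<bar> - c * t"
proof -
  define f where "f = (\<lambda>t. \<bar>abs_sin_primitive t\<bar> - c * t)"
  define s where "s = arcsin c"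
  have coer: "f s + 1 \<le> f t" if "R \<le> \<bar>t\<bar>" and R: "R = (\<bar>f s\<bar> + 3) / min c (2 / pi - c)" for t R
  proof -
    define k where "k = min c (2 / pi - c)"
    have k: "k > 0" "k \<le> c" "k \<le> 2 / pi - c" using c by (auto simp: k_def)
    have "R * k = \<bar>f s\<bar> + 3" using k(1) unfolding R k_def[symmetric] by simp
    moreover have "R * k \<le> \<bar>t\<bar> * k" using that(1) k(1) by (intro mult_right_mono) auto
    ultimately have "k * \<bar>t\<bar> \<ge> \<bar>f s\<bar> + 3" by (simp add: mult.commute)
    moreover have "k * \<bar>t\<bar> - 2 \<le> f t"
    proof (cases "t \<ge> 0")
      case True
      have "k * t \<le> (2 / pi - c) * t" using k True by (intro mult_right_mono) auto
      then have "k * t \<le> 2 / pi * t - c * t" by (simp add: algebra_simps)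
      then show ?thesis using abs_sin_primitive_linear_lower[OF True] True unfolding f_def by simp
    next
      case False
      have "k * (- t) \<le> c * (- t)" using k False by (intro mult_right_mono) auto
      then have "k * (- t) \<le> \<bar>abs_sin_primitive t\<bar> - c * t" 
        using abs_ge_zero[of "abs_sin_primitive t"] by linarith
      moreover have "\<bar>t\<bar> = - t" using False by simp
      ultimately show ?thesis unfolding f_def by simp
    qed
    ultimately show ?thesis by linarith
  qed
  define R where "R = (\<bar>f s\<bar> + 3) / min c (2 / pi - c)"
  define K where "K = {-R..R} \<inter> {t. \<mu> \<le> \<bar>t - s\<bar>}"
  have "closed {t. \<mu> \<le> \<bar>t - s\<bar>}" by (intro closed_Collect_le continuous_intros)
  then have "compact K" unfolding K_def by (intro compact_Int_closed) auto
  have contf: "continuous_on A f" for A unfolding f_def by (intro continuous_intros continuous_abs_sin_primitive)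
  have "\<exists>d>0. \<forall>t\<in>K. f s + d \<le> f t"
  proof (cases "K = {}")
    case True
    then show ?thesis by (intro exI[of _ 1]) auto
  next
    case False
    then obtain t0 where t0: "t0 \<in> K" "\<And>t. t \<in> K \<Longrightarrow> f t0 \<le> f t"
      using continuous_attains_inf[OF \<open>compact K\<close> False contf] by auto
    have "f s < f t0"
      using boundary_potential_strict_min[OF c, of t0] t0(1) \<open>\<mu> > 0\<close> by (auto simp: f_def s_def K_def)
    then show ?thesis using t0 by (intro exI[of _ "f t0 - f s"]) auto
  qed
  then obtain d where d: "d > 0" "\<And>t. t \<in> K \<Longrightarrow> f s + d \<le> f t" by blast
  have "f s + min d 1 \<le> f t" if "\<mu> \<le> \<bar>t - s\<bar>" for t
  proof (cases "t \<in> K")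
    case True
    then show ?thesis using d(2)[OF True] by auto
  next
    case False
    then have "R \<le> \<bar>t\<bar>" using that by (auto simp: K_def)
    then show ?thesis using coer[OF _ R_def] by fastforce
  qed
  then show thesis using d(1) by (intro that[of "min d 1"]) (auto simp: f_def s_def)
qed

section \<open>Gronwall comparison and local C1 convergence\<close>

lemma Gronwall_pair:
  fixes u w :: "real \<Rightarrow> real"
  assumes du: "\<And>x. x \<in> {0..T} \<Longrightarrow> (u has_real_derivative u' x) (at x within {0..T})"
    and dw: "\<And>x. x \<in> {0..T} \<Longrightarrow> (w has_real_derivative w' x) (at x within {0..T})"
    and b: "\<And>x. x \<in> {0..T} \<Longrightarrow> \<bar>u' x - w x\<bar> \<le> \<rho>" "\<And>x. x \<in> {0..T} \<Longrightarrow> \<bar>w' x\<bar> \<le> \<bar>u x\<bar> + \<rho>"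
    and x: "x \<in> {0..T}"
  shows "(u x)\<^sup>2 + (w x)\<^sup>2 \<le> ((u 0)\<^sup>2 + (w 0)\<^sup>2 + \<rho>\<^sup>2) * exp (3 * T)"
proof -
  \<comment> \<open>Putting \<open>\<rho>\<^sup>2\<close> into \<open>E\<close> absorbs the
    inhomogeneity: the products, split by Young's inequality, add up to
    \<open>E' \<le> 3 * E\<close>.\<close>
  define E where "E = (\<lambda>x. (u x)\<^sup>2 + (w x)\<^sup>2 + \<rho>\<^sup>2)"
  define F where "F = (\<lambda>x. E x * exp (- 3 * x))"
  define E' where "E' = (\<lambda>x. 2 * u x * u' x + 2 * w x * w' x)"
  have cu: "continuous_on {0..T} u" "continuous_on {0..T} w"
    by (rule DERIV_continuous_on[OF du]) (assumption, rule DERIV_continuous_on[OF dw])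
  have E': "E' y \<le> 3 * E y" if y: "y \<in> {0..T}" for y
  proof -
    have "0 \<le> \<rho>" using b(1)[OF y] by linarith
    have s: "2 * a * b \<le> \<bar>a\<bar>\<^sup>2 + \<bar>b\<bar>\<^sup>2" for a b :: real 
      using sum_squares_bound[of a b] by simp
    have "2 * u y * u' y = 2 * u y * w y + 2 * u y * (u' y - w y)" by (simp add: algebra_simps)
    also have "\<dots> \<le> ((u y)\<^sup>2 + (w y)\<^sup>2) + ((u y)\<^sup>2 + \<rho>\<^sup>2)"
    proof -
      have "\<bar>u' y - w y\<bar>\<^sup>2 \<le> \<rho>\<^sup>2" using b(1)[OF y] by (intro power_mono) auto
      then show ?thesis using s[of "u y" "w y"] s[of "u y" "u' y - w y"] by simp
    qed
    finally have 1: "2 * u y * u' y \<le> 2 * (u y)\<^sup>2 + (w y)\<^sup>2 + \<rho>\<^sup>2" by simp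
    have "2 * w y * w' y \<le> 2 * \<bar>w y\<bar> * \<bar>w' y\<bar>" 
      using abs_ge_self[of "w y * w' y"] by (simp add: abs_mult)
    also have "\<dots> \<le> 2 * \<bar>w y\<bar> * (\<bar>u y\<bar> + \<rho>)" using b(2)[OF y] by (intro mult_left_mono) auto
    also have "\<dots> \<le> ((w y)\<^sup>2 + (u y)\<^sup>2) + ((w y)\<^sup>2 + \<rho>\<^sup>2)"
      using s[of "\<bar>w y\<bar>" "\<bar>u y\<bar>"] s[of "\<bar>w y\<bar>" \<rho>] by (simp add: algebra_simps)
    finally have "2 * w y * w' y \<le> 2 * (w y)\<^sup>2 + (u y)\<^sup>2 + \<rho>\<^sup>2" by simp
    moreover have "a \<le> 2 * p + q + r \<Longrightarrow> b \<le> 2 * q + p + r \<Longrightarrow> 0 \<le> r \<Longrightarrow> a + b \<le> 3 * (p + q + r)" for a b p q r :: real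
      by simp
    ultimately show ?thesis unfolding E'_def E_def using 1 zero_le_power2[of \<rho>] by blast
  qed
  have "F x \<le> F 0"
  proof (cases "x = 0")
    case False
    have "F x \<le> F 0"
    proof (rule DERIV_nonpos_imp_decreasing_open[of 0 x F])
      show "continuous_on {0..x} F" unfolding F_def E_def
        by (intro continuous_intros continuous_on_subset[OF cu(1)] continuous_on_subset[OF cu(2)]) (use x in auto)
      fix y assume y: "0 < y" "y < x"
      then have yT: "y \<in> {0..T}" "at y within {0..T} = at y" using x by (auto intro!: at_within_interior)
      have "(E has_real_derivative E' y) (at y)"
        using du[OF yT(1)] dw[OF yT(1)] unfolding yT(2) E_def E'_def 
        by (auto intro!: derivative_eq_intros)
      then have "(F has_real_derivative (E' y - 3 * E y) * exp (- 3 * y)) (at y)"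
        unfolding F_def by (auto intro!: derivative_eq_intros simp: algebra_simps)
      moreover have "(E' y - 3 * E y) * exp (- 3 * y) \<le> 0"
        using E'[OF yT(1)] by (intro mult_nonpos_nonneg) auto
      ultimately show "\<exists>d. (F has_real_derivative d) (at y) \<and> d \<le> 0" by blast
    qed (use x in auto)
    then show ?thesis .
  qed simp
  then have "E x * exp (- 3 * x) * exp (3 * x) \<le> E 0 * exp (3 * x)" by (simp add: F_def)
  then have "E x \<le> E 0 * exp (3 * x)" by (simp add: mult.assoc flip: exp_add)
  also have "\<dots> \<le> E 0 * exp (3 * T)" using x by (intro mult_left_mono) (auto simp: E_def)
  finally show ?thesis using zero_le_power2[of \<rho>] unfolding E_def by linarith
qed

text \<open>In the application \<open>\<psi>'\<close> contains \<open>1 / v\<^sup>2\<close> and need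
  not be differentiable, so the comparison runs on the pair of \<open>\<psi>\<close> and a
  differentiable substitute \<open>z\<close> for its slope, uniformly close to
  \<open>\<psi>'\<close>. Convergence of both at 0 propagates to {0..T}.\<close>

lemma C1_loc_conv_by_Gronwall:
  fixes \<psi> \<psi>' z z' :: "real \<Rightarrow> real \<Rightarrow> real"
  assumes lim: "\<And>x. x \<ge> 0 \<Longrightarrow> (\<psi>0 has_real_derivative z0 x) (at x within {0..})"
      "\<And>x. x \<ge> 0 \<Longrightarrow> (z0 has_real_derivative q0 x) (at x within {0..})"
    and init: "((\<lambda>e. \<psi> e 0) \<longlongrightarrow> \<psi>0 0) F" "((\<lambda>e. z e 0) \<longlongrightarrow> z0 0) F"
    and ev: "\<And>T \<rho>. T > 0 \<Longrightarrow> \<rho> > 0 \<Longrightarrow> eventually (\<lambda>e. \<forall>x\<in>{0..T}.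
        (\<psi> e has_real_derivative \<psi>' e x) (at x within {0..T}) \<and>
        (z e has_real_derivative z' e x) (at x within {0..T}) \<and>
        \<bar>\<psi>' e x - z e x\<bar> \<le> \<rho> \<and> \<bar>z' e x - q0 x\<bar> \<le> \<bar>\<psi> e x - \<psi>0 x\<bar> + \<rho>) F"
  shows "C1_loc_conv \<psi> \<psi>0 F"
  unfolding C1_loc_conv_def
proof (intro allI impI exI[of _ \<psi>'] exI[of _ z0] conjI ballI)
  fix T :: real assume T: "T > 0"
  have sub: "(f has_real_derivative d) (at x within {0..}) \<Longrightarrow> (f has_real_derivative d) (at x within {0..T})" for f d x
    by (erule DERIV_subset) auto
  show "(\<psi>0 has_real_derivative z0 x) (at x within {0..T})" if "x \<in> {0..T}" for x
    using lim(1)[of x] that sub by auto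
  show "eventually (\<lambda>e. \<forall>x\<in>{0..T}. (\<psi> e has_real_derivative \<psi>' e x) (at x within {0..T})) F"
    using ev[OF T zero_less_one] by eventually_elim auto
  have key: "eventually (\<lambda>e. \<forall>x\<in>{0..T}. \<bar>\<psi> e x - \<psi>0 x\<bar> < r \<and> \<bar>\<psi>' e x - z0 x\<bar> < r) F" if r: "r > 0" for r
  proof -
    \<comment> \<open>Calibrated so that \<open>3 * \<rho>\<^sup>2 * exp (3 * T)\<close> is at most
      \<open>(r / 2)\<^sup>2\<close>, while \<open>\<rho> \<le> r / 4\<close> covers the distance of
      \<open>\<psi>'\<close> from \<open>z\<close>.\<close>
    define \<rho> where "\<rho> = r / (4 * exp (3 * T))"
    have \<rho>: "\<rho> > 0" using r by (simp add: \<rho>_def)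
    have "eventually (\<lambda>e. \<bar>\<psi> e 0 - \<psi>0 0\<bar> < \<rho>) F" "eventually (\<lambda>e. \<bar>z e 0 - z0 0\<bar> < \<rho>) F"
      using tendstoD[OF init(1) \<rho>] tendstoD[OF init(2) \<rho>] by (auto simp: dist_real_def)
    then show ?thesis using ev[OF T \<rho>]
    proof eventually_elim
      case (elim e)
      show ?case
      proof
        fix x assume x: "x \<in> {0..T}"
        let ?u = "\<lambda>x. \<psi> e x - \<psi>0 x" and ?w = "\<lambda>x. z e x - z0 x"
        have "(?u x)\<^sup>2 + (?w x)\<^sup>2 \<le> ((?u 0)\<^sup>2 + (?w 0)\<^sup>2 + \<rho>\<^sup>2) * exp (3 * T)"
        proof (rule Gronwall_pair[OF _ _ _ _ x])
          fix y assume y: "y \<in> {0..T}"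
          show "(?u has_real_derivative \<psi>' e y - z0 y) (at y within {0..T})"
            using elim(3) y lim(1)[of y] sub by (intro DERIV_diff) auto
          show "(?w has_real_derivative z' e y - q0 y) (at y within {0..T})"
            using elim(3) y lim(2)[of y] sub by (intro DERIV_diff) auto
          show "\<bar>\<psi>' e y - z0 y - ?w y\<bar> \<le> \<rho>" using elim(3) y by auto
          show "\<bar>z' e y - q0 y\<bar> \<le> \<bar>?u y\<bar> + \<rho>" using elim(3) y by auto
        qed
        also have "\<dots> \<le> (\<rho>\<^sup>2 + \<rho>\<^sup>2 + \<rho>\<^sup>2) * exp (3 * T)"
        proof -
          have "\<bar>?u 0\<bar>\<^sup>2 \<le> \<rho>\<^sup>2" "\<bar>?w 0\<bar>\<^sup>2 \<le> \<rho>\<^sup>2"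
            by (rule power_mono, use elim(1,2) in simp, simp)+
          then show ?thesis by (intro mult_right_mono) auto
        qed
        also have "\<dots> = 3 * \<rho>\<^sup>2 * exp (3 * T)" by simp
        also have "\<dots> \<le> 4 * \<rho>\<^sup>2 * (exp (3 * T))\<^sup>2"
        proof -
          have "exp (3 * T) * 1 \<le> exp (3 * T) * exp (3 * T)" using T by (intro mult_left_mono) auto
          then show ?thesis using \<rho> by (intro mult_mono) (auto simp: power2_eq_square)
        qed
        also have "\<dots> = (r / 2)\<^sup>2" by (simp add: \<rho>_def power2_eq_square)
        finally have E: "(?u x)\<^sup>2 + (?w x)\<^sup>2 \<le> (r / 2)\<^sup>2" .
        have "(?u x)\<^sup>2 \<le> (r / 2)\<^sup>2" "(?w x)\<^sup>2 \<le> (r / 2)\<^sup>2" 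
          using E zero_le_power2[of "?u x"] zero_le_power2[of "?w x"] by linarith+
        then have *: "\<bar>?u x\<bar> \<le> r / 2" "\<bar>?w x\<bar> \<le> r / 2" 
          using r by (simp_all add: power2_le_iff_abs_le)
        have "1 \<le> exp (3 * T)" using T by simp
        then have "\<rho> \<le> r / 4" using r unfolding \<rho>_def by (intro divide_left_mono) auto
        moreover have "\<bar>\<psi>' e x - z e x\<bar> \<le> \<rho>" using elim(3) x by auto
        ultimately show "\<bar>\<psi> e x - \<psi>0 x\<bar> < r \<and> \<bar>\<psi>' e x - z0 x\<bar> < r" using * r by linarith
      qed
    qed
  qed
  show "uniform_limit {0..T} \<psi> \<psi>0 F"
    unfolding uniform_limit_iff dist_real_def by (intro allI impI eventually_mono[OF key]) auto
  show "uniform_limit {0..T} \<psi>' z0 F"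
    unfolding uniform_limit_iff dist_real_def by (intro allI impI eventually_mono[OF key]) auto
qed

section \<open>Regular minimizers and their boundary layers\<close>

text \<open>Bundles what the asymptotics use of a minimizer. \<open>\<sigma>\<close> is the inverse
  layer width \<open>sqrt \<delta> / \<epsilon>\<close>, and \<open>M\<close> is the flux,
  differentiable although \<open>\<phi>'\<close> is only continuous.\<close>

definition regular_minimizer where
  "regular_minimizer \<epsilon> \<sigma> \<kappa> \<eta> v \<phi> M \<phi>' \<longleftrightarrow>
     \<epsilon> > 0 \<and> \<sigma> > 0 \<and> \<kappa> > 0 \<and> 0 \<le> \<eta> \<and> \<eta> \<le> 1/2 \<and>
     (\<forall>x\<in>{0..1}. \<bar>v x - 1\<bar> \<le> \<eta>) \<and> (\<forall>x\<in>{0..1}. (v x - 1)\<^sup>2 \<le> 12 * \<epsilon> * well_energy \<epsilon> v) \<and>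
     good_set v = {0<..<1} \<and> \<phi> 0 = 0 \<and>
     (\<forall>x\<in>{0..1}. (\<phi> has_real_derivative \<phi>' x) (at x within {0..1})) \<and>
     (\<forall>x\<in>{0..1}. \<phi>' x = 2 * \<kappa> - M x / (v x)\<^sup>2) \<and> M 1 = 0 \<and>
     (\<forall>x\<in>{0..1}. (M has_real_derivative - (\<sigma>\<^sup>2 * (v x)^4 * (sin (\<phi> x) * cos (\<phi> x)))) (at x within {0..1})) \<and>
     continuous_on {0..1} \<phi>'"

lemma minimizer_regular:
  assumes min: "is_minimizer \<epsilon> \<delta> \<kappa> v \<phi>" and pos: "\<epsilon> > 0" "\<delta> > 0" "\<kappa> > 0"
    and nn: "\<And>x. x \<in> {0..1} \<Longrightarrow> v x \<ge> 0" and \<eta>: "sqrt (6 * \<epsilon>) * \<kappa> \<le> 1/2"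
  shows "\<exists>M \<phi>'. regular_minimizer \<epsilon> (sqrt \<delta> / \<epsilon>) \<kappa> (sqrt (6 * \<epsilon>) * \<kappa>) v \<phi> M \<phi>'"
proof -
  let ?\<eta> = "sqrt (6 * \<epsilon>) * \<kappa>"
  have adm: "admissible v \<phi>" using min by (simp add: is_minimizer_def)
  have \<eta>0: "?\<eta> \<ge> 0" using pos by simp
  have sup: "\<bar>v x - 1\<bar> \<le> ?\<eta>" if x: "x \<in> {0..1}" for x
  proof -
    have "(v x - 1)\<^sup>2 \<le> ?\<eta>\<^sup>2"
      using minimizer_sup_bound[OF min pos(1,2) nn x] pos by (simp add: power_mult_distrib)
    then show ?thesis using \<eta>0 by (simp add: power2_le_iff_abs_le)
  qed
  have vpos: "v x > 0" if "x \<in> {0..1}" for x using sup[OF that] \<eta> by linarith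
  obtain M where M: "M 1 = 0"
    "\<And>x. x \<in> {0..1} \<Longrightarrow> (M has_real_derivative - (\<delta>/\<epsilon>\<^sup>2 * (v x)^4 * (sin (\<phi> x) * cos (\<phi> x)))) (at x within {0..1})"
    "\<And>x. x \<in> {0..1} \<Longrightarrow> (\<phi> has_real_derivative 2 * \<kappa> - M x / (v x)\<^sup>2) (at x within {0..1})"
    by (rule minimizer_Euler_Lagrange[OF min pos(1,2) vpos]) blast+
  have \<sigma>2: "\<delta>/\<epsilon>\<^sup>2 = (sqrt \<delta> / \<epsilon>)\<^sup>2" using pos by (simp add: power_divide)
  have cv: "continuous_on {0..1} v" using adm by (simp add: admissible_def)
  have cM: "continuous_on {0..1} M" by (rule DERIV_continuous_on[OF M(2)])
  have "continuous_on {0..1} (\<lambda>x. 2 * \<kappa> - M x / (v x)\<^sup>2)"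
    using vpos by (intro continuous_intros cv cM) (auto simp: less_imp_neq[symmetric])
  moreover have "good_set v = {0<..<1}" using good_set_pos[of v] vpos by auto
  ultimately have "regular_minimizer \<epsilon> (sqrt \<delta> / \<epsilon>) \<kappa> ?\<eta> v \<phi> M (\<lambda>x. 2 * \<kappa> - M x / (v x)\<^sup>2)"
    unfolding regular_minimizer_def
    using M[unfolded \<sigma>2] sup sup_bound_by_well_energy[OF adm nn pos(1)] adm pos \<eta> \<eta>0
    by (simp add: admissible_def)
  then show ?thesis by blast
qed

lemma regular_minimizer_energy:
  assumes reg: "regular_minimizer \<epsilon> \<sigma> \<kappa> \<eta> v \<phi> M \<phi>'" and min: "is_minimizer \<epsilon> \<delta> \<kappa> v \<phi>"
    and \<sigma>: "\<sigma> = sqrt \<delta> / \<epsilon>" and "\<delta> > 0"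
  shows "(1 - \<kappa> * \<epsilon>) * well_energy \<epsilon> v
      + (1 - 4 * \<eta> - 2 * \<kappa> * \<epsilon>) * integral {0..1} (\<lambda>x. 1/8 * (\<phi>' x)\<^sup>2 + \<sigma>\<^sup>2/8 * (sin (\<phi> x))\<^sup>2)
      - \<kappa>/2 * \<phi> 1 \<le> G \<epsilon> \<delta> \<kappa> v \<phi>"
proof -
  have "\<sigma>\<^sup>2/8 = \<delta>/(8*\<epsilon>\<^sup>2)" using \<open>\<delta> > 0\<close> by (simp add: \<sigma> power_divide)
  then show ?thesis
    using reg \<open>\<delta> > 0\<close> unfolding regular_minimizer_def
    by (simp only:) (rule minimizer_energy_lower_bound[OF min]; blast)
qed

text \<open>The Modica-Mortola inequality, integrated along the path that starts at
  \<open>\<phi> 0 = 0\<close>. Having it at every \<open>x\<close>, not only at 1, is what later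
  yields the sup bounds on \<open>\<phi>\<close>.\<close>

lemma regular_minimizer_path_cost:
  assumes reg: "regular_minimizer \<epsilon> \<sigma> \<kappa> \<eta> v \<phi> M \<phi>'" and x: "x \<in> {0..1}"
  shows "\<sigma>/4 * \<bar>abs_sin_primitive (\<phi> x)\<bar> \<le> integral {0..1} (\<lambda>x. 1/8 * (\<phi>' x)\<^sup>2 + \<sigma>\<^sup>2/8 * (sin (\<phi> x))\<^sup>2)"
proof -
  have \<sigma>: "\<sigma> > 0" and p0: "\<phi> 0 = 0" and c': "continuous_on {0..1} \<phi>'"
    and d: "\<And>x. x \<in> {0..1} \<Longrightarrow> (\<phi> has_real_derivative \<phi>' x) (at x within {0..1})"
    using reg by (auto simp: regular_minimizer_def)
  have cp: "continuous_on {0..1} \<phi>" by (rule DERIV_continuous_on[OF d])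
  let ?h = "\<lambda>x. 1/8 * (\<phi>' x)\<^sup>2 + \<sigma>\<^sup>2/8 * (sin (\<phi> x))\<^sup>2"
  have ch: "continuous_on {0..1} ?h" by (intro continuous_intros cp c')
  have sub: "{0..x} \<subseteq> {0..1}" using x by auto
  have "((\<lambda>y. \<sigma>/4 * (\<bar>sin (\<phi> y)\<bar> * \<phi>' y)) has_integral \<sigma>/4 * (abs_sin_primitive (\<phi> x) - abs_sin_primitive (\<phi> 0))) {0..x}"
  proof (intro has_integral_mult_right fundamental_theorem_of_calculus)
    fix y assume y: "y \<in> {0..x}"
    have "(\<phi> has_real_derivative \<phi>' y) (at y within {0..x})"
      using d[of y] y sub by (auto intro: DERIV_subset)
    from DERIV_chain2[OF abs_sin_primitive_deriv this]
    show "((\<lambda>x. abs_sin_primitive (\<phi> x)) has_vector_derivative \<bar>sin (\<phi> y)\<bar> * \<phi>' y) (at y within {0..x})"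
      by (simp add: has_real_derivative_iff_has_vector_derivative)
  qed (use x in auto)
  then have i: "((\<lambda>y. \<sigma>/4 * (\<bar>sin (\<phi> y)\<bar> * \<phi>' y)) has_integral \<sigma>/4 * abs_sin_primitive (\<phi> x)) {0..x}"
    by (simp add: p0 abs_sin_primitive_0)
  have "norm (integral {0..x} (\<lambda>y. \<sigma>/4 * (\<bar>sin (\<phi> y)\<bar> * \<phi>' y))) \<le> integral {0..x} ?h"
  proof (rule integral_norm_bound_integral)
    show "?h integrable_on {0..x}" by (intro integrable_continuous_real continuous_on_subset[OF ch sub])
    fix y
    have "2 * \<bar>\<phi>' y\<bar> * (\<sigma> * \<bar>sin (\<phi> y)\<bar>) \<le> \<bar>\<phi>' y\<bar>\<^sup>2 + (\<sigma> * \<bar>sin (\<phi> y)\<bar>)\<^sup>2" by (rule sum_squares_bound)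
    then show "norm (\<sigma>/4 * (\<bar>sin (\<phi> y)\<bar> * \<phi>' y)) \<le> ?h y"
      using \<sigma> by (simp add: abs_mult power_mult_distrib algebra_simps)
  qed (use i in auto)
  also have "\<dots> \<le> integral {0..1} ?h"
    using sub by (intro integral_subset_le integrable_continuous_real continuous_on_subset[OF ch sub] ch) auto
  finally show ?thesis using \<sigma> integral_unique[OF i] by (simp add: abs_mult)
qed

text \<open>Deliberately crude: 10 covers both \<open>(5/2) / (1/4)\<close> and
  \<open>(5/2) * (13/4)\<close>.\<close>

lemma near_one_bounds:
  fixes v \<eta> :: real
  assumes "\<bar>v - 1\<bar> \<le> \<eta>" "\<eta> \<le> 1/2"
  shows "\<bar>1 / v\<^sup>2 - 1\<bar> \<le> 10 * \<eta>" "\<bar>v^4 - 1\<bar> \<le> 10 * \<eta>" "v^4 \<le> 16" "1/2 \<le> v"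
proof -
  show v: "1/2 \<le> v" using assms by linarith
  have v2: "v \<le> 3/2" using assms by linarith
  have s: "\<bar>v\<^sup>2 - 1\<bar> \<le> \<eta> * (5/2)"
  proof -
    have "\<bar>v\<^sup>2 - 1\<bar> = \<bar>v - 1\<bar> * \<bar>v + 1\<bar>" by (simp add: power2_eq_square algebra_simps flip: abs_mult)
    also have "\<dots> \<le> \<eta> * (5/2)" using assms v v2 by (intro mult_mono) auto
    finally show ?thesis .
  qed
  have vl: "1/4 \<le> v\<^sup>2" using power_mono[OF v, of 2] by (simp add: power2_eq_square)
  have vu: "v\<^sup>2 \<le> 9/4" using power_mono[OF v2, of 2] v by (simp add: power2_eq_square)
  have "1 / v\<^sup>2 - 1 = (1 - v\<^sup>2) / v\<^sup>2" using v by (simp add: field_simps)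
  then have "\<bar>1 / v\<^sup>2 - 1\<bar> = \<bar>v\<^sup>2 - 1\<bar> / v\<^sup>2" using v by (simp add: abs_minus_commute)
  also have "\<dots> \<le> \<eta> * (5/2) / (1/4)" using s vl assms(1) by (intro frac_le) auto
  finally show "\<bar>1 / v\<^sup>2 - 1\<bar> \<le> 10 * \<eta>" by simp
  have "v^4 - 1 = (v\<^sup>2 - 1) * (v\<^sup>2 + 1)" by (simp add: power2_eq_square power4_eq_xxxx algebra_simps)
  then have "\<bar>v^4 - 1\<bar> = \<bar>v\<^sup>2 - 1\<bar> * \<bar>v\<^sup>2 + 1\<bar>" by (simp only: abs_mult)
  also have "\<dots> \<le> \<eta> * (5/2) * (13/4)" using s vu assms(1) by (intro mult_mono) auto
  also have "\<dots> \<le> 10 * \<eta>" using assms(1) by simp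
  finally show "\<bar>v^4 - 1\<bar> \<le> 10 * \<eta>" .
  have "(v\<^sup>2)\<^sup>2 \<le> (9/4)\<^sup>2" using vu by (intro power_mono) auto
  then show "v^4 \<le> 16" by (simp add: power2_eq_square power4_eq_xxxx mult.assoc)
qed

lemma bounded_derivative_growth:
  fixes f :: "real \<Rightarrow> real"
  assumes d: "\<And>x. x \<in> {0..T} \<Longrightarrow> (f has_real_derivative f' x) (at x within {0..T})"
    and b: "\<And>x. x \<in> {0..T} \<Longrightarrow> \<bar>f' x\<bar> \<le> B" and xy: "x \<in> {0..T}" "y \<in> {0..T}"
  shows "\<bar>f x - f y\<bar> \<le> B * T"
proof -
  have "norm (f x - f y) \<le> B * norm (x - y)"
    by (rule field_differentiable_bound[OF convex_real_interval(5) d]) (use b xy in auto)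
  also have "\<dots> \<le> B * T" using xy b[OF xy(1)] by (intro mult_left_mono) auto
  finally show ?thesis by simp
qed

text \<open>Blow-up at the free end in the variable \<open>\<sigma> * (1 - y)\<close>.
  \<open>M 1 = 0\<close> makes the initial slope the explicit number
  \<open>- (2 * k * \<kappa> / \<sigma>)\<close>, and the rescaled flux, starting at 0 with bounded
  derivative, is bounded on {0..T}, so replacing \<open>v\<close> by 1 costs
  \<open>O(\<eta>)\<close>. The amplitude factor \<open>k\<close> admits phases that are themselves
  small.\<close>

lemma C1_loc_conv_right_end:
  fixes \<phi> \<phi>' M v :: "real \<Rightarrow> real \<Rightarrow> real"
  assumes reg: "eventually (\<lambda>e. regular_minimizer e (\<sigma> e) (\<kappa> e) (\<eta> e) (v e) (\<phi> e) (M e) (\<phi>' e)) F"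
    and \<eta>: "(\<eta> \<longlongrightarrow> 0) F" and \<sigma>: "filterlim \<sigma> at_top F"
    and lim: "\<And>x. x \<ge> 0 \<Longrightarrow> (\<psi>0 has_real_derivative z0 x) (at x within {0..})"
      "\<And>x. x \<ge> 0 \<Longrightarrow> (z0 has_real_derivative q0 x) (at x within {0..})"
    and B: "eventually (\<lambda>e. \<forall>x\<in>{0..1}. \<bar>k e * (sin (\<phi> e x) * cos (\<phi> e x))\<bar> \<le> B) F"
    and init: "((\<lambda>e. k e * \<phi> e 1) \<longlongrightarrow> \<psi>0 0) F" "((\<lambda>e. - (2 * k e * \<kappa> e / \<sigma> e)) \<longlongrightarrow> z0 0) F"
    and nonlin: "\<And>\<rho>. \<rho> > 0 \<Longrightarrow> eventually (\<lambda>e. \<forall>x\<in>{0..\<sigma> e}.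
      \<bar>k e * (sin (\<phi> e (1 - x / \<sigma> e)) * cos (\<phi> e (1 - x / \<sigma> e))) - q0 x\<bar> \<le> \<bar>k e * \<phi> e (1 - x / \<sigma> e) - \<psi>0 x\<bar> + \<rho>) F"
  shows "C1_loc_conv (\<lambda>e x. k e * \<phi> e (1 - x / \<sigma> e)) \<psi>0 F"
proof -
  define m where "m = (\<lambda>e x. k e * (M e (1 - x / \<sigma> e) / \<sigma> e))"
  define s where "s = (\<lambda>e x. k e * (sin (\<phi> e (1 - x / \<sigma> e)) * cos (\<phi> e (1 - x / \<sigma> e))))"
  define w where "w = (\<lambda>e x. v e (1 - x / \<sigma> e))"
  define c where "c = (\<lambda>e. - (2 * k e * \<kappa> e / \<sigma> e))"
  show ?thesis
  proof (rule C1_loc_conv_by_Gronwall[OF lim, where z = "\<lambda>e x. c e + m e x" and z' = "\<lambda>e x. (w e x)^4 * s e x"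
        and \<psi>' = "\<lambda>e x. c e + m e x / (w e x)\<^sup>2"])
    show "((\<lambda>e. k e * \<phi> e (1 - 0 / \<sigma> e)) \<longlongrightarrow> \<psi>0 0) F" using init(1) by simp
    have "eventually (\<lambda>e. c e = c e + m e 0) F"
      using reg by eventually_elim (auto simp: m_def regular_minimizer_def)
    then show "((\<lambda>e. c e + m e 0) \<longlongrightarrow> z0 0) F"
      by (rule Lim_transform_eventually[OF init(2)[folded c_def]])
  next
    fix T \<rho> :: real assume T: "T > 0" and \<rho>: "\<rho> > 0"
    \<comment> \<open>Chosen so that the two errors caused by \<open>v\<close>, namely
      \<open>10 * \<eta>\<close> times \<open>16 * \<bar>B\<bar> * T\<close> and
      \<open>10 * \<eta>\<close> times \<open>\<bar>B\<bar>\<close>, together stay below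
      \<open>\<rho> / 2\<close>.\<close>
    define \<rho>' where "\<rho>' = \<rho> / (2 * (160 * \<bar>B\<bar> * T + 10 * \<bar>B\<bar> + 1))"
    define K where "K = 160 * \<bar>B\<bar> * T + 10 * \<bar>B\<bar> + 1"
    have "K > 0" unfolding K_def using T by (intro add_nonneg_pos add_nonneg_nonneg mult_nonneg_nonneg) auto
    then have \<rho>': "\<rho>' > 0" "\<rho>' * (160 * \<bar>B\<bar> * T + 10 * \<bar>B\<bar> + 1) = \<rho> / 2" using \<rho> unfolding \<rho>'_def K_def[symmetric] by auto
    have e\<eta>: "eventually (\<lambda>e. \<eta> e < \<rho>') F" using order_tendstoD(2)[OF \<eta> \<rho>'(1)] .
    have e\<sigma>: "eventually (\<lambda>e. T \<le> \<sigma> e) F" using \<sigma> by (simp add: filterlim_at_top)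
    have e\<rho>: "\<rho> / 2 > 0" using \<rho> by simp
    show "\<forall>\<^sub>F e in F. \<forall>x\<in>{0..T}.
             ((\<lambda>x. k e * \<phi> e (1 - x / \<sigma> e)) has_real_derivative c e + m e x / (w e x)\<^sup>2) (at x within {0..T}) \<and>
             ((\<lambda>x. c e + m e x) has_real_derivative w e x ^ 4 * s e x) (at x within {0..T}) \<and>
             \<bar>c e + m e x / (w e x)\<^sup>2 - (c e + m e x)\<bar> \<le> \<rho> \<and>
             \<bar>w e x ^ 4 * s e x - q0 x\<bar> \<le> \<bar>k e * \<phi> e (1 - x / \<sigma> e) - \<psi>0 x\<bar> + \<rho>"
      using reg e\<eta> e\<sigma> B nonlin[OF e\<rho>]
    proof eventually_elim
      case (elim e)
      have \<sigma>0: "\<sigma> e > 0" and \<eta>0: "0 \<le> \<eta> e" "\<eta> e \<le> 1/2" using elim(1) by (auto simp: regular_minimizer_def)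
      have im: "1 - x / \<sigma> e \<in> {0..1}" if "x \<in> {0..T}" for x
        using that \<sigma>0 elim(3) by (auto simp: field_simps)
      have vb: "\<bar>w e x - 1\<bar> \<le> \<eta> e" if "x \<in> {0..T}" for x
        using im[OF that] elim(1) by (auto simp: w_def regular_minimizer_def)
      have sB: "\<bar>s e x\<bar> \<le> \<bar>B\<bar>" if "x \<in> {0..T}" for x
        using im[OF that] elim(4) by (fastforce simp: s_def)
      have chain: "((\<lambda>x. f (1 - x / \<sigma> e)) has_real_derivative - d / \<sigma> e) (at x within {0..T})"
        if "(f has_real_derivative d) (at (1 - x / \<sigma> e) within {0..1})" "x \<in> {0..T}" for f d x
      proof -
        have a: "((\<lambda>x. 1 - x / \<sigma> e) has_real_derivative - 1 / \<sigma> e) (at x within {0..T})"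
          using \<sigma>0 by (auto intro!: derivative_eq_intros)
        have b: "(f has_real_derivative d) (at (1 - x / \<sigma> e) within (\<lambda>x. 1 - x / \<sigma> e) ` {0..T})"
          using that(1) im by (intro DERIV_subset[OF that(1)]) auto
        show ?thesis using DERIV_image_chain[OF b a] by (simp add: o_def)
      qed
      have dM: "(m e has_real_derivative w e x ^ 4 * s e x) (at x within {0..T})" if x: "x \<in> {0..T}" for x
      proof -
        have "(M e has_real_derivative - ((\<sigma> e)\<^sup>2 * (w e x)^4 * (sin (\<phi> e (1 - x / \<sigma> e)) * cos (\<phi> e (1 - x / \<sigma> e))))) (at (1 - x / \<sigma> e) within {0..1})"
          using elim(1) im[OF x] by (auto simp: regular_minimizer_def w_def)
        from DERIV_cmult[OF DERIV_cdivide[OF chain[OF this x]], of "k e" "\<sigma> e"]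
        show ?thesis unfolding m_def
          by (rule DERIV_cong) (use \<sigma>0 in \<open>simp add: s_def power2_eq_square\<close>)
      qed
      have m0: "m e 0 = 0" using elim(1) by (simp add: m_def regular_minimizer_def)
      have mB: "\<bar>m e x\<bar> \<le> 16 * \<bar>B\<bar> * T" if x: "x \<in> {0..T}" for x
      proof -
        have "\<bar>m e x - m e 0\<bar> \<le> 16 * \<bar>B\<bar> * T"
        proof (rule bounded_derivative_growth[OF dM _ x])
          fix y assume y: "y \<in> {0..T}"
          show "\<bar>w e y ^ 4 * s e y\<bar> \<le> 16 * \<bar>B\<bar>" unfolding abs_mult
            using near_one_bounds(3)[OF vb[OF y] \<eta>0(2)] sB[OF y] by (intro mult_mono) auto
        qed (use T in auto)
        then show ?thesis using m0 by simp
      qed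
      show ?case
      proof (intro ballI conjI)
        fix x assume x: "x \<in> {0..T}"
        have "(\<phi> e has_real_derivative 2 * \<kappa> e - M e (1 - x / \<sigma> e) / (w e x)\<^sup>2) (at (1 - x / \<sigma> e) within {0..1})"
          using elim(1) im[OF x] by (auto simp: regular_minimizer_def w_def)
        from DERIV_cmult[OF chain[OF this x], of "k e"]
        show "((\<lambda>x. k e * \<phi> e (1 - x / \<sigma> e)) has_real_derivative c e + m e x / (w e x)\<^sup>2) (at x within {0..T})"
          by (rule DERIV_cong) (simp add: c_def m_def algebra_simps diff_divide_distrib)
        show "((\<lambda>x. c e + m e x) has_real_derivative w e x ^ 4 * s e x) (at x within {0..T})"
          using DERIV_add[OF DERIV_const dM[OF x], of "c e"] by simp
        note nb = near_one_bounds[OF vb[OF x] \<eta>0(2)]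
        have t: "10 * \<eta> e * (16 * \<bar>B\<bar> * T) + 10 * \<eta> e * \<bar>B\<bar> \<le> \<rho> / 2"
        proof -
          have "\<eta> e * (160 * \<bar>B\<bar> * T + 10 * \<bar>B\<bar>) \<le> \<rho>' * (160 * \<bar>B\<bar> * T + 10 * \<bar>B\<bar> + 1)"
            using elim(2) \<eta>0 \<rho>' T by (intro mult_mono) auto
          then show ?thesis using \<rho>'(2) by (simp add: algebra_simps)
        qed
        have t1: "0 \<le> 10 * \<eta> e * (16 * \<bar>B\<bar> * T)" "0 \<le> 10 * \<eta> e * \<bar>B\<bar>" using \<eta>0 T by auto
        have "\<bar>c e + m e x / (w e x)\<^sup>2 - (c e + m e x)\<bar> = \<bar>1 / (w e x)\<^sup>2 - 1\<bar> * \<bar>m e x\<bar>"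
          by (simp add: algebra_simps flip: abs_mult)
        also have "\<dots> \<le> 10 * \<eta> e * (16 * \<bar>B\<bar> * T)" using nb(1) mB[OF x] by (intro mult_mono) auto
        finally show "\<bar>c e + m e x / (w e x)\<^sup>2 - (c e + m e x)\<bar> \<le> \<rho>" using t t1 \<rho> by linarith
        have "\<bar>w e x ^ 4 * s e x - s e x\<bar> = \<bar>w e x ^ 4 - 1\<bar> * \<bar>s e x\<bar>" by (simp add: algebra_simps flip: abs_mult)
        also have "\<dots> \<le> 10 * \<eta> e * \<bar>B\<bar>" using nb(2) sB[OF x] by (intro mult_mono) auto
        finally have "\<bar>w e x ^ 4 * s e x - s e x\<bar> \<le> \<rho> / 2" using t t1 by linarith
        moreover have "\<bar>s e x - q0 x\<bar> \<le> \<bar>k e * \<phi> e (1 - x / \<sigma> e) - \<psi>0 x\<bar> + \<rho> / 2"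
          using elim(5) elim(3) x unfolding s_def by auto
        ultimately show "\<bar>w e x ^ 4 * s e x - q0 x\<bar> \<le> \<bar>k e * \<phi> e (1 - x / \<sigma> e) - \<psi>0 x\<bar> + \<rho>"
          by linarith
      qed
    qed
  qed
qed

lemma abs_SUP_le:
  fixes f :: "real \<Rightarrow> real"
  assumes "\<And>x. x \<in> {0<..<1} \<Longrightarrow> \<bar>f x\<bar> \<le> m"
  shows "\<bar>SUP x\<in>{0<..<1}. \<bar>f x\<bar>\<bar> \<le> m"
proof -
  have "(SUP x\<in>{0<..<1}. \<bar>f x\<bar>) \<le> m" using assms by (intro cSUP_least) auto
  moreover have "\<bar>f (1/2)\<bar> \<le> (SUP x\<in>{0<..<1}. \<bar>f x\<bar>)"
    using assms by (intro cSUP_upper bdd_aboveI[of _ m]) auto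
  ultimately show ?thesis by linarith
qed

lemma asymp_eqI:
  assumes "((\<lambda>e. f e / g e) \<longlongrightarrow> 1) F" "eventually (\<lambda>e. g e \<noteq> 0) F"
  shows "asymp_eq F f g"
  unfolding asymp_eq_def
proof (intro exI conjI)
  show "((\<lambda>e. f e / g e - 1) \<longlongrightarrow> 0) F" using tendsto_diff[OF assms(1) tendsto_const[of 1]] by simp
  show "eventually (\<lambda>e. f e = g e * (1 + (f e / g e - 1))) F" using assms(2) by eventually_elim simp
qed

lemma eventually_at_right_0_pos: "eventually (\<lambda>e. (e::real) > 0) (at_right 0)"
  by (simp add: eventually_at_right_less)

lemma minimizer_family_regular:
  assumes fam: "minimizer_family \<delta> \<kappa> v \<phi>" and \<eta>: "((\<lambda>e. sqrt (6 * e) * \<kappa> e) \<longlongrightarrow> 0) (at_right 0)"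
  obtains M \<phi>' where "eventually (\<lambda>e. regular_minimizer e (sqrt (\<delta> e) / e) (\<kappa> e) (sqrt (6 * e) * \<kappa> e) (v e) (\<phi> e) (M e) (\<phi>' e)) (at_right 0)"
proof -
  have *: "\<exists>M \<phi>'. e > 0 \<and> sqrt (6 * e) * \<kappa> e \<le> 1/2 \<longrightarrow> 
      regular_minimizer e (sqrt (\<delta> e) / e) (\<kappa> e) (sqrt (6 * e) * \<kappa> e) (v e) (\<phi> e) M \<phi>'" for e
    using minimizer_regular[of e "\<delta> e" "\<kappa> e" "v e" "\<phi> e"] fam unfolding minimizer_family_def by blast
  then obtain M \<phi>' where M: "\<And>e. e > 0 \<and> sqrt (6 * e) * \<kappa> e \<le> 1/2 \<longrightarrow> 
      regular_minimizer e (sqrt (\<delta> e) / e) (\<kappa> e) (sqrt (6 * e) * \<kappa> e) (v e) (\<phi> e) (M e) (\<phi>' e)" by metis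
  have "eventually (\<lambda>e. sqrt (6 * e) * \<kappa> e < 1/2) (at_right 0)" using order_tendstoD(2)[OF \<eta>, of "1/2"] by simp
  then have "eventually (\<lambda>e. regular_minimizer e (sqrt (\<delta> e) / e) (\<kappa> e) (sqrt (6 * e) * \<kappa> e) (v e) (\<phi> e) (M e) (\<phi>' e)) (at_right 0)"
    using eventually_at_right_0_pos by eventually_elim (use M in auto)
  then show thesis by (rule that)
qed

section \<open>Asymptotics of the energy in the non-winding regimes\<close>

text \<open>Well energy, path cost at an arbitrary point and boundary term at 1 are kept as separate
  summands, since the modulus, the sup bound on the phase and the boundary value are read off from
  different ones.\<close>

lemma family_energy_lower:
  assumes fam: "minimizer_family \<delta> \<kappa> v \<phi>"
    and reg: "eventually (\<lambda>e. regular_minimizer e (sqrt (\<delta> e) / e) (\<kappa> e) (\<eta> e) (v e) (\<phi> e) (M e) (\<phi>' e)) (at_right 0)"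
    and th: "((\<lambda>e. 1 - 4 * \<eta> e - 2 * \<kappa> e * e) \<longlongrightarrow> 1) (at_right 0)"
  shows "eventually (\<lambda>e. \<forall>x\<in>{0..1}. (1 - \<kappa> e * e) * well_energy e (v e)
      + (1 - 4 * \<eta> e - 2 * \<kappa> e * e) * (sqrt (\<delta> e) / e / 4 * \<bar>abs_sin_primitive (\<phi> e x)\<bar>)
      - \<kappa> e / 2 * \<phi> e 1 \<le> G e (\<delta> e) (\<kappa> e) (v e) (\<phi> e)) (at_right 0)"
proof -
  have "eventually (\<lambda>e. 1 - 4 * \<eta> e - 2 * \<kappa> e * e > 0) (at_right 0)" using order_tendstoD(1)[OF th, of 0] by simp
  then show ?thesis using reg
  proof eventually_elim
    case (elim e)
    have e: "e > 0" using elim(2) by (simp add: regular_minimizer_def)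
    then have min: "is_minimizer e (\<delta> e) (\<kappa> e) (v e) (\<phi> e)" "\<delta> e > 0" using fam by (auto simp: minimizer_family_def)
    show ?case
    proof
      fix x :: real assume x: "x \<in> {0..1}"
      have "(1 - 4 * \<eta> e - 2 * \<kappa> e * e) * (sqrt (\<delta> e) / e / 4 * \<bar>abs_sin_primitive (\<phi> e x)\<bar>)
         \<le> (1 - 4 * \<eta> e - 2 * \<kappa> e * e) * integral {0..1} (\<lambda>x. 1/8 * (\<phi>' e x)\<^sup>2 + (sqrt (\<delta> e) / e)\<^sup>2/8 * (sin (\<phi> e x))\<^sup>2)"
        using elim(1) by (intro mult_left_mono regular_minimizer_path_cost[OF elim(2) x]) auto
      then show "(1 - \<kappa> e * e) * well_energy e (v e)
          + (1 - 4 * \<eta> e - 2 * \<kappa> e * e) * (sqrt (\<delta> e) / e / 4 * \<bar>abs_sin_primitive (\<phi> e x)\<bar>)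
          - \<kappa> e / 2 * \<phi> e 1 \<le> G e (\<delta> e) (\<kappa> e) (v e) (\<phi> e)"
        using regular_minimizer_energy[OF elim(2) min(1) refl min(2)] by linarith
    qed
  qed
qed

text \<open>Merges the bounds for all \<open>\<mu>\<close> into one infinitesimal: \<open>h\<close>
  is the least relative error, an infimum that is still a valid bound because the inequality is
  closed in \<open>\<mu>\<close>.\<close>

lemma uniform_bound_factor:
  fixes f :: "'a \<Rightarrow> real \<Rightarrow> real"
  assumes T: "T > 0" and ev: "\<And>\<mu>. \<mu> > 0 \<Longrightarrow> eventually (\<lambda>e. \<forall>x\<in>A e. \<bar>f e x\<bar> \<le> T + \<mu>) F"
  shows "\<exists>h. (h \<longlongrightarrow> 0) F \<and> eventually (\<lambda>e. \<forall>x\<in>A e. \<bar>f e x\<bar> \<le> T * (1 + h e)) F"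
proof -
  define X where "X e = {\<mu>. 0 \<le> \<mu> \<and> (\<forall>x\<in>A e. \<bar>f e x\<bar> \<le> T * (1 + \<mu>))}" for e
  define h where "h e = Inf (X e)" for e
  have bdd: "bdd_below (X e)" for e by (auto simp: X_def intro: bdd_belowI[of _ 0])
  have ev': "eventually (\<lambda>e. \<mu> \<in> X e) F" if "\<mu> > 0" for \<mu>
    using ev[of "T * \<mu>"] T that by (auto simp: X_def algebra_simps)
  have "(h \<longlongrightarrow> 0) F"
  proof (rule tendstoI)
    fix r :: real assume r: "r > 0"
    have "eventually (\<lambda>e. r / 2 \<in> X e) F" using r by (intro ev') auto
    then show "eventually (\<lambda>e. dist (h e) 0 < r) F"
    proof eventually_elim
      case (elim e)
      have "h e \<le> r / 2" unfolding h_def using elim bdd by (intro cInf_lower) auto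
      moreover have "X e \<noteq> {}" using elim by auto
      then have "0 \<le> h e" unfolding h_def by (rule cInf_greatest) (simp add: X_def)
      ultimately show ?case using r by simp
    qed
  qed
  moreover have "eventually (\<lambda>e. \<forall>x\<in>A e. \<bar>f e x\<bar> \<le> T * (1 + h e)) F"
    using ev'[OF zero_less_one]
  proof eventually_elim
    case (elim e)
    show ?case
    proof
      fix x assume x: "x \<in> A e"
      have "\<bar>f e x\<bar> / T - 1 \<le> h e" unfolding h_def
      proof (rule cInf_greatest)
        fix \<mu> assume "\<mu> \<in> X e"
        then have "\<bar>f e x\<bar> \<le> T * (1 + \<mu>)" using x by (auto simp: X_def)
        then show "\<bar>f e x\<bar> / T - 1 \<le> \<mu>" using T by (simp add: field_simps)
      qed (use elim in auto)
      then show "\<bar>f e x\<bar> \<le> T * (1 + h e)" using T by (simp add: field_simps)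
    qed
  qed
  ultimately show ?thesis by blast
qed

text \<open>\<open>\<delta> = o(\<epsilon>)\<close> makes the sup bound on \<open>v - 1\<close>
  vanish, as it is a multiple of \<open>sqrt (\<delta> / \<epsilon>)\<close>;
  \<open>\<epsilon>\<^sup>2 = o(\<delta>)\<close> sends the inverse layer width to infinity.\<close>

lemma scaling_limits:
  fixes \<delta> \<kappa> :: "real \<Rightarrow> real"
  assumes \<kappa>': "\<forall>e>0. \<kappa> e = kt * sqrt (\<delta> e) / e" and \<delta>': "\<forall>e>0. \<delta> e > 0"
    and o1: "\<delta> \<in> o[at_right 0](\<lambda>e. e)" and o2: "(\<lambda>e. e\<^sup>2) \<in> o[at_right 0](\<delta>)"
  shows "(\<delta> \<longlongrightarrow> 0) (at_right 0)" "filterlim (\<lambda>e. sqrt (\<delta> e) / e) at_top (at_right 0)"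
    "((\<lambda>e. sqrt (6 * e) * \<kappa> e) \<longlongrightarrow> 0) (at_right 0)" "((\<lambda>e. \<kappa> e * e) \<longlongrightarrow> 0) (at_right 0)"
    "((\<lambda>e. 1 - 4 * (sqrt (6 * e) * \<kappa> e) - 2 * \<kappa> e * e) \<longlongrightarrow> 1) (at_right 0)"
    "\<And>e. e > 0 \<Longrightarrow> sqrt (6 * e) * \<kappa> e = sqrt 6 * kt * sqrt (\<delta> e / e)"
proof -
  have \<kappa>: "\<kappa> e = kt * sqrt (\<delta> e) / e" and \<delta>: "\<delta> e > 0" if "e > 0" for e using \<kappa>' \<delta>' that by auto
  have d1: "((\<lambda>e. \<delta> e / e) \<longlongrightarrow> 0) (at_right 0)" using smalloD_tendsto[OF o1] .
  have d2: "((\<lambda>e. e\<^sup>2 / \<delta> e) \<longlongrightarrow> 0) (at_right 0)" using smalloD_tendsto[OF o2] .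
  have id: "((\<lambda>e::real. e) \<longlongrightarrow> 0) (at_right 0)" by (rule tendsto_ident_at)
  have "((\<lambda>e. \<delta> e / e * e) \<longlongrightarrow> 0 * 0) (at_right 0)" by (intro tendsto_mult d1 id)
  moreover have "eventually (\<lambda>e. \<delta> e / e * e = \<delta> e) (at_right 0)" using eventually_at_right_0_pos by eventually_elim simp
  ultimately show \<delta>0: "(\<delta> \<longlongrightarrow> 0) (at_right 0)" using Lim_transform_eventually by fastforce
  have "((\<lambda>e. sqrt (e\<^sup>2 / \<delta> e)) \<longlongrightarrow> sqrt 0) (at_right 0)" by (intro tendsto_real_sqrt d2)
  moreover have "eventually (\<lambda>e. sqrt (e\<^sup>2 / \<delta> e) = e / sqrt (\<delta> e)) (at_right 0)"
    using eventually_at_right_0_pos by eventually_elim (simp add: real_sqrt_divide)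
  ultimately have "((\<lambda>e. e / sqrt (\<delta> e)) \<longlongrightarrow> 0) (at_right 0)" using Lim_transform_eventually by fastforce
  moreover have "eventually (\<lambda>e. e / sqrt (\<delta> e) > 0) (at_right 0)"
    using eventually_at_right_0_pos by eventually_elim (simp add: \<delta>)
  ultimately have "filterlim (\<lambda>e. inverse (e / sqrt (\<delta> e))) at_top (at_right 0)"
    by (rule filterlim_inverse_at_top)
  then show "filterlim (\<lambda>e. sqrt (\<delta> e) / e) at_top (at_right 0)" by simp
  show \<eta>: "sqrt (6 * e) * \<kappa> e = sqrt 6 * kt * sqrt (\<delta> e / e)" if "e > 0" for e
  proof -
    have "sqrt (6 * e) * \<kappa> e = sqrt 6 * kt * sqrt (\<delta> e) * (sqrt e / e)" using \<kappa>[OF that] by (simp add: real_sqrt_mult)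
    also have "sqrt e / e = 1 / sqrt e"
    proof -
      have "sqrt e * sqrt e = e" using that by simp
      then show ?thesis using that by (simp add: field_simps del: real_sqrt_mult_self)
    qed
    finally show ?thesis by (simp add: real_sqrt_divide)
  qed
  have "((\<lambda>e. sqrt 6 * kt * sqrt (\<delta> e / e)) \<longlongrightarrow> sqrt 6 * kt * sqrt 0) (at_right 0)" by (intro tendsto_intros d1)
  moreover have "eventually (\<lambda>e. sqrt 6 * kt * sqrt (\<delta> e / e) = sqrt (6 * e) * \<kappa> e) (at_right 0)"
    using eventually_at_right_0_pos by eventually_elim (simp add: \<eta>)
  ultimately show \<eta>0: "((\<lambda>e. sqrt (6 * e) * \<kappa> e) \<longlongrightarrow> 0) (at_right 0)" using Lim_transform_eventually by fastforce
  have "((\<lambda>e. kt * sqrt (\<delta> e)) \<longlongrightarrow> kt * sqrt 0) (at_right 0)" by (intro tendsto_intros \<delta>0)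
  moreover have "eventually (\<lambda>e. kt * sqrt (\<delta> e) = \<kappa> e * e) (at_right 0)"
    using eventually_at_right_0_pos by eventually_elim (simp add: \<kappa>)
  ultimately show \<kappa>e: "((\<lambda>e. \<kappa> e * e) \<longlongrightarrow> 0) (at_right 0)" using Lim_transform_eventually by fastforce
  have "((\<lambda>e. 1 - 4 * (sqrt (6 * e) * \<kappa> e) - 2 * (\<kappa> e * e)) \<longlongrightarrow> 1 - 4 * 0 - 2 * 0) (at_right 0)"
    by (intro tendsto_diff tendsto_mult tendsto_const \<eta>0 \<kappa>e)
  then show "((\<lambda>e. 1 - 4 * (sqrt (6 * e) * \<kappa> e) - 2 * \<kappa> e * e) \<longlongrightarrow> 1) (at_right 0)" by (simp add: mult.assoc)
qed

text \<open>For a decreasing phase in {0..pi}, equality in the Modica-Mortola inequality means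
  \<open>f' = - sin f\<close> after rescaling, an equation solved by the half-angle
  substitution.\<close>

lemma heteroclinic_profile:
  fixes s :: real
  assumes s: "0 < s" "s < pi / 2"
  defines "f \<equiv> \<lambda>x. 2 * arctan (tan (s / 2) * exp (- x))"
  shows "f 0 = s" "\<And>x. (f has_real_derivative - sin (f x)) (at x)"
    "\<And>x. 0 < f x" "\<And>x. x \<ge> 0 \<Longrightarrow> f x \<le> s" "(f \<longlongrightarrow> 0) at_top" "\<And>x y. x \<le> y \<Longrightarrow> f y \<le> f x"
proof -
  define \<tau> where "\<tau> = tan (s / 2)"
  have \<tau>: "\<tau> > 0" unfolding \<tau>_def by (rule tan_gt_zero) (use s in auto)
  show f0: "f 0 = s" using s by (simp add: f_def arctan_tan)
  have sin2: "sin (2 * arctan u) = 2 * u / (1 + u\<^sup>2)" for u :: real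
  proof -
    have "sqrt (1 + u\<^sup>2) * sqrt (1 + u\<^sup>2) = 1 + u\<^sup>2" by simp
    then show ?thesis by (simp add: sin_double sin_arctan cos_arctan)
  qed
  show "(f has_real_derivative - sin (f x)) (at x)" for x
    unfolding f_def sin2 \<tau>_def[symmetric]
    by (auto intro!: derivative_eq_intros simp: field_simps add_pos_nonneg)
  show "0 < f x" for x using \<tau> by (simp add: f_def \<tau>_def[symmetric])
  show mono: "f y \<le> f x" if "x \<le> y" for x y
    using that \<tau> by (simp add: f_def \<tau>_def[symmetric] arctan_le_iff)
  show "f x \<le> s" if "x \<ge> 0" for x using mono[OF that] f0 by simp
  have "((\<lambda>x::real. exp (- x)) \<longlongrightarrow> 0) at_top" by real_asymp
  then have "((\<lambda>x. 2 * arctan (tan (s / 2) * exp (- x))) \<longlongrightarrow> 2 * arctan (tan (s / 2) * 0)) at_top"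
    by (intro tendsto_intros)
  then show "(f \<longlongrightarrow> 0) at_top" by (simp add: f_def)
qed

text \<open>Reversed in space, the profile satisfies \<open>g' = \<sigma> * sin g\<close> and
  saturates the lower bound, but it does not vanish at 0. Subtracting the constant
  \<open>g 0\<close> can only lower the squared sine, as all values lie between 0 and
  \<open>pi / 2\<close>, and shortens the twist by \<open>f \<sigma>\<close>, which is the error
  term.\<close>

lemma subcritical_upper_bound:
  assumes min: "is_minimizer \<epsilon> \<delta> \<kappa> v \<phi>" and \<delta>: "\<delta> > 0" "\<epsilon> > 0" and s: "0 < s" "s < pi / 2"
    and \<sigma>: "\<sigma> = sqrt \<delta> / \<epsilon>" and \<kappa>: "\<kappa> = kt * \<sigma>" "kt > 0"
  defines "f \<equiv> \<lambda>x. 2 * arctan (tan (s / 2) * exp (- x))"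
  shows "G \<epsilon> \<delta> \<kappa> v \<phi> \<le> \<sigma> * ((1 - cos s) / 4 - kt / 2 * s + kt / 2 * f \<sigma>)"
proof -
  have prof: "f 0 = s" "(f has_real_derivative - sin (f x)) (at x)" "0 < f x"
    "x \<ge> 0 \<Longrightarrow> f x \<le> s" "x \<le> y \<Longrightarrow> f y \<le> f x" for x y
    unfolding f_def using heteroclinic_profile[OF s] by blast+
  have \<sigma>0: "\<sigma> > 0" using \<delta> by (simp add: \<sigma>)
  have \<sigma>2: "\<delta>/(8*\<epsilon>\<^sup>2) = \<sigma>\<^sup>2/8" using \<delta> by (simp add: \<sigma> power_divide)
  define g where "g = (\<lambda>x. f (\<sigma> * (1 - x)))"
  define g' where "g' = (\<lambda>x. \<sigma> * sin (g x))"
  have dg: "(g has_real_derivative g' x) (at x)" for x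
    unfolding g_def g'_def
    by (rule DERIV_cong[OF DERIV_chain2[OF prof(2), of "\<lambda>x. \<sigma> * (1 - x)" "- \<sigma>"]])
       (auto intro!: derivative_eq_intros)
  have cg: "continuous_on A g" for A by (rule DERIV_continuous_on[OF has_field_derivative_at_within[OF dg]])
  have cg': "continuous_on A g'" for A unfolding g'_def by (intro continuous_intros cg)
  have d\<psi>: "((\<lambda>x. g x - g 0) has_real_derivative g' x) (at x)" for x
    using DERIV_diff[OF dg DERIV_const[of "g 0"]] by simp
  have "G \<epsilon> \<delta> \<kappa> v \<phi> \<le> integral {0..1} (\<lambda>x. 1/8 * (g' x)\<^sup>2 + \<sigma>\<^sup>2/8 * (sin (g x - g 0))\<^sup>2 - \<kappa>/2 * g' x)"
    using minimizer_upper_bound[OF min d\<psi> cg'] unfolding \<sigma>2 by simp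
  also have "\<dots> \<le> integral {0..1} (\<lambda>x. \<sigma>/4 * (sin (g x) * g' x) - \<kappa>/2 * g' x)"
  proof (rule integral_le)
    fix x :: real assume x: "x \<in> {0..1}"
    have "g 0 \<le> g x" unfolding g_def by (rule prof(5)) (use x \<sigma>0 in auto)
    moreover have "0 < g 0" "g x \<le> s" unfolding g_def using prof(3) prof(4)[of "\<sigma> * (1 - x)"] x \<sigma>0 by auto
    ultimately have "0 \<le> sin (g x - g 0)" "sin (g x - g 0) \<le> sin (g x)"
      using s by (auto intro!: sin_ge_zero sin_monotone_2pi_le)
    then have "(sin (g x - g 0))\<^sup>2 \<le> (sin (g x))\<^sup>2" by (intro power_mono) auto
    then have "\<sigma>\<^sup>2/8 * (sin (g x - g 0))\<^sup>2 \<le> \<sigma>\<^sup>2/8 * (sin (g x))\<^sup>2" by (intro mult_left_mono) auto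
    moreover have "\<sigma>/4 * (sin (g x) * g' x) = 1/8 * (g' x)\<^sup>2 + \<sigma>\<^sup>2/8 * (sin (g x))\<^sup>2"
      by (simp add: g'_def power2_eq_square)
    ultimately show "1/8 * (g' x)\<^sup>2 + \<sigma>\<^sup>2/8 * (sin (g x - g 0))\<^sup>2 - \<kappa>/2 * g' x \<le> \<sigma>/4 * (sin (g x) * g' x) - \<kappa>/2 * g' x"
      by linarith
  qed (intro integrable_continuous_real continuous_intros cg cg')+
  also have "\<dots> = (- \<sigma>/4 * cos (g 1) - \<kappa>/2 * g 1) - (- \<sigma>/4 * cos (g 0) - \<kappa>/2 * g 0)"
  proof (rule integral_unique, rule fundamental_theorem_of_calculus)
    fix x :: real
    have "((\<lambda>x. - \<sigma>/4 * cos (g x) - \<kappa>/2 * g x) has_real_derivative \<sigma>/4 * (sin (g x) * g' x) - \<kappa>/2 * g' x) (at x)"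
      by (auto intro!: derivative_eq_intros dg)
    then show "((\<lambda>x. - \<sigma>/4 * cos (g x) - \<kappa>/2 * g x) has_vector_derivative \<sigma>/4 * (sin (g x) * g' x) - \<kappa>/2 * g' x) (at x within {0..1})"
      by (simp add: has_real_derivative_iff_has_vector_derivative has_vector_derivative_at_within)
  qed simp
  also have "\<dots> = \<sigma>/4 * (cos (f \<sigma>) - cos s) - \<kappa>/2 * s + \<kappa>/2 * f \<sigma>"
    by (simp add: g_def prof(1) field_simps)
  also have "\<dots> \<le> \<sigma>/4 * (1 - cos s) - \<kappa>/2 * s + \<kappa>/2 * f \<sigma>"
    using \<sigma>0 by simp
  also have "\<dots> = \<sigma> * ((1 - cos s) / 4 - kt / 2 * s + kt / 2 * f \<sigma>)"
    by (simp add: \<kappa> algebra_simps)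
  finally show ?thesis .
qed

text \<open>For small amplitude the layer is that of the quadratic energy,
  \<open>2 * \<kappa> / \<sigma> * exp (- \<sigma> * (1 - x))\<close>, made to vanish at 0 by
  subtracting its value there, whence the error \<open>exp (- \<sigma>)\<close>. The sine is removed
  by \<open>(sin t)\<^sup>2 \<le> t\<^sup>2\<close>.\<close>

lemma small_twist_upper_bound:
  assumes min: "is_minimizer \<epsilon> \<delta> \<kappa> v \<phi>" and \<delta>: "\<delta> > 0" "\<epsilon> > 0" 
    and \<sigma>: "\<sigma> = sqrt \<delta> / \<epsilon>" and \<kappa>: "\<kappa> > 0"
  shows "G \<epsilon> \<delta> \<kappa> v \<phi> \<le> \<kappa>\<^sup>2 / \<sigma> * (- 1/2 + exp (- \<sigma>))"
proof -
  have \<sigma>0: "\<sigma> > 0" using \<delta> by (simp add: \<sigma>)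
  have \<sigma>2: "\<delta>/(8*\<epsilon>\<^sup>2) = \<sigma>\<^sup>2/8" using \<delta> by (simp add: \<sigma> power_divide)
  define E where "E = (\<lambda>x. exp (- \<sigma> * (1 - x)))"
  have dE: "(E has_real_derivative \<sigma> * E x) (at x)" for x
    unfolding E_def by (auto intro!: derivative_eq_intros)
  have cE: "continuous_on A E" for A by (rule DERIV_continuous_on[OF has_field_derivative_at_within[OF dE]])
  define \<psi> where "\<psi> = (\<lambda>x. 2 * \<kappa> / \<sigma> * (E x - E 0))"
  have d\<psi>: "(\<psi> has_real_derivative 2 * \<kappa> * E x) (at x)" for x
    unfolding \<psi>_def using \<sigma>0 by (auto intro!: derivative_eq_intros dE)
  have c\<psi>: "continuous_on A \<psi>" for A unfolding \<psi>_def by (intro continuous_intros cE)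
  have "G \<epsilon> \<delta> \<kappa> v \<phi> \<le> integral {0..1} (\<lambda>x. 1/8 * (2 * \<kappa> * E x)\<^sup>2 + \<sigma>\<^sup>2/8 * (sin (\<psi> x))\<^sup>2 - \<kappa>/2 * (2 * \<kappa> * E x))"
    unfolding \<sigma>2[symmetric]
    by (rule minimizer_upper_bound[OF min d\<psi>]) (auto intro!: continuous_intros cE simp: \<psi>_def)
  also have "\<dots> \<le> integral {0..1} (\<lambda>x. \<kappa>\<^sup>2 / \<sigma> * (E x * (\<sigma> * E x) - \<sigma> * E x))"
  proof (rule integral_le)
    fix x :: real assume x: "x \<in> {0..1}"
    have "E 0 \<le> E x" unfolding E_def using x \<sigma>0 by simp
    then have p: "0 \<le> \<psi> x" using \<kappa> \<sigma>0 by (simp add: \<psi>_def)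
    have "\<psi> x \<le> 2 * \<kappa> / \<sigma> * E x" unfolding \<psi>_def using \<kappa> \<sigma>0 by (intro mult_left_mono) (auto simp: E_def)
    then have "(\<psi> x)\<^sup>2 \<le> (2 * \<kappa> / \<sigma> * E x)\<^sup>2" using p by (intro power_mono)
    moreover have "(sin (\<psi> x))\<^sup>2 \<le> (\<psi> x)\<^sup>2" using abs_sin_x_le_abs_x[of "\<psi> x"] by (simp add: abs_le_square_iff)
    ultimately have "\<sigma>\<^sup>2/8 * (sin (\<psi> x))\<^sup>2 \<le> \<sigma>\<^sup>2/8 * (2 * \<kappa> / \<sigma> * E x)\<^sup>2" by (intro mult_left_mono) auto
    also have "\<dots> = \<kappa>\<^sup>2 / 2 * (E x)\<^sup>2" using \<sigma>0 by (simp add: power2_eq_square)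
    finally have "1/8 * (2 * \<kappa> * E x)\<^sup>2 + \<sigma>\<^sup>2/8 * (sin (\<psi> x))\<^sup>2 - \<kappa>/2 * (2 * \<kappa> * E x) \<le> \<kappa>\<^sup>2 * (E x)\<^sup>2 - \<kappa>\<^sup>2 * E x"
      by (simp add: power2_eq_square)
    also have "\<dots> = \<kappa>\<^sup>2 / \<sigma> * (E x * (\<sigma> * E x) - \<sigma> * E x)" using \<sigma>0 by (simp add: power2_eq_square algebra_simps)
    finally show "1/8 * (2 * \<kappa> * E x)\<^sup>2 + \<sigma>\<^sup>2/8 * (sin (\<psi> x))\<^sup>2 - \<kappa>/2 * (2 * \<kappa> * E x) \<le> \<kappa>\<^sup>2 / \<sigma> * (E x * (\<sigma> * E x) - \<sigma> * E x)" .
  qed (intro integrable_continuous_real continuous_intros cE c\<psi>)+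
  also have "\<dots> = \<kappa>\<^sup>2 / \<sigma> * ((E 1)\<^sup>2 / 2 - E 1) - \<kappa>\<^sup>2 / \<sigma> * ((E 0)\<^sup>2 / 2 - E 0)"
  proof (rule integral_unique, rule fundamental_theorem_of_calculus)
    fix x :: real
    have "((\<lambda>x. \<kappa>\<^sup>2 / \<sigma> * ((E x)\<^sup>2 / 2 - E x)) has_real_derivative \<kappa>\<^sup>2 / \<sigma> * (E x * (\<sigma> * E x) - \<sigma> * E x)) (at x)"
      by (rule DERIV_cmult) (auto intro!: derivative_eq_intros dE)
    then show "((\<lambda>x. \<kappa>\<^sup>2 / \<sigma> * ((E x)\<^sup>2 / 2 - E x)) has_vector_derivative \<kappa>\<^sup>2 / \<sigma> * (E x * (\<sigma> * E x) - \<sigma> * E x)) (at x within {0..1})"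
      by (simp add: has_real_derivative_iff_has_vector_derivative has_vector_derivative_at_within)
  qed simp
  also have "\<dots> = \<kappa>\<^sup>2 / \<sigma> * (- 1/2 - (E 0)\<^sup>2 / 2 + E 0)"
    by (simp add: E_def algebra_simps)
  also have "\<dots> \<le> \<kappa>\<^sup>2 / \<sigma> * (- 1/2 + exp (- \<sigma>))"
    using \<sigma>0 by (intro mult_left_mono) (auto simp: E_def)
  finally show ?thesis .
qed

text \<open>The first bound, from the fourth-order expansion of the cosine, is sharp at 0 and fixes
  leading constants. The second trades sharpness for a pure square and serves for a priori bounds;
  \<open>pi\<^sup>2 \<le> 10\<close> leaves the factor \<open>1/6\<close> in it.\<close>

lemma abs_sin_primitive_quadratic_lower:
  assumes "0 \<le> t" "t \<le> pi"
  shows "t\<^sup>2 / 2 * (1 - t\<^sup>2 / 12) \<le> abs_sin_primitive t" "t\<^sup>2 / 12 \<le> abs_sin_primitive t"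
proof -
  obtain u where u: "cos t = (\<Sum>m<4. cos_coeff m * t ^ m) + cos (u + 1/2 * real 4 * pi) / fact 4 * t ^ 4"
    using Maclaurin_cos_expansion[of t 4] by blast
  have "(\<Sum>m<4. cos_coeff m * t ^ m) = 1 - t\<^sup>2 / 2"
  proof -
    have "{..<4::nat} = {0, 1, 2, 3}" by auto
    then show ?thesis by (simp add: cos_coeff_def)
  qed
  moreover have "cos (u + 1/2 * real 4 * pi) / fact 4 * t ^ 4 \<le> 1 / 24 * t ^ 4"
    by (intro mult_right_mono) (auto simp: fact_numeral)
  ultimately have "cos t \<le> 1 - t\<^sup>2 / 2 + 1 / 24 * t ^ 4" using u by linarith
  then show 1: "t\<^sup>2 / 2 * (1 - t\<^sup>2 / 12) \<le> abs_sin_primitive t"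
    unfolding abs_sin_primitive_eq[OF assms] by (simp add: power2_eq_square power4_eq_xxxx algebra_simps)
  have "t\<^sup>2 \<le> pi\<^sup>2" using assms by (intro power_mono) auto
  also have "pi\<^sup>2 \<le> 3.1416\<^sup>2" using pi_approx by (intro power_mono) auto
  also have "(3.1416::real)\<^sup>2 \<le> 10" by (simp add: power2_eq_square)
  finally have "1/6 \<le> 1 - t\<^sup>2 / 12" by simp
  then have "t\<^sup>2 / 2 * (1/6) \<le> t\<^sup>2 / 2 * (1 - t\<^sup>2 / 12)" by (intro mult_left_mono) auto
  with 1 show "t\<^sup>2 / 12 \<le> abs_sin_primitive t" by simp
qed

section \<open>Asymptotics below the winding threshold\<close>

lemma abs_abs_sin_primitive: "\<bar>abs_sin_primitive t\<bar> = abs_sin_primitive \<bar>t\<bar>"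
  using abs_sin_primitive_mono[of 0 t] abs_sin_primitive_mono[of t 0] abs_sin_primitive_0 abs_sin_primitive_uminus[of t]
  by (cases "t \<ge> 0") auto

lemma sin_cos_Lipschitz: "\<bar>sin x * cos x - sin y * cos y\<bar> \<le> \<bar>x - y\<bar>" for x y :: real
proof -
  have "sin x * cos x - sin y * cos y = (sin (2 * x) - sin (2 * y)) / 2" by (simp add: sin_double)
  then show ?thesis using sin_Lipschitz[of "2 * x" "2 * y"] by simp
qed

text \<open>Divided by \<open>\<sigma>\<close>, the energy \<open>g\<close> is squeezed:
  \<open>p + W / 4 - a \<le> g \<le> fs / 4 + u\<close>, with \<open>p\<close> essentially the
  rescaled well energy, \<open>W\<close> the boundary potential at \<open>\<phi> 1\<close>,
  \<open>fs\<close> its minimum, and \<open>a\<close>, \<open>u\<close> infinitesimal. As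
  \<open>p \<ge> 0\<close> and \<open>W \<ge> fs\<close>, the slack \<open>u + a\<close> controls at
  once the energy, the modulus (through \<open>p\<close>) and the boundary value (through the
  potential gap).\<close>

lemma subcritical_twist_asymptotics:
  fixes \<delta> \<kappa> :: "real \<Rightarrow> real" and v \<phi> :: "real \<Rightarrow> real \<Rightarrow> real" and kt :: real
  assumes kt: "0 < kt" "kt < 1/pi" and \<kappa>: "\<forall>e>0. \<kappa> e = kt * sqrt (\<delta> e) / e"
    and o1: "\<delta> \<in> o[at_right 0](\<lambda>e. e)" and o2: "(\<lambda>e. e\<^sup>2) \<in> o[at_right 0](\<delta>)"
    and fam: "minimizer_family \<delta> \<kappa> v \<phi>"
  shows "(\<lambda>e. SUP x\<in>{0<..<1}. \<bar>1 - v e x\<bar>) \<in> o[at_right 0](\<lambda>e. \<delta> e powr (1/4))"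
    and "asymp_eq (at_right 0) (\<lambda>e. \<phi> e 1) (\<lambda>e. arcsin (2 * kt))"
    and "asymp_eq (at_right 0) (\<lambda>e. G e (\<delta> e) (\<kappa> e) (v e) (\<phi> e))
          (\<lambda>e. sqrt (\<delta> e) / e * ((1 - sqrt (1 - 4 * kt\<^sup>2)) / 4 - kt / 2 * arcsin (2 * kt)))"
    and "\<exists>h. (h \<longlongrightarrow> 0) (at_right 0) \<and>
           eventually (\<lambda>e. \<forall>x\<in>good_set (v e). \<bar>\<phi> e x\<bar> \<le> arcsin (2 * kt) * (1 + h e)) (at_right 0)"
    and "C1_loc_conv (\<lambda>e x. \<phi> e (1 - e * x / sqrt (\<delta> e)))
          (\<lambda>x. 2 * arctan (tan (arcsin (2 * kt) / 2) * exp (- x))) (at_right 0)"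
proof -
  let ?F = "at_right (0::real)"
  let ?S = abs_sin_primitive
  have \<delta>0: "\<forall>e>0. \<delta> e > 0" using fam by (simp add: minimizer_family_def)
  note sl = scaling_limits[OF \<kappa> \<delta>0 o1 o2]
  obtain M \<phi>' where reg: "eventually (\<lambda>e. regular_minimizer e (sqrt (\<delta> e) / e) (\<kappa> e) (sqrt (6 * e) * \<kappa> e) (v e) (\<phi> e) (M e) (\<phi>' e)) ?F"
    by (rule minimizer_family_regular[OF fam sl(3)])
  define \<sigma> where "\<sigma> = (\<lambda>e. sqrt (\<delta> e) / e)"
  define \<theta> where "\<theta> = (\<lambda>e. 1 - 4 * (sqrt (6 * e) * \<kappa> e) - 2 * \<kappa> e * e)"
  define g where "g = (\<lambda>e. G e (\<delta> e) (\<kappa> e) (v e) (\<phi> e) / \<sigma> e)"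
  define p where "p = (\<lambda>e. (1 - \<kappa> e * e) * well_energy e (v e) / \<sigma> e)"
  define c where "c = 2 * kt"
  define s where "s = arcsin c"
  define fs where "fs = \<bar>?S s\<bar> - c * s"
  define f where "f = (\<lambda>x. 2 * arctan (tan (s / 2) * exp (- x)))"
  define u where "u = (\<lambda>e. kt / 2 * f (\<sigma> e))"
  have \<theta>1: "(\<theta> \<longlongrightarrow> 1) ?F" using sl(5) by (simp add: \<theta>_def)
  have c: "0 < c" "c < 2 / pi" using kt by (auto simp: c_def field_simps)
  have "2 / pi < 1" using pi_gt3 by simp
  then have c1: "c < 1" using c by linarith
  have s: "0 < s" "s < pi / 2" "sin s = c"
  proof -
    show "sin s = c" using c c1 by (simp add: s_def)
    have "arcsin 0 < arcsin c" using c c1 by (intro arcsin_less_arcsin) auto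
    then show "0 < s" by (simp add: s_def)
    show "s < pi / 2" unfolding s_def using arcsin_lt_bounded[of c] c c1 by auto
  qed
  have cs: "cos s = sqrt (1 - 4 * kt\<^sup>2)" using c c1 unfolding s_def by (simp add: cos_arcsin c_def power_mult_distrib)
  have Ss: "?S s = 1 - cos s" by (rule abs_sin_primitive_eq) (use s in auto)
  have fs: "fs = 1 - cos s - c * s" using Ss by (simp add: fs_def)
  have fs0: "fs < 0"
    using boundary_potential_strict_min[OF c, of 0] s(1) by (simp add: fs_def s_def abs_sin_primitive_0)
  have prof: "f 0 = s" "(f has_real_derivative - sin (f x)) (at x)" "(f \<longlongrightarrow> 0) at_top" for x
    unfolding f_def using heteroclinic_profile[OF s(1,2)] by blast+
  have u0: "(u \<longlongrightarrow> 0) ?F"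
  proof -
    have "((\<lambda>e. kt / 2 * f (\<sigma> e)) \<longlongrightarrow> kt / 2 * 0) ?F"
      unfolding \<sigma>_def by (intro tendsto_intros filterlim_compose[OF prof(3) sl(2)])
    then show ?thesis by (simp add: u_def)
  qed
  have pos: "eventually (\<lambda>e. e > 0 \<and> \<sigma> e > 0 \<and> \<kappa> e = kt * \<sigma> e \<and> \<delta> e > 0 \<and> is_minimizer e (\<delta> e) (\<kappa> e) (v e) (\<phi> e)) ?F"
    using eventually_at_right_0_pos
    by eventually_elim (use \<delta>0 \<kappa> fam in \<open>auto simp: \<sigma>_def minimizer_family_def\<close>)
  have LB: "eventually (\<lambda>e. \<forall>x\<in>{0..1}. p e + \<theta> e / 4 * \<bar>?S (\<phi> e x)\<bar> - kt / 2 * \<phi> e 1 \<le> g e) ?F"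
    using family_energy_lower[OF fam reg sl(5)] pos
  proof eventually_elim
    case (elim e)
    show ?case
    proof
      fix x :: real assume x: "x \<in> {0..1}"
      have "(1 - \<kappa> e * e) * well_energy e (v e) + \<theta> e * (\<sigma> e / 4 * \<bar>?S (\<phi> e x)\<bar>) - \<kappa> e / 2 * \<phi> e 1
          \<le> G e (\<delta> e) (\<kappa> e) (v e) (\<phi> e)"
        using elim(1) x by (simp only: \<theta>_def \<sigma>_def)
      moreover have "\<sigma> e * p e = (1 - \<kappa> e * e) * well_energy e (v e)" "\<sigma> e * g e = G e (\<delta> e) (\<kappa> e) (v e) (\<phi> e)"
        using elim(2) by (auto simp: p_def g_def)
      moreover have "\<kappa> e / 2 * \<phi> e 1 = \<sigma> e * (kt / 2 * \<phi> e 1)" using elim(2) by simp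
      moreover have "\<sigma> e * (p e + \<theta> e / 4 * \<bar>?S (\<phi> e x)\<bar> - kt / 2 * \<phi> e 1)
          = \<sigma> e * p e + \<theta> e * (\<sigma> e / 4 * \<bar>?S (\<phi> e x)\<bar>) - \<sigma> e * (kt / 2 * \<phi> e 1)"
        by (simp add: algebra_simps)
      ultimately have "\<sigma> e * (p e + \<theta> e / 4 * \<bar>?S (\<phi> e x)\<bar> - kt / 2 * \<phi> e 1) \<le> \<sigma> e * g e"
        by linarith
      then show "p e + \<theta> e / 4 * \<bar>?S (\<phi> e x)\<bar> - kt / 2 * \<phi> e 1 \<le> g e" using elim(2) by simp
    qed
  qed
  have UB: "eventually (\<lambda>e. g e \<le> fs / 4 + u e) ?F"
    using pos
  proof eventually_elim
    case (elim e)
    have "G e (\<delta> e) (\<kappa> e) (v e) (\<phi> e) \<le> \<sigma> e * ((1 - cos s) / 4 - kt / 2 * s + kt / 2 * f (\<sigma> e))"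
      unfolding f_def by (rule subcritical_upper_bound[OF _ _ _ s(1,2)]) (use elim kt in \<open>auto simp: \<sigma>_def\<close>)
    also have "(1 - cos s) / 4 - kt / 2 * s + kt / 2 * f (\<sigma> e) = fs / 4 + u e" by (simp add: fs u_def c_def field_simps)
    finally show ?case using elim by (simp add: g_def pos_divide_le_eq mult.commute)
  qed
  have \<kappa>1: "eventually (\<lambda>e. \<kappa> e * e < 1/2) ?F" using order_tendstoD(2)[OF sl(4), of "1/2"] by simp
  have p0: "eventually (\<lambda>e. 0 \<le> p e) ?F"
    using \<kappa>1 pos by eventually_elim (auto simp: p_def well_energy_nonneg intro!: divide_nonneg_nonneg mult_nonneg_nonneg)
  \<comment> \<open>The factor \<open>\<theta>\<close> multiplies \<open>\<bar>?S\<bar>\<close> in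
    the lower bound, so \<open>\<bar>?S (\<phi> e 1)\<bar>\<close> must be bounded before
    \<open>\<theta>\<close> can be replaced by 1. \<open>k\<close> is the margin below the threshold
    that makes the linear growth of \<open>?S\<close> win for \<open>\<theta>\<close> near
    1.\<close>
  define k where "k = 1 - c * pi / 2"
  have k: "k > 0" using c by (simp add: k_def field_simps)
  define Bd where "Bd = 2 * (1 + c * pi) / k"
  have Bd: "eventually (\<lambda>e. \<bar>?S (\<phi> e 1)\<bar> \<le> Bd) ?F"
  proof -
    have "eventually (\<lambda>e. \<theta> e > 1 - k / 2) ?F" using order_tendstoD(1)[OF \<theta>1, of "1 - k/2"] k by simp
    moreover have "eventually (\<lambda>e. u e < 1/4) ?F" using order_tendstoD(2)[OF u0, of "1/4"] by simp
    ultimately show ?thesis using LB UB p0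
    proof eventually_elim
      case (elim e)
      define y where "y = \<bar>?S (\<phi> e 1)\<bar>"
      have "p e + \<theta> e / 4 * y - kt / 2 * \<phi> e 1 \<le> g e" using elim(3) unfolding y_def by simp
      then have "\<theta> e * y \<le> 1 + c * \<phi> e 1" using elim(2,4,5) fs0 by (simp add: c_def)
      also have "c * \<phi> e 1 \<le> c * \<bar>\<phi> e 1\<bar>" using c by simp
      also have "\<bar>\<phi> e 1\<bar> \<le> (y + 2) * (pi / 2)"
        using abs_sin_primitive_linear_lower[of "\<bar>\<phi> e 1\<bar>"] unfolding y_def abs_abs_sin_primitive by (simp add: field_simps)
      finally have "\<theta> e * y \<le> 1 + c * ((y + 2) * (pi / 2))" using c by simp
      moreover have "(1 - k / 2) * y \<le> \<theta> e * y" using elim(1) by (intro mult_right_mono) (auto simp: y_def)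
      moreover have "1 + c * ((y + 2) * (pi / 2)) = 1 + c * pi + (y - k * y)" by (simp add: k_def algebra_simps)
      moreover have "(1 - k / 2) * y = y - k * y / 2" by (simp add: algebra_simps)
      ultimately have "k * y / 2 \<le> 1 + c * pi" by linarith
      then show ?case using k by (simp add: Bd_def y_def field_simps)
    qed
  qed
  \<comment> \<open>The price of replacing \<open>\<theta>\<close> by 1.\<close>
  define a where "a = (\<lambda>e. \<bar>1 - \<theta> e\<bar> * Bd / 4)"
  have a0: "(a \<longlongrightarrow> 0) ?F"
  proof -
    have "((\<lambda>e. \<bar>1 - \<theta> e\<bar> * Bd / 4) \<longlongrightarrow> \<bar>1 - 1\<bar> * Bd / 4) ?F" by (intro tendsto_intros \<theta>1) simp
    then show ?thesis by (simp add: a_def)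
  qed
  define W where "W = (\<lambda>e. \<bar>?S (\<phi> e 1)\<bar> - c * \<phi> e 1)"
  have Wmin: "fs \<le> W e" for e
    using boundary_potential_strict_min[OF c, of "\<phi> e 1"] by (cases "\<phi> e 1 = s") (auto simp: fs_def W_def s_def)
  have key: "eventually (\<lambda>e. p e + W e / 4 \<le> g e + a e \<and> g e \<le> fs / 4 + u e \<and> 0 \<le> p e) ?F"
    using LB UB p0 Bd
  proof eventually_elim
    case (elim e)
    have "p e + \<theta> e / 4 * \<bar>?S (\<phi> e 1)\<bar> - kt / 2 * \<phi> e 1 \<le> g e" using elim(1) by simp
    moreover have "(1 - \<theta> e) * \<bar>?S (\<phi> e 1)\<bar> \<le> \<bar>1 - \<theta> e\<bar> * Bd" using elim(4) by (intro mult_mono) auto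
    ultimately have "p e + W e / 4 \<le> g e + a e" by (simp add: W_def a_def c_def field_simps)
    then show ?case using elim by simp
  qed
  have gl: "(g \<longlongrightarrow> fs / 4) ?F"
  proof (rule tendsto_sandwich)
    show "eventually (\<lambda>e. fs / 4 - a e \<le> g e) ?F" using key
    proof eventually_elim
      case (elim e)
      then show ?case using Wmin[of e] by linarith
    qed
    show "eventually (\<lambda>e. g e \<le> fs / 4 + u e) ?F" by (rule UB)
    show "((\<lambda>e. fs / 4 - a e) \<longlongrightarrow> fs / 4) ?F" using tendsto_diff[OF tendsto_const a0, of "fs/4"] by simp
    show "((\<lambda>e. fs / 4 + u e) \<longlongrightarrow> fs / 4) ?F" using tendsto_add[OF tendsto_const u0, of "fs/4"] by simp
  qed
  have ua: "((\<lambda>e. u e + a e) \<longlongrightarrow> 0) ?F" using tendsto_add[OF u0 a0] by simp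
  have pl: "eventually (\<lambda>e. p e \<le> u e + a e) ?F" 
    using key
  proof eventually_elim
    case (elim e)
    then show ?case using Wmin[of e] by linarith
  qed
  have \<phi>1: "((\<lambda>e. \<phi> e 1) \<longlongrightarrow> s) ?F"
  proof (rule tendstoI)
    fix \<mu> :: real assume "\<mu> > 0"
    then obtain d where d: "d > 0" "\<And>t. \<mu> \<le> \<bar>t - s\<bar> \<Longrightarrow> fs + d \<le> \<bar>?S t\<bar> - c * t"
      using boundary_potential_gap[OF c] unfolding fs_def s_def by metis
    have "eventually (\<lambda>e. u e + a e < d / 4) ?F" using order_tendstoD(2)[OF ua, of "d/4"] d by simp
    then show "eventually (\<lambda>e. dist (\<phi> e 1) s < \<mu>) ?F" using key
    proof eventually_elim
      case (elim e)
      then have "W e < fs + d" by linarith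
      then show ?case using d(2)[of "\<phi> e 1"] by (auto simp: W_def dist_real_def not_le[symmetric])
    qed
  qed
  show "asymp_eq ?F (\<lambda>e. \<phi> e 1) (\<lambda>e. arcsin (2 * kt))"
  proof (rule asymp_eqI)
    show "((\<lambda>e. \<phi> e 1 / arcsin (2 * kt)) \<longlongrightarrow> 1) ?F"
      using tendsto_divide[OF \<phi>1 tendsto_const[of s]] s(1) by (simp add: s_def c_def)
  qed (use s(1) in \<open>simp add: s_def c_def\<close>)
  show "asymp_eq ?F (\<lambda>e. G e (\<delta> e) (\<kappa> e) (v e) (\<phi> e))
          (\<lambda>e. sqrt (\<delta> e) / e * ((1 - sqrt (1 - 4 * kt\<^sup>2)) / 4 - kt / 2 * arcsin (2 * kt)))"
  proof (rule asymp_eqI)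
    have eq: "(1 - sqrt (1 - 4 * kt\<^sup>2)) / 4 - kt / 2 * arcsin (2 * kt) = fs / 4"
      unfolding fs cs[symmetric] by (simp add: s_def c_def field_simps)
    have "((\<lambda>e. g e / (fs / 4)) \<longlongrightarrow> 1) ?F"
      using tendsto_divide[OF gl tendsto_const[of "fs / 4"]] fs0 by simp
    then show "((\<lambda>e. G e (\<delta> e) (\<kappa> e) (v e) (\<phi> e) / (sqrt (\<delta> e) / e * ((1 - sqrt (1 - 4 * kt\<^sup>2)) / 4 - kt / 2 * arcsin (2 * kt)))) \<longlongrightarrow> 1) ?F"
      unfolding eq g_def \<sigma>_def by (simp only: divide_divide_eq_left)
    show "eventually (\<lambda>e. sqrt (\<delta> e) / e * ((1 - sqrt (1 - 4 * kt\<^sup>2)) / 4 - kt / 2 * arcsin (2 * kt)) \<noteq> 0) ?F"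
      unfolding eq using pos by eventually_elim (use fs0 in \<open>auto simp: \<sigma>_def\<close>)
  qed
  have good: "eventually (\<lambda>e. good_set (v e) = {0<..<1}) ?F"
    using reg by eventually_elim (simp add: regular_minimizer_def)
  show "\<exists>h. (h \<longlongrightarrow> 0) ?F \<and> eventually (\<lambda>e. \<forall>x\<in>good_set (v e). \<bar>\<phi> e x\<bar> \<le> arcsin (2 * kt) * (1 + h e)) ?F"
  proof (rule uniform_bound_factor)
    show "0 < arcsin (2 * kt)" using s(1) by (simp add: s_def c_def)
    fix \<mu> :: real assume \<mu>: "\<mu> > 0"
    \<comment> \<open>Solving the lower bound at a general \<open>x\<close> for
      \<open>\<bar>?S (\<phi> e x)\<bar>\<close> gives this quotient. Its limit is the cost
      \<open>?S s\<close> of the boundary value itself, and \<open>?S\<close> increases strictly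
      just past \<open>s\<close>.\<close>
    have "((\<lambda>e. (4 * g e + c * \<phi> e 1) / \<theta> e) \<longlongrightarrow> (4 * (fs / 4) + c * s) / 1) ?F"
      by (intro tendsto_intros gl \<phi>1 \<theta>1) simp
    moreover have "(4 * (fs / 4) + c * s) / 1 = ?S s"
    proof -
      have "(4 * (fs / 4) + c * s) / 1 = fs + c * s" by simp
      also have "\<dots> = ?S s" by (simp add: Ss fs)
      finally show ?thesis .
    qed
    ultimately have lim: "((\<lambda>e. (4 * g e + c * \<phi> e 1) / \<theta> e) \<longlongrightarrow> ?S s) ?F" by (simp only:)
    have "?S s < ?S (s + \<mu>)"
    proof -
      have "cos (min (s + \<mu>) pi) < cos s" by (rule cos_monotone_0_pi) (use s \<mu> in auto)
      moreover have "?S (min (s + \<mu>) pi) = 1 - cos (min (s + \<mu>) pi)"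
        by (rule abs_sin_primitive_eq) (use s \<mu> in auto)
      ultimately have "?S s < ?S (min (s + \<mu>) pi)" using Ss by linarith
      also have "\<dots> \<le> ?S (s + \<mu>)" by (intro abs_sin_primitive_mono) auto
      finally show ?thesis .
    qed
    from order_tendstoD(2)[OF lim this]
    have "eventually (\<lambda>e. (4 * g e + c * \<phi> e 1) / \<theta> e < ?S (s + \<mu>)) ?F" .
    moreover have "eventually (\<lambda>e. \<theta> e > 0) ?F" using order_tendstoD(1)[OF \<theta>1, of 0] by simp
    ultimately show "eventually (\<lambda>e. \<forall>x\<in>good_set (v e). \<bar>\<phi> e x\<bar> \<le> arcsin (2 * kt) + \<mu>) ?F"
      using LB p0 good
    proof eventually_elim
      case (elim e)
      show ?case
      proof
        fix x assume "x \<in> good_set (v e)"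
        then have "p e + \<theta> e / 4 * \<bar>?S (\<phi> e x)\<bar> - kt / 2 * \<phi> e 1 \<le> g e" using elim(3,5) by auto
        then have "\<bar>?S (\<phi> e x)\<bar> * \<theta> e \<le> 4 * g e + c * \<phi> e 1" using elim(4) by (simp add: c_def field_simps)
        then have "\<bar>?S (\<phi> e x)\<bar> \<le> (4 * g e + c * \<phi> e 1) / \<theta> e" using elim(2) by (simp add: field_simps)
        then have "?S \<bar>\<phi> e x\<bar> < ?S (s + \<mu>)" using elim(1) by (simp add: abs_abs_sin_primitive)
        then have "\<bar>\<phi> e x\<bar> < s + \<mu>" using abs_sin_primitive_mono[of "s + \<mu>" "\<bar>\<phi> e x\<bar>"] by linarith
        then show "\<bar>\<phi> e x\<bar> \<le> arcsin (2 * kt) + \<mu>" by (simp add: s_def c_def)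
      qed
    qed
  qed
  show "(\<lambda>e. SUP x\<in>{0<..<1}. \<bar>1 - v e x\<bar>) \<in> o[at_right 0](\<lambda>e. \<delta> e powr (1/4))"
  proof (rule landau_o.smallI)
    fix r :: real assume r: "r > 0"
    \<comment> \<open>24 is 12 times 2: \<open>(v - 1)\<^sup>2\<close> is at most
      \<open>12 * e\<close> times the well energy, the latter at most
      \<open>2 * p e * \<sigma> e\<close>, and
      \<open>e * \<sigma> e = sqrt (\<delta> e)\<close>.\<close>
    have "eventually (\<lambda>e. u e + a e < r\<^sup>2 / 24) ?F" using order_tendstoD(2)[OF ua, of "r\<^sup>2/24"] r by simp
    then show "eventually (\<lambda>e. norm (SUP x\<in>{0<..<1}. \<bar>1 - v e x\<bar>) \<le> r * norm (\<delta> e powr (1/4))) ?F"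
      using pl pos \<kappa>1 reg
    proof eventually_elim
      case (elim e)
      have e: "e > 0" "\<sigma> e > 0" "\<delta> e > 0" using elim(3) by auto
      have E: "well_energy e (v e) \<le> 2 * p e * \<sigma> e"
      proof -
        have "well_energy e (v e) \<le> 2 * ((1 - \<kappa> e * e) * well_energy e (v e))"
        proof -
          have "1/2 * well_energy e (v e) \<le> (1 - \<kappa> e * e) * well_energy e (v e)"
            using elim(4) well_energy_nonneg by (intro mult_right_mono) auto
          then show ?thesis by linarith
        qed
        also have "(1 - \<kappa> e * e) * well_energy e (v e) = p e * \<sigma> e" using e by (simp add: p_def)
        finally show ?thesis by simp
      qed
      have q: "(\<delta> e powr (1/4))\<^sup>2 = sqrt (\<delta> e)"
      proof -
        have "(\<delta> e powr (1/4))\<^sup>2 = \<delta> e powr (1/4 + 1/4)" by (simp only: power2_eq_square powr_add)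
        also have "\<dots> = sqrt (\<delta> e)" using e by (simp add: powr_half_sqrt)
        finally show ?thesis .
      qed
      have "\<bar>1 - v e x\<bar> \<le> r * \<delta> e powr (1/4)" if x: "x \<in> {0<..<1}" for x
      proof -
        have "(v e x - 1)\<^sup>2 \<le> 12 * e * well_energy e (v e)" using elim(5) x by (simp add: regular_minimizer_def)
        also have "\<dots> \<le> 12 * e * (2 * p e * \<sigma> e)" using E e by (intro mult_left_mono) auto
        also have "\<dots> = 24 * p e * sqrt (\<delta> e)" using e by (simp add: \<sigma>_def)
        also have "\<dots> \<le> r\<^sup>2 * sqrt (\<delta> e)" using elim(1,2) e by (intro mult_right_mono) auto
        also have "\<dots> = (r * \<delta> e powr (1/4))\<^sup>2" by (simp add: power_mult_distrib q)
        finally have "\<bar>v e x - 1\<bar> \<le> r * \<delta> e powr (1/4)" using r by (simp add: power2_le_iff_abs_le)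
        then show ?thesis by (simp add: abs_minus_commute)
      qed
      then show ?case using abs_SUP_le[of "\<lambda>x. 1 - v e x" "r * \<delta> e powr (1/4)"] by simp
    qed
  qed
  have "C1_loc_conv (\<lambda>e x. 1 * \<phi> e (1 - x / (sqrt (\<delta> e) / e))) f ?F"
  proof (rule C1_loc_conv_right_end[OF reg sl(3) sl(2), where k = "\<lambda>_. 1" and B = 1])
    show "(f has_real_derivative - sin (f x)) (at x within {0..})" for x
      using prof(2) by (rule has_field_derivative_at_within)
    show "((\<lambda>x. - sin (f x)) has_real_derivative sin (f x) * cos (f x)) (at x within {0..})" for x
      by (rule has_field_derivative_at_within) (auto intro!: derivative_eq_intros prof(2))
    show "eventually (\<lambda>e. \<forall>x\<in>{0..1}. \<bar>1 * (sin (\<phi> e x) * cos (\<phi> e x))\<bar> \<le> 1) ?F"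
      by (intro always_eventually allI ballI) (simp add: abs_mult mult_le_one)
    show "((\<lambda>e. 1 * \<phi> e 1) \<longlongrightarrow> f 0) ?F" using \<phi>1 prof(1) by simp
    \<comment> \<open>The twist relation \<open>2 * \<kappa> / \<sigma> = c = sin s\<close> makes
      the initial slope equal to that of the profile already before the limit.\<close>
    have "eventually (\<lambda>e. - sin (f 0) = - (2 * 1 * \<kappa> e / (sqrt (\<delta> e) / e))) ?F"
      using pos by eventually_elim (auto simp: prof(1) s(3) c_def \<sigma>_def)
    then show "((\<lambda>e. - (2 * 1 * \<kappa> e / (sqrt (\<delta> e) / e))) \<longlongrightarrow> - sin (f 0)) ?F"
      by (rule Lim_transform_eventually[OF tendsto_const])
    show "\<forall>\<^sub>F e in ?F. \<forall>x\<in>{0..sqrt (\<delta> e) / e}.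
       \<bar>1 * (sin (\<phi> e (1 - x / (sqrt (\<delta> e) / e))) * cos (\<phi> e (1 - x / (sqrt (\<delta> e) / e)))) - sin (f x) * cos (f x)\<bar>
       \<le> \<bar>1 * \<phi> e (1 - x / (sqrt (\<delta> e) / e)) - f x\<bar> + \<rho>" if "\<rho> > 0" for \<rho>
      unfolding mult_1 by (intro always_eventually allI ballI order_trans[OF sin_cos_Lipschitz]) (use that in simp)
  qed
  then show "C1_loc_conv (\<lambda>e x. \<phi> e (1 - e * x / sqrt (\<delta> e)))
          (\<lambda>x. 2 * arctan (tan (arcsin (2 * kt) / 2) * exp (- x))) ?F"
    by (simp add: f_def s_def c_def mult.commute)
qed

section \<open>Bounded twist with fixed delta\<close>

lemma sin_minus_self_le: "\<bar>sin x - x\<bar> \<le> x\<^sup>2 / 2" for x :: real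
proof -
  have "(\<Sum>m<2. sin_coeff m * x ^ m) = x"
  proof -
    have "{..<2::nat} = {0, 1}" by auto
    then show ?thesis by (simp add: sin_coeff_def)
  qed
  then show ?thesis using Maclaurin_sin_bound[of x 2] by (simp add: fact_numeral)
qed

text \<open>\<open>\<kappa>\<close> may itself tend to 0, so everything is measured in its own
  units: energy in \<open>\<kappa>\<^sup>2 / \<sigma>\<close>, phase in
  \<open>b = \<kappa> / \<sigma>\<close>. With \<open>r = \<phi> 1 / (2 * b)\<close> the reduced
  energy is to leading order \<open>r\<^sup>2 / 2 - r\<close>, that is
  \<open>(r - 1)\<^sup>2 / 2 - 1/2\<close>, and the squeeze forces \<open>r\<close> to 1.\<close>

lemma small_twist_asymptotics:
  fixes \<kappa> :: "real \<Rightarrow> real" and v \<phi> :: "real \<Rightarrow> real \<Rightarrow> real" and d :: real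
  assumes d: "d > 0" and K: "\<forall>e>0. \<kappa> e \<le> K" and fam: "minimizer_family (\<lambda>_. d) \<kappa> v \<phi>"
  shows "(\<lambda>e. SUP x\<in>{0<..<1}. \<bar>v e x - 1\<bar>) \<in> o[at_right 0](\<lambda>e. e)"
    and "asymp_eq (at_right 0) (\<lambda>e. \<phi> e 1) (\<lambda>e. 2 * \<kappa> e * e / sqrt d)"
    and "eventually (\<lambda>e. \<forall>x\<in>good_set (v e). \<bar>\<phi> e x\<bar> \<le> 14 * \<kappa> e * e / sqrt d) (at_right 0)"
    and "asymp_eq (at_right 0) (\<lambda>e. G e d (\<kappa> e) (v e) (\<phi> e)) (\<lambda>e. - ((\<kappa> e)\<^sup>2 * e / (2 * sqrt d)))"
    and "C1_loc_conv (\<lambda>e x. sqrt d / (2 * \<kappa> e * e) * \<phi> e (1 - e * x / sqrt d)) (\<lambda>x. exp (- x)) (at_right 0)"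
proof -
  let ?F = "at_right (0::real)"
  let ?S = abs_sin_primitive
  have \<kappa>0: "\<kappa> e > 0" if "e > 0" for e using fam that by (simp add: minimizer_family_def)
  have "\<kappa> 1 \<le> K" "0 < \<kappa> 1" using K \<kappa>0[of 1] by simp_all
  then have K0: "K > 0" by linarith
  have id: "((\<lambda>e::real. e) \<longlongrightarrow> 0) ?F" by (rule tendsto_ident_at)
  have squeeze: "(h \<longlongrightarrow> 0) ?F" if "\<And>e. e > 0 \<Longrightarrow> 0 \<le> h e \<and> h e \<le> h' e" "(h' \<longlongrightarrow> 0) ?F" for h h' :: "real \<Rightarrow> real"
    by (rule tendsto_sandwich[OF _ _ tendsto_const that(2)])
       (use eventually_at_right_0_pos in eventually_elim, use that(1) in auto)+
  have \<eta>0: "((\<lambda>e. sqrt (6 * e) * \<kappa> e) \<longlongrightarrow> 0) ?F"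
  proof (rule squeeze)
    show "((\<lambda>e. sqrt (6 * e) * K) \<longlongrightarrow> 0) ?F"
      using tendsto_mult[OF tendsto_real_sqrt[OF tendsto_mult[OF tendsto_const id]] tendsto_const, of 6 K] by simp
    show "0 \<le> sqrt (6 * e) * \<kappa> e \<and> sqrt (6 * e) * \<kappa> e \<le> sqrt (6 * e) * K" if "e > 0" for e
      using \<kappa>0[OF that] K that by (auto intro!: mult_left_mono)
  qed
  have \<kappa>e: "((\<lambda>e. \<kappa> e * e) \<longlongrightarrow> 0) ?F"
  proof (rule squeeze)
    show "((\<lambda>e. K * e) \<longlongrightarrow> 0) ?F" using tendsto_mult[OF tendsto_const id, of K] by simp
    show "0 \<le> \<kappa> e * e \<and> \<kappa> e * e \<le> K * e" if "e > 0" for e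
      using \<kappa>0[OF that] K that by (auto intro!: mult_right_mono)
  qed
  have th: "((\<lambda>e. 1 - 4 * (sqrt (6 * e) * \<kappa> e) - 2 * \<kappa> e * e) \<longlongrightarrow> 1) ?F"
  proof -
    have "((\<lambda>e. 1 - 4 * (sqrt (6 * e) * \<kappa> e) - 2 * (\<kappa> e * e)) \<longlongrightarrow> 1 - 4 * 0 - 2 * 0) ?F"
      by (intro tendsto_diff tendsto_mult tendsto_const \<eta>0 \<kappa>e)
    then show ?thesis by (simp add: mult.assoc)
  qed
  have \<sigma>t: "filterlim (\<lambda>e. sqrt d / e) at_top ?F" using d by real_asymp
  obtain M \<phi>' where reg: "eventually (\<lambda>e. regular_minimizer e (sqrt d / e) (\<kappa> e) (sqrt (6 * e) * \<kappa> e) (v e) (\<phi> e) (M e) (\<phi>' e)) ?F"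
    by (rule minimizer_family_regular[OF fam \<eta>0])
  define \<sigma> where "\<sigma> = (\<lambda>e. sqrt d / e)"
  define \<theta> where "\<theta> = (\<lambda>e. 1 - 4 * (sqrt (6 * e) * \<kappa> e) - 2 * \<kappa> e * e)"
  define b where "b = (\<lambda>e. \<kappa> e / \<sigma> e)"
  define g where "g = (\<lambda>e. G e d (\<kappa> e) (v e) (\<phi> e) * \<sigma> e / (\<kappa> e)\<^sup>2)"
  define p where "p = (\<lambda>e. (1 - \<kappa> e * e) * well_energy e (v e) * \<sigma> e / (\<kappa> e)\<^sup>2)"
  define r where "r = (\<lambda>e. \<phi> e 1 / (2 * b e))"
  define u where "u = (\<lambda>e. exp (- \<sigma> e))"
  have \<theta>1: "(\<theta> \<longlongrightarrow> 1) ?F" using th by (simp add: \<theta>_def)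
  have u0: "(u \<longlongrightarrow> 0) ?F" unfolding u_def \<sigma>_def using d by real_asymp
  have pos: "eventually (\<lambda>e. e > 0 \<and> \<sigma> e > 0 \<and> \<kappa> e > 0 \<and> b e > 0 \<and> is_minimizer e d (\<kappa> e) (v e) (\<phi> e)) ?F"
    using eventually_at_right_0_pos
    by eventually_elim (use d \<kappa>0 fam in \<open>auto simp: \<sigma>_def b_def minimizer_family_def\<close>)
  have b0: "(b \<longlongrightarrow> 0) ?F"
  proof -
    have "((\<lambda>e. \<kappa> e * e / sqrt d) \<longlongrightarrow> 0 / sqrt d) ?F" using d by (intro tendsto_divide \<kappa>e tendsto_const) auto
    then show ?thesis by (simp add: b_def \<sigma>_def)
  qed
  have LB: "eventually (\<lambda>e. \<forall>x\<in>{0..1}. p e + \<theta> e / (4 * (b e)\<^sup>2) * \<bar>?S (\<phi> e x)\<bar> - r e \<le> g e) ?F"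
    using family_energy_lower[OF fam reg th] pos
  proof eventually_elim
    case (elim e)
    define \<mu> where "\<mu> = \<sigma> e / (\<kappa> e)\<^sup>2"
    have \<mu>: "\<mu> > 0" using elim(2) by (simp add: \<mu>_def)
    show ?case
    proof
      fix x :: real assume x: "x \<in> {0..1}"
      have "(1 - \<kappa> e * e) * well_energy e (v e) + \<theta> e * (\<sigma> e / 4 * \<bar>?S (\<phi> e x)\<bar>) - \<kappa> e / 2 * \<phi> e 1
          \<le> G e d (\<kappa> e) (v e) (\<phi> e)"
        using elim(1) x by (simp only: \<theta>_def \<sigma>_def)
      then have "\<mu> * ((1 - \<kappa> e * e) * well_energy e (v e) + \<theta> e * (\<sigma> e / 4 * \<bar>?S (\<phi> e x)\<bar>) - \<kappa> e / 2 * \<phi> e 1)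
          \<le> \<mu> * G e d (\<kappa> e) (v e) (\<phi> e)" using \<mu> by (intro mult_left_mono) auto
      moreover have "\<mu> * ((1 - \<kappa> e * e) * well_energy e (v e)) = p e" "\<mu> * G e d (\<kappa> e) (v e) (\<phi> e) = g e"
        by (simp_all add: \<mu>_def p_def g_def)
      moreover have "\<mu> * (\<kappa> e / 2 * \<phi> e 1) = r e" "\<mu> * (\<theta> e * (\<sigma> e / 4 * \<bar>?S (\<phi> e x)\<bar>)) = \<theta> e / (4 * (b e)\<^sup>2) * \<bar>?S (\<phi> e x)\<bar>"
        using elim(2) by (simp_all add: \<mu>_def r_def b_def power2_eq_square field_simps)
      ultimately show "p e + \<theta> e / (4 * (b e)\<^sup>2) * \<bar>?S (\<phi> e x)\<bar> - r e \<le> g e"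
        by (simp only: right_diff_distrib distrib_left)
    qed
  qed
  have UB: "eventually (\<lambda>e. g e \<le> - 1/2 + u e) ?F"
    using pos
  proof eventually_elim
    case (elim e)
    have "G e d (\<kappa> e) (v e) (\<phi> e) \<le> (\<kappa> e)\<^sup>2 / \<sigma> e * (- 1/2 + exp (- \<sigma> e))"
      by (rule small_twist_upper_bound) (use elim d in \<open>auto simp: \<sigma>_def\<close>)
    then have "G e d (\<kappa> e) (v e) (\<phi> e) * (\<sigma> e / (\<kappa> e)\<^sup>2) \<le> (\<kappa> e)\<^sup>2 / \<sigma> e * (- 1/2 + exp (- \<sigma> e)) * (\<sigma> e / (\<kappa> e)\<^sup>2)"
      using elim by (intro mult_right_mono) auto
    also have "\<dots> = - 1/2 + u e" using elim by (simp add: u_def)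
    finally show ?case by (simp add: g_def)
  qed
  have \<kappa>1: "eventually (\<lambda>e. \<kappa> e * e < 1/2) ?F" using order_tendstoD(2)[OF \<kappa>e, of "1/2"] by simp
  have p0: "eventually (\<lambda>e. 0 \<le> p e) ?F"
    using \<kappa>1 pos by eventually_elim (auto simp: p_def well_energy_nonneg intro!: divide_nonneg_nonneg mult_nonneg_nonneg)
  have \<theta>h: "eventually (\<lambda>e. 1/2 < \<theta> e) ?F" using order_tendstoD(1)[OF \<theta>1, of "1/2"] by simp
  have uh: "eventually (\<lambda>e. u e < 1/2) ?F" using order_tendstoD(2)[OF u0, of "1/2"] by simp
  have bh: "eventually (\<lambda>e. b e < 1/16) ?F" using order_tendstoD(2)[OF b0, of "1/16"] by simp
  have bound: "eventually (\<lambda>e. 0 < \<phi> e 1 \<and> \<phi> e 1 \<le> 48 * b e \<and> \<phi> e 1 \<le> pi \<and> 0 < r e \<and> r e \<le> 24) ?F"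
    using LB UB p0 \<theta>h uh bh pos
  proof eventually_elim
    case (elim e)
    define t where "t = \<phi> e 1"
    have b: "b e > 0" using elim by simp
    have L: "p e + \<theta> e / (4 * (b e)\<^sup>2) * \<bar>?S t\<bar> - r e \<le> g e" using elim(1) by (simp add: t_def)
    have nn: "0 \<le> \<theta> e / (4 * (b e)\<^sup>2) * \<bar>?S t\<bar>" using elim(4) by (intro mult_nonneg_nonneg) auto
    have r: "r e > 0" using L nn elim(2,3,5) by linarith
    then have t: "t > 0" using b by (simp add: r_def t_def zero_less_divide_iff)
    have "\<theta> e / (4 * (b e)\<^sup>2) * \<bar>?S t\<bar> \<le> t / (2 * b e)" using L elim(2,3,5) by (simp add: r_def t_def)
    then have "\<theta> e * \<bar>?S t\<bar> \<le> 2 * b e * t" using b by (simp add: field_simps power2_eq_square)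
    moreover have "1/2 * \<bar>?S t\<bar> \<le> \<theta> e * \<bar>?S t\<bar>" using elim(4) by (intro mult_right_mono) auto
    moreover have "\<bar>?S t\<bar> = ?S t" using t by (simp add: abs_abs_sin_primitive)
    ultimately have S: "?S t \<le> 4 * b e * t" by simp
    \<comment> \<open>The quadratic lower bound is available only up to \<open>pi\<close>; a larger
      \<open>t\<close> would give \<open>2 / pi \<le> 8 * b\<close>, impossible for small
      \<open>b\<close>.\<close>
    have tpi: "t \<le> pi"
    proof (rule ccontr)
      assume "\<not> t \<le> pi"
      then have "2 \<le> ?S t" using abs_sin_primitive_mono[of pi t] abs_sin_primitive_eq[of pi] by simp
      moreover have "2 / pi * t - 2 \<le> ?S t" using t by (intro abs_sin_primitive_linear_lower) auto
      ultimately have "2 / pi * t \<le> 2 * ?S t" by linarith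
      also have "\<dots> \<le> (8 * b e) * t" using S by linarith
      finally have "2 / pi \<le> 8 * b e" using t by (rule mult_right_le_imp_le)
      moreover have "8 * b e < 1/2" using elim(6) by simp
      moreover have "1/2 \<le> 2 / pi" using pi_less_4 by (simp add: field_simps)
      ultimately show False by linarith
    qed
    have "t\<^sup>2 / 12 \<le> 4 * b e * t" using abs_sin_primitive_quadratic_lower(2)[of t] t tpi S by simp
    then have "t * t \<le> t * (48 * b e)" by (simp add: power2_eq_square algebra_simps)
    then have "t \<le> 48 * b e" using t by simp
    then have "r e \<le> 24" using b by (simp add: r_def t_def field_simps)
    then show ?case using t tpi r \<open>t \<le> 48 * b e\<close> by (simp add: t_def)
  qed
  \<comment> \<open>Both corrections to the quadratic law in one factor: \<open>\<theta>\<close>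
    from the modulus, the bracket from the cosine expansion.\<close>
  define \<Theta> where "\<Theta> = (\<lambda>e. \<theta> e * (1 - (\<phi> e 1)\<^sup>2 / 12))"
  have \<phi>0: "((\<lambda>e. \<phi> e 1) \<longlongrightarrow> 0) ?F"
  proof (rule tendsto_sandwich[OF _ _ tendsto_const])
    show "eventually (\<lambda>e. 0 \<le> \<phi> e 1) ?F" "eventually (\<lambda>e. \<phi> e 1 \<le> 48 * b e) ?F"
      using bound by (auto elim!: eventually_mono)
    show "((\<lambda>e. 48 * b e) \<longlongrightarrow> 0) ?F" using tendsto_mult[OF tendsto_const b0, of 48] by simp
  qed
  have \<Theta>1: "(\<Theta> \<longlongrightarrow> 1) ?F"
  proof -
    have "(\<Theta> \<longlongrightarrow> 1 * (1 - 0\<^sup>2 / 12)) ?F" unfolding \<Theta>_def by (intro tendsto_intros \<theta>1 \<phi>0) auto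
    then show ?thesis by simp
  qed
  \<comment> \<open>288 is half of \<open>24\<^sup>2\<close>, from the a priori bound
    \<open>r e \<le> 24\<close>.\<close>
  define w where "w = (\<lambda>e. u e + 288 * \<bar>1 - \<Theta> e\<bar>)"
  have w0: "(w \<longlongrightarrow> 0) ?F"
  proof -
    have "(w \<longlongrightarrow> 0 + 288 * \<bar>1 - 1\<bar>) ?F" unfolding w_def by (intro tendsto_intros u0 \<Theta>1)
    then show ?thesis by simp
  qed
  have key: "eventually (\<lambda>e. p e + (r e - 1)\<^sup>2 / 2 \<le> w e \<and> - 1/2 - w e \<le> g e \<and> 0 \<le> p e) ?F"
    using LB UB p0 bound \<theta>h pos
  proof eventually_elim
    case (elim e)
    define t where "t = \<phi> e 1"
    have b: "b e > 0" using elim by simp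
    have t: "0 < t" "t \<le> pi" using elim(4) by (auto simp: t_def)
    have L: "p e + \<theta> e / (4 * (b e)\<^sup>2) * ?S t - r e \<le> g e" using bspec[OF elim(1), of 1] t by (simp add: t_def abs_abs_sin_primitive)
    have "\<theta> e / (4 * (b e)\<^sup>2) * (t\<^sup>2 / 2 * (1 - t\<^sup>2 / 12)) \<le> \<theta> e / (4 * (b e)\<^sup>2) * ?S t"
      using elim(5) t by (intro mult_left_mono abs_sin_primitive_quadratic_lower) auto
    moreover have "\<theta> e / (4 * (b e)\<^sup>2) * (t\<^sup>2 / 2 * (1 - t\<^sup>2 / 12)) = \<Theta> e * (r e)\<^sup>2 / 2"
      unfolding \<Theta>_def r_def t_def[symmetric] using b by (simp add: power2_eq_square)
    ultimately have 1: "p e + \<Theta> e * (r e)\<^sup>2 / 2 - r e \<le> g e" using L by linarith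
    have "(1 - \<Theta> e) * (r e)\<^sup>2 \<le> \<bar>1 - \<Theta> e\<bar> * 24\<^sup>2" using elim(4) by (intro mult_mono power_mono) auto
    then have 2: "(r e)\<^sup>2 / 2 - \<Theta> e * (r e)\<^sup>2 / 2 \<le> 288 * \<bar>1 - \<Theta> e\<bar>" by (simp add: algebra_simps)
    have 3: "(r e - 1)\<^sup>2 / 2 = (r e)\<^sup>2 / 2 - r e + 1/2" by (simp add: power2_eq_square field_simps)
    have "0 \<le> (r e - 1)\<^sup>2 / 2" "0 \<le> u e" by (auto simp: u_def)
    then show ?case using 1 2 3 elim(2,3) unfolding w_def by linarith
  qed
  have r1: "(r \<longlongrightarrow> 1) ?F"
  proof -
    have "((\<lambda>e. (r e - 1)\<^sup>2) \<longlongrightarrow> 0) ?F"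
    proof (rule tendsto_sandwich[OF _ _ tendsto_const])
      show "eventually (\<lambda>e. (r e - 1)\<^sup>2 \<le> 2 * w e) ?F" using key by eventually_elim linarith
      show "((\<lambda>e. 2 * w e) \<longlongrightarrow> 0) ?F" using tendsto_mult[OF tendsto_const w0, of 2] by simp
    qed auto
    from tendsto_real_sqrt[OF this] have "((\<lambda>e. \<bar>r e - 1\<bar>) \<longlongrightarrow> 0) ?F" by simp
    then have "((\<lambda>e. r e - 1) \<longlongrightarrow> 0) ?F" by (rule tendsto_rabs_zero_cancel)
    from tendsto_add[OF this tendsto_const[of 1]] show ?thesis by simp
  qed
  have g1: "(g \<longlongrightarrow> - 1/2) ?F"
  proof (rule tendsto_sandwich)
    show "eventually (\<lambda>e. - 1/2 - w e \<le> g e) ?F" using key by eventually_elim auto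
    show "eventually (\<lambda>e. g e \<le> - 1/2 + u e) ?F" by (rule UB)
    show "((\<lambda>e. - 1/2 - w e) \<longlongrightarrow> - 1/2) ?F" using tendsto_diff[OF tendsto_const w0, of "- 1/2"] by simp
    show "((\<lambda>e. - 1/2 + u e) \<longlongrightarrow> - 1/2) ?F" using tendsto_add[OF tendsto_const u0, of "- 1/2"] by simp
  qed
  have pl: "eventually (\<lambda>e. p e \<le> w e) ?F" using key
  proof eventually_elim
    case (elim e)
    then show ?case using zero_le_power2[of "r e - 1"] by linarith
  qed
  have b_eq: "b e = \<kappa> e * e / sqrt d" for e by (simp add: b_def \<sigma>_def)
  show "asymp_eq ?F (\<lambda>e. \<phi> e 1) (\<lambda>e. 2 * \<kappa> e * e / sqrt d)"
  proof (rule asymp_eqI)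
    show "((\<lambda>e. \<phi> e 1 / (2 * \<kappa> e * e / sqrt d)) \<longlongrightarrow> 1) ?F" using r1 by (simp add: r_def b_eq mult.assoc)
    show "eventually (\<lambda>e. 2 * \<kappa> e * e / sqrt d \<noteq> 0) ?F" using pos by eventually_elim (use d in auto)
  qed
  show "asymp_eq ?F (\<lambda>e. G e d (\<kappa> e) (v e) (\<phi> e)) (\<lambda>e. - ((\<kappa> e)\<^sup>2 * e / (2 * sqrt d)))"
  proof (rule asymp_eqI)
    have "((\<lambda>e. g e * - 2) \<longlongrightarrow> - 1/2 * - 2) ?F" by (intro tendsto_mult g1 tendsto_const)
    then have lim: "((\<lambda>e. g e * - 2) \<longlongrightarrow> 1) ?F" by simp
    have "eventually (\<lambda>e. g e * - 2 = G e d (\<kappa> e) (v e) (\<phi> e) / - ((\<kappa> e)\<^sup>2 * e / (2 * sqrt d))) ?F"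
      using pos by eventually_elim (use d in \<open>simp add: g_def \<sigma>_def mult_ac\<close>)
    then show "((\<lambda>e. G e d (\<kappa> e) (v e) (\<phi> e) / - ((\<kappa> e)\<^sup>2 * e / (2 * sqrt d))) \<longlongrightarrow> 1) ?F"
      by (rule Lim_transform_eventually[OF lim])
    show "eventually (\<lambda>e. - ((\<kappa> e)\<^sup>2 * e / (2 * sqrt d)) \<noteq> 0) ?F" using pos by eventually_elim (use d in auto)
  qed
  have \<phi>b: "eventually (\<lambda>e. \<forall>x\<in>{0..1}. \<bar>\<phi> e x\<bar> \<le> 14 * b e) ?F"
  proof -
    have "eventually (\<lambda>e. r e < 2) ?F" using order_tendstoD(2)[OF r1, of 2] by simp
    then show ?thesis using LB UB p0 \<theta>h uh bh pos
    proof eventually_elim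
      case (elim e)
      have b: "b e > 0" using elim by simp
      show ?case
      proof
        fix x :: real assume x: "x \<in> {0..1}"
        define y where "y = \<bar>\<phi> e x\<bar>"
        have y: "y \<ge> 0" by (simp add: y_def)
        have "p e + \<theta> e / (4 * (b e)\<^sup>2) * ?S y - r e \<le> g e" using bspec[OF elim(2) x] by (simp only: y_def abs_abs_sin_primitive)
        then have "\<theta> e / (4 * (b e)\<^sup>2) * ?S y \<le> 2" using elim(1,3,4,6) by linarith
        then have "\<theta> e * ?S y \<le> 8 * (b e)\<^sup>2" using b by (simp add: field_simps)
        moreover have "0 \<le> ?S y" using abs_sin_primitive_mono[OF y] by (simp add: abs_sin_primitive_0)
        then have "1/2 * ?S y \<le> \<theta> e * ?S y" using elim(5) by (intro mult_right_mono) auto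
        ultimately have S: "?S y \<le> 16 * (b e)\<^sup>2" by linarith
        have "(b e)\<^sup>2 \<le> (1/16)\<^sup>2" using b elim(7) by (intro power_mono) auto
        then have "?S y < 2" using S by (simp add: power2_eq_square)
        then have ypi: "y \<le> pi" using abs_sin_primitive_mono[of pi y] abs_sin_primitive_eq[of pi] by (cases "y \<le> pi") auto
        have "y\<^sup>2 / 12 \<le> 16 * (b e)\<^sup>2" using abs_sin_primitive_quadratic_lower(2)[OF y ypi] S by linarith
        then have "y\<^sup>2 \<le> 192 * (b e)\<^sup>2" by simp
        \<comment> \<open>Source of the universal constant in (a):
          \<open>192 \<le> 14\<^sup>2\<close>, with 192 equal to 12 times 16.\<close>
        also have "\<dots> \<le> (14 * b e)\<^sup>2" by (simp add: power_mult_distrib)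
        finally show "\<bar>\<phi> e x\<bar> \<le> 14 * b e" unfolding y_def[symmetric] by (rule power2_le_imp_le) (use b in simp)
      qed
    qed
  qed
  have good: "eventually (\<lambda>e. good_set (v e) = {0<..<1}) ?F"
    using reg by eventually_elim (simp add: regular_minimizer_def)
  show "eventually (\<lambda>e. \<forall>x\<in>good_set (v e). \<bar>\<phi> e x\<bar> \<le> 14 * \<kappa> e * e / sqrt d) ?F"
    using \<phi>b good by eventually_elim (auto simp: b_eq mult.assoc)
  show "(\<lambda>e. SUP x\<in>{0<..<1}. \<bar>v e x - 1\<bar>) \<in> o[at_right 0](\<lambda>e. e)"
  proof (rule landau_o.smallI)
    fix c :: real assume c: "c > 0"
    \<comment> \<open>With \<open>1 / \<sigma> e = e / sqrt d\<close> the bound for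
      \<open>(v - 1)\<^sup>2\<close> becomes
      \<open>24 * w e * K\<^sup>2 * e\<^sup>2 / sqrt d\<close>; the second power of \<open>e\<close>
      is what gives \<open>o(e)\<close> for \<open>v - 1\<close>.\<close>
    define c' where "c' = c\<^sup>2 * sqrt d / (24 * K\<^sup>2)"
    have c': "c' > 0" using c d K0 by (simp add: c'_def)
    have "eventually (\<lambda>e. w e < c') ?F" using order_tendstoD(2)[OF w0 c'] .
    then show "eventually (\<lambda>e. norm (SUP x\<in>{0<..<1}. \<bar>v e x - 1\<bar>) \<le> c * norm e) ?F"
      using pl p0 pos \<kappa>1 reg
    proof eventually_elim
      case (elim e)
      have e: "e > 0" "\<sigma> e > 0" "\<kappa> e > 0" using elim(4) by auto
      have E: "well_energy e (v e) \<le> 2 * (p e * ((\<kappa> e)\<^sup>2 / \<sigma> e))"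
      proof -
        have "1/2 * well_energy e (v e) \<le> (1 - \<kappa> e * e) * well_energy e (v e)"
          using elim(5) well_energy_nonneg by (intro mult_right_mono) auto
        also have "\<dots> = p e * ((\<kappa> e)\<^sup>2 / \<sigma> e)" using e by (simp add: p_def)
        finally show ?thesis by linarith
      qed
      have "\<bar>v e x - 1\<bar> \<le> c * e" if x: "x \<in> {0<..<1}" for x
      proof -
        have "(v e x - 1)\<^sup>2 \<le> 12 * e * well_energy e (v e)" using elim(6) x by (simp add: regular_minimizer_def)
        also have "\<dots> \<le> 12 * e * (2 * (p e * ((\<kappa> e)\<^sup>2 / \<sigma> e)))" using E e by (intro mult_left_mono) auto
        also have "\<dots> \<le> 12 * e * (2 * (c' * (K\<^sup>2 / \<sigma> e)))"
          using e K elim(1,2,3) c' by (intro mult_left_mono mult_mono divide_right_mono power_mono) auto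
        also have "\<dots> = (c * e)\<^sup>2" using e K0 d by (simp add: c'_def \<sigma>_def power2_eq_square)
        finally show ?thesis using c e by (simp add: power2_le_iff_abs_le)
      qed
      then show ?case using abs_SUP_le[of "\<lambda>x. v e x - 1" "c * e"] e by simp
    qed
  qed
  \<comment> \<open>Normalises the amplitude: the initial slope becomes exactly -1, and the
    nonlinearity differs from its linearisation by at most \<open>98 * b e\<close>.\<close>
  define k where "k = (\<lambda>e. 1 / (2 * b e))"
  have "C1_loc_conv (\<lambda>e x. k e * \<phi> e (1 - x / (sqrt d / e))) (\<lambda>x. exp (- x)) ?F"
  proof (rule C1_loc_conv_right_end[OF reg \<eta>0 \<sigma>t, where B = 7])
    show "((\<lambda>x. exp (- x)) has_real_derivative - exp (- x)) (at x within {0..})" for x :: real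
      by (auto intro!: derivative_eq_intros)
    show "((\<lambda>x. - exp (- x)) has_real_derivative exp (- x)) (at x within {0..})" for x :: real
      by (auto intro!: derivative_eq_intros)
    show "eventually (\<lambda>e. \<forall>x\<in>{0..1}. \<bar>k e * (sin (\<phi> e x) * cos (\<phi> e x))\<bar> \<le> 7) ?F"
      using \<phi>b pos
    proof eventually_elim
      case (elim e)
      have b: "b e > 0" using elim by simp
      show ?case
      proof
        fix x :: real assume x: "x \<in> {0..1}"
        have "\<bar>sin (\<phi> e x)\<bar> * \<bar>cos (\<phi> e x)\<bar> \<le> \<bar>\<phi> e x\<bar> * 1"
          by (intro mult_mono abs_sin_x_le_abs_x) auto
        also have "\<dots> \<le> 14 * b e" using elim(1) x by simp
        finally show "\<bar>k e * (sin (\<phi> e x) * cos (\<phi> e x))\<bar> \<le> 7"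
          using b by (simp add: k_def abs_mult field_simps)
      qed
    qed
    show "((\<lambda>e. k e * \<phi> e 1) \<longlongrightarrow> exp (- 0)) ?F" using r1 by (simp add: k_def r_def[abs_def])
    have "eventually (\<lambda>e. - exp (- 0) = - (2 * k e * \<kappa> e / (sqrt d / e))) ?F"
      using pos by eventually_elim (auto simp: k_def b_def \<sigma>_def[symmetric])
    then show "((\<lambda>e. - (2 * k e * \<kappa> e / (sqrt d / e))) \<longlongrightarrow> - exp (- 0)) ?F"
      by (rule Lim_transform_eventually[OF tendsto_const])
    fix \<rho> :: real assume \<rho>: "\<rho> > 0"
    have "eventually (\<lambda>e. b e < \<rho> / 98) ?F" using order_tendstoD(2)[OF b0, of "\<rho> / 98"] \<rho> by simp
    then show "\<forall>\<^sub>F e in ?F. \<forall>x\<in>{0..sqrt d / e}.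
       \<bar>k e * (sin (\<phi> e (1 - x / (sqrt d / e))) * cos (\<phi> e (1 - x / (sqrt d / e)))) - exp (- x)\<bar>
       \<le> \<bar>k e * \<phi> e (1 - x / (sqrt d / e)) - exp (- x)\<bar> + \<rho>"
      using \<phi>b pos
    proof eventually_elim
      case (elim e)
      have b: "b e > 0" "\<sigma> e > 0" using elim by auto
      show ?case
      proof
        fix x assume x: "x \<in> {0..sqrt d / e}"
        define y where "y = \<phi> e (1 - x / (sqrt d / e))"
        have "1 - x / \<sigma> e \<in> {0..1}" using x b unfolding \<sigma>_def[symmetric] by (auto simp: \<sigma>_def[symmetric] field_simps)
        then have "\<bar>y\<bar> \<le> 14 * b e" using elim(2) by (auto simp: y_def \<sigma>_def)
        then have "\<bar>y\<bar>\<^sup>2 \<le> (14 * b e)\<^sup>2" by (intro power_mono) auto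
        then have y2: "y\<^sup>2 \<le> 196 * (b e)\<^sup>2" by (simp add: power_mult_distrib)
        have "sin y * cos y - y = (sin (2 * y) - 2 * y) / 2" by (simp add: sin_double)
        then have "\<bar>sin y * cos y - y\<bar> = \<bar>sin (2 * y) - 2 * y\<bar> / 2" by (simp only: abs_divide abs_numeral)
        also have "\<dots> \<le> y\<^sup>2" using sin_minus_self_le[of "2 * y"] by (simp add: power_mult_distrib)
        also have "\<dots> \<le> 196 * (b e)\<^sup>2" by (rule y2)
        finally have "\<bar>sin y * cos y - y\<bar> \<le> 196 * (b e)\<^sup>2" .
        then have "k e * \<bar>sin y * cos y - y\<bar> \<le> k e * (196 * (b e)\<^sup>2)" using b by (intro mult_left_mono) (auto simp: k_def)
        also have "\<dots> = 98 * b e" using b by (simp add: k_def power2_eq_square)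
        also have "\<dots> \<le> \<rho>" using elim(1) by simp
        finally have "k e * \<bar>sin y * cos y - y\<bar> \<le> \<rho>" .
        moreover have "k e * (sin y * cos y) - k e * y = k e * (sin y * cos y - y)" by (simp add: right_diff_distrib)
        moreover have "k e > 0" using b by (simp add: k_def)
        ultimately have "\<bar>k e * (sin y * cos y) - k e * y\<bar> \<le> \<rho>" by (simp add: abs_mult)
        then show "\<bar>k e * (sin (\<phi> e (1 - x / (sqrt d / e))) * cos (\<phi> e (1 - x / (sqrt d / e)))) - exp (- x)\<bar>
           \<le> \<bar>k e * \<phi> e (1 - x / (sqrt d / e)) - exp (- x)\<bar> + \<rho>"
          unfolding y_def[symmetric] by linarith
      qed
    qed
  qed
  then show "C1_loc_conv (\<lambda>e x. sqrt d / (2 * \<kappa> e * e) * \<phi> e (1 - e * x / sqrt d)) (\<lambda>x. exp (- x)) ?F"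
    by (simp add: k_def b_eq mult.commute mult.left_commute)
qed

section \<open>The winding regime\<close>

lemma sqrt_add_square_Lipschitz: "\<bar>sqrt (a\<^sup>2 + s\<^sup>2) - sqrt (b\<^sup>2 + s\<^sup>2)\<bar> \<le> \<bar>a - b\<bar>" for a b s :: real
proof -
  have "sqrt (x\<^sup>2 + s\<^sup>2) \<le> sqrt (y\<^sup>2 + s\<^sup>2) + \<bar>x - y\<bar>" for x y :: real
    using real_sqrt_sum_squares_triangle_ineq[of y "x - y" s 0] by simp
  from this[of a b] this[of b a] show ?thesis by (simp add: abs_minus_commute)
qed

text \<open>The integral is continuous and strictly increasing in \<open>a\<close>. At 0 it is the
  integral of the sine, 1, which the supercritical twist puts below \<open>kt * pi\<close>; at
  \<open>2 * kt\<close> the integrand is at least \<open>2 * kt\<close>.\<close>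

lemma winding_parameter_ex1:
  assumes kt: "kt > 1 / pi"
  shows "\<exists>!a. 0 < a \<and> a \<le> 2 * kt \<and> integral {0..pi/2} (\<lambda>y. sqrt (a\<^sup>2 + (sin y)\<^sup>2)) = kt * pi"
proof -
  define h where "h = (\<lambda>a::real. integral {0..pi/2} (\<lambda>y. sqrt (a\<^sup>2 + (sin y)\<^sup>2)))"
  have int: "(\<lambda>y. sqrt (a\<^sup>2 + (sin y)\<^sup>2)) integrable_on {0..pi/2}" for a :: real
    by (intro integrable_continuous_real continuous_intros)
  have kt1: "1 < kt * pi" using kt by (simp add: field_simps)
  have "0 < 1 / pi" by simp
  then have kt0: "kt > 0" using kt by linarith
  have Lip: "\<bar>h a - h b\<bar> \<le> pi / 2 * \<bar>a - b\<bar>" for a b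
  proof -
    have "norm (integral {0..pi/2} (\<lambda>y. sqrt (a\<^sup>2 + (sin y)\<^sup>2) - sqrt (b\<^sup>2 + (sin y)\<^sup>2))) \<le> integral {0..pi/2} (\<lambda>y::real. \<bar>a - b\<bar>)"
      by (rule integral_norm_bound_integral)
         (auto intro!: integrable_diff int sqrt_add_square_Lipschitz)
    then show ?thesis unfolding h_def by (simp add: Henstock_Kurzweil_Integration.integral_diff[OF int int])
  qed
  have cont: "continuous_on A h" for A
  proof (rule continuous_on_subset[of UNIV])
    have "(pi / 2)-lipschitz_on UNIV h"
      by (rule lipschitz_onI) (use Lip in \<open>auto simp: dist_real_def\<close>)
    then show "continuous_on UNIV h" by (rule lipschitz_on_continuous_on)
  qed simp
  have h0: "h 0 = 1"
  proof -
    have "((\<lambda>y. sqrt (0\<^sup>2 + (sin y)\<^sup>2)) has_integral (- cos (pi/2) - (- cos 0))) {0..pi/2}"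
    proof (rule has_integral_eq[rotated])
      show "((\<lambda>y. sin y) has_integral (- cos (pi/2) - (- cos 0))) {0..pi/2}"
        by (rule fundamental_theorem_of_calculus)
           (auto simp flip: has_real_derivative_iff_has_vector_derivative intro!: derivative_eq_intros)
      show "sin y = sqrt (0\<^sup>2 + (sin y)\<^sup>2)" if "y \<in> {0..pi/2}" for y :: real
        using sin_ge_zero[of y] that by simp
    qed
    then show ?thesis unfolding h_def by (simp add: integral_unique)
  qed
  have h2: "kt * pi \<le> h (2 * kt)"
  proof -
    have "integral {0..pi/2} (\<lambda>y::real. 2 * kt) \<le> h (2 * kt)" unfolding h_def
      by (rule integral_le[OF _ int]) (use kt0 in \<open>auto intro!: real_le_rsqrt\<close>)
    then show ?thesis by (simp add: mult.commute)
  qed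
  have strict: "h a < h b" if "0 \<le> a" "a < b" for a b
  proof -
    \<comment> \<open>A lower bound, uniform in \<open>y\<close>, for the difference of the two
      roots, obtained by rationalising it.\<close>
    define c where "c = (b\<^sup>2 - a\<^sup>2) / (2 * sqrt (b\<^sup>2 + 1))"
    have sq: "a\<^sup>2 < b\<^sup>2" using that by (intro power_strict_mono) auto
    have c: "c > 0" using sq by (simp add: c_def add_nonneg_pos)
    have "integral {0..pi/2} (\<lambda>y::real. c) \<le> integral {0..pi/2} (\<lambda>y. sqrt (b\<^sup>2 + (sin y)\<^sup>2) - sqrt (a\<^sup>2 + (sin y)\<^sup>2))"
    proof (rule integral_le)
      fix y :: real
      let ?A = "sqrt (a\<^sup>2 + (sin y)\<^sup>2)" and ?B = "sqrt (b\<^sup>2 + (sin y)\<^sup>2)"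
      have A: "?A \<le> ?B" using sq by (intro real_sqrt_le_mono) auto
      have s1: "(sin y)\<^sup>2 \<le> 1" by (simp add: abs_square_le_1)
      have B: "?B \<le> sqrt (b\<^sup>2 + 1)" using s1 by (intro real_sqrt_le_mono) auto
      have "0 < b\<^sup>2 + (sin y)\<^sup>2" using that by (intro add_pos_nonneg) auto
      then have B0: "?B > 0" by simp
      have A0: "?A \<ge> 0" by simp
      have "(?B - ?A) * (?B + ?A) = ?B\<^sup>2 - ?A\<^sup>2" by (simp add: power2_eq_square algebra_simps)
      also have "\<dots> = b\<^sup>2 - a\<^sup>2" by simp
      finally have e: "?B - ?A = (b\<^sup>2 - a\<^sup>2) / (?B + ?A)" using nonzero_eq_divide_eq[of "?B + ?A"] B0 A0 by (metis add_pos_nonneg less_irrefl)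
      have S: "?B + ?A \<le> 2 * sqrt (b\<^sup>2 + 1)" "0 < ?B + ?A" using A B B0 A0 by linarith+
      then have "0 < (2 * sqrt (b\<^sup>2 + 1)) * (?B + ?A)" by (intro mult_pos_pos) linarith+
      then show "c \<le> ?B - ?A" unfolding e c_def
        using S(1) sq by (intro divide_left_mono) auto
    qed (auto intro!: integrable_diff int)
    then have "c * (pi / 2) \<le> h b - h a" unfolding h_def
      by (simp add: mult.commute[of c] Henstock_Kurzweil_Integration.integral_diff[OF int int])
    moreover have "c * (pi / 2) > 0" using c by simp
    ultimately show ?thesis by linarith
  qed
  obtain a where a: "0 \<le> a" "a \<le> 2 * kt" "h a = kt * pi"
    using IVT'[of h 0 "kt * pi" "2 * kt"] h0 h2 kt1 kt0 cont by auto
  have "a \<noteq> 0" using a(3) h0 kt1 by auto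
  then have "0 < a \<and> a \<le> 2 * kt \<and> h a = kt * pi" using a by auto
  moreover have "b = a" if "0 < b \<and> b \<le> 2 * kt \<and> h b = kt * pi" for b
    using strict[of a b] strict[of b a] that a by (cases a b rule: linorder_cases) auto
  ultimately show ?thesis unfolding h_def by blast
qed

section \<open>First integral and winding profile\<close>

locale winding =
  fixes \<alpha> kt :: real
  assumes \<alpha>: "\<alpha> > 0" and period: "integral {0..pi/2} (\<lambda>y. sqrt (\<alpha>\<^sup>2 + (sin y)\<^sup>2)) = kt * pi"
begin

text \<open>The pendulum speed: \<open>f' = r f\<close> is the first integral of
  \<open>f'' = sin f * cos f\<close> at level \<open>\<alpha>\<^sup>2\<close>, with slope
  \<open>\<alpha>\<close> where \<open>f = 0\<close>.\<close>

definition r :: "real \<Rightarrow> real" where "r t = sqrt (\<alpha>\<^sup>2 + (sin t)\<^sup>2)"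

lemma r_sq: "(r t)\<^sup>2 = \<alpha>\<^sup>2 + (sin t)\<^sup>2"
  by (simp add: r_def)

lemma r_ge: "\<alpha> \<le> r t"
  unfolding r_def by (rule real_le_rsqrt) simp

lemma r_pos: "r t > 0"
  using r_ge[of t] \<alpha> by linarith

lemma r_le: "r t \<le> \<alpha> + 1"
proof -
  have "(sin t)\<^sup>2 \<le> 1" by (simp add: abs_square_le_1)
  moreover have "(\<alpha> + 1)\<^sup>2 = \<alpha>\<^sup>2 + 2 * \<alpha> + 1" by (simp add: power2_eq_square algebra_simps)
  ultimately have "\<alpha>\<^sup>2 + (sin t)\<^sup>2 \<le> (\<alpha> + 1)\<^sup>2" using \<alpha> by linarith
  then show ?thesis unfolding r_def using \<alpha> by (intro real_le_lsqrt) auto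
qed

lemma r_0: "r 0 = \<alpha>"
  using \<alpha> by (simp add: r_def)

lemma r_deriv: "(r has_real_derivative sin t * cos t / r t) (at t)"
proof -
  have "0 < \<alpha>\<^sup>2 + (sin t)\<^sup>2" using \<alpha> by (intro add_pos_nonneg) auto
  then show ?thesis unfolding r_def[abs_def]
    by (auto intro!: derivative_eq_intros simp: field_simps)
qed

lemma continuous_r: "continuous_on A r"
  by (rule DERIV_continuous_on[OF has_field_derivative_at_within[OF r_deriv]])

definition R :: "real \<Rightarrow> real" where
  "R = (SOME F. F 0 = 0 \<and> (\<forall>x. (F has_real_derivative r x) (at x)))"

lemma R_0: "R 0 = 0" and R_deriv: "(R has_real_derivative r x) (at x)"
proof -
  have "\<exists>F. F 0 = 0 \<and> (\<forall>x. (F has_real_derivative r x) (at x))"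
    by (rule antiderivative_UNIV[OF continuous_r]) blast
  from someI_ex[OF this] show "R 0 = 0" "(R has_real_derivative r x) (at x)" by (auto simp: R_def)
qed

lemma R_half_period: "R (pi / 2) = kt * pi"
proof -
  have "(r has_integral R (pi / 2) - R 0) {0..pi/2}"
    by (rule fundamental_theorem_of_calculus)
       (auto simp flip: has_real_derivative_iff_has_vector_derivative intro: has_field_derivative_at_within R_deriv)
  then show ?thesis using period by (simp add: R_0 integral_unique r_def[abs_def])
qed

lemma R_uminus: "R (- t) = - R t"
proof -
  let ?f = "\<lambda>t. R (- t) + R t"
  have "(?f has_real_derivative 0) (at t)" for t
    by (rule DERIV_cong[OF DERIV_add[OF DERIV_chain2[OF R_deriv, of uminus "-1"] R_deriv]])
       (auto intro!: derivative_eq_intros simp: r_def)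
  then have "?f t = ?f 0" by (rule constant_if_derivative_zero)
  then show ?thesis by (simp add: R_0)
qed

lemma R_pi: "R pi = 2 * kt * pi"
proof -
  let ?f = "\<lambda>t. R (pi - t) + R t"
  have "(?f has_real_derivative 0) (at t)" for t
    by (rule DERIV_cong[OF DERIV_add[OF DERIV_chain2[OF R_deriv, of "\<lambda>t. pi - t" "-1"] R_deriv]])
       (auto intro!: derivative_eq_intros simp: r_def)
  then have "?f 0 = ?f (pi / 2)" by (rule constant_if_derivative_zero)
  moreover have "pi - pi / 2 = pi / 2" by simp
  ultimately show ?thesis by (simp add: R_0 R_half_period)
qed

lemma R_add_pi: "R (t + pi) = R t + 2 * kt * pi"
proof -
  let ?f = "\<lambda>t. R (t + pi) - R t"
  have "(?f has_real_derivative 0) (at t)" for t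
    by (rule DERIV_cong[OF DERIV_diff[OF DERIV_chain2[OF R_deriv, of "\<lambda>t. t + pi" 1] R_deriv]])
       (auto intro!: derivative_eq_intros simp: r_def)
  then have "?f t = ?f 0" by (rule constant_if_derivative_zero)
  then show ?thesis using R_pi by (simp add: R_0)
qed

text \<open>The choice of \<^term>\<open>\<alpha>\<close> makes the mean of \<^term>\<open>r\<close> over a period equal to
  \<^term>\<open>2 * kt\<close>, so the linear part of \<^term>\<open>R\<close> cancels the twist term of the energy.\<close>

lemma R_minus_linear_bounded:
  obtains C where "C > 0" "\<And>t. \<bar>R t - 2 * kt * t\<bar> \<le> C"
proof -
  define P where "P = (\<lambda>t. R t - 2 * kt * t)"
  have per: "P (t + real n * pi) = P t" for t n
  proof (induction n)
    case (Suc n)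
    have eq: "t + real (Suc n) * pi = (t + real n * pi) + pi" by (simp add: algebra_simps)
    have "P (t + real (Suc n) * pi) = P (t + real n * pi)" unfolding eq P_def R_add_pi by (simp add: algebra_simps)
    then show ?case using Suc by simp
  qed simp
  have "continuous_on {0..pi} R" by (rule DERIV_continuous_on[OF has_field_derivative_at_within[OF R_deriv]])
  then have "continuous_on {0..pi} P" unfolding P_def by (intro continuous_intros)
  then have "bounded (P ` {0..pi})" using compact_continuous_image compact_imp_bounded compact_Icc by blast
  then obtain C where C: "C > 0" "\<And>t. t \<in> {0..pi} \<Longrightarrow> \<bar>P t\<bar> \<le> C" by (auto simp: bounded_pos)
  have nonneg: "\<bar>P t\<bar> \<le> C" if t: "t \<ge> 0" for t
  proof -
    obtain u n where "t = u + real n * pi" "0 \<le> u" "u < pi" using mod_pi[OF t] .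
    then show ?thesis using per[of u n] C(2)[of u] by simp
  qed
  have "P (- t) = - P t" for t by (simp add: P_def R_uminus)
  then have "\<bar>P t\<bar> \<le> C" for t using nonneg[of t] nonneg[of "- t"] by (cases "t \<ge> 0") auto
  then show thesis using C(1) by (intro that[of C]) (auto simp: P_def)
qed

text \<open>Separation of variables: \<open>T\<close> is the travel time, a primitive of
  \<open>1 / r\<close>. Its slope is at least \<open>1 / (\<alpha> + 1)\<close>, so it maps onto the
  whole line and its inverse is a global profile.\<close>

lemma profile_exists:
  obtains f where "f 0 = 0" "\<And>x. (f has_real_derivative r (f x)) (at x)"
proof -
  have "continuous_on UNIV (\<lambda>t. 1 / r t)" 
    by (intro continuous_intros continuous_r) (use r_pos in \<open>auto simp: less_imp_neq[symmetric]\<close>)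
  then obtain T where T: "T 0 = 0" "\<And>x. (T has_real_derivative 1 / r x) (at x)" 
    using antiderivative_UNIV by blast
  have mono: "T x < T y" if "x < y" for x y
    by (rule DERIV_pos_imp_increasing[OF that]) (use T(2) r_pos in \<open>auto intro!: exI\<close>)
  have grow: "(y - x) / (\<alpha> + 1) \<le> T y - T x" if "x \<le> y" for x y
  proof -
    have "(\<lambda>t. T t - t / (\<alpha> + 1)) x \<le> (\<lambda>t. T t - t / (\<alpha> + 1)) y"
    proof (rule DERIV_nonneg_imp_nondecreasing[OF that])
      fix t
      have "((\<lambda>t. T t - t / (\<alpha> + 1)) has_real_derivative 1 / r t - 1 / (\<alpha> + 1)) (at t)"
        using \<alpha> by (auto intro!: derivative_eq_intros T(2))
      moreover have "0 \<le> 1 / r t - 1 / (\<alpha> + 1)" using r_le[of t] r_pos[of t] \<alpha> by (simp add: frac_le)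
      ultimately show "\<exists>y. ((\<lambda>t. T t - t / (\<alpha> + 1)) has_real_derivative y) (at t) \<and> 0 \<le> y" by blast
    qed
    then show ?thesis by (simp add: diff_divide_distrib)
  qed
  have contT: "isCont T x" for x using T(2) by (rule DERIV_isCont)
  have "\<exists>x. T x = y" for y
  proof -
    define c where "c = \<bar>y\<bar> * (\<alpha> + 1)"
    have c: "c \<ge> 0" using \<alpha> by (simp add: c_def)
    have ca: "c / (\<alpha> + 1) = \<bar>y\<bar>" using \<alpha> by (simp add: c_def)
    have "\<bar>y\<bar> \<le> T c" using grow[of 0 c] c T(1) ca by simp
    moreover have "T (- c) \<le> - \<bar>y\<bar>" using grow[of "- c" 0] c T(1) ca by simp
    ultimately show ?thesis
      using IVT[of T "- c" y c] contT c by force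
  qed
  then obtain f where f: "\<And>y. T (f y) = y" by metis
  have inj: "f (T x) = x" for x
    using f[of "T x"] mono by (metis less_irrefl linorder_neqE)
  have contf: "isCont f y" for y
  proof -
    have "isCont f (T (f y))"
      by (rule isCont_inverse_function2[of "f y - 1" "f y" "f y + 1" f T]) (use inj contT in auto)
    then show ?thesis by (simp add: f)
  qed
  show thesis
  proof (rule that[of f])
    show "f 0 = 0" using inj[of 0] T(1) by simp
    fix y
    have "(f has_real_derivative inverse (1 / r (f y))) (at y)"
      by (rule DERIV_inverse_function[where f = T and a = "y - 1" and b = "y + 1"]) (use r_pos[of "f y"] T(2)[of "f y"] f contf in auto)
    then show "(f has_real_derivative r (f y)) (at y)" by simp
  qed
qed

lemma profile_ode:
  assumes "f 0 = 0" "\<And>x. (f has_real_derivative r (f x)) (at x)"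
  shows "ode_sol \<alpha> f"
  unfolding ode_sol_def
proof (intro exI[of _ "\<lambda>x. r (f x)"] conjI allI impI)
  show "f 0 = 0" "r (f 0) = \<alpha>" using assms r_0 by auto
  fix x :: real
  show "(f has_real_derivative r (f x)) (at x within {0..})" using assms(2) by (rule has_field_derivative_at_within)
  have "((\<lambda>x. r (f x)) has_real_derivative sin (f x) * cos (f x)) (at x)"
    by (rule DERIV_cong[OF DERIV_chain2[OF r_deriv assms(2)]]) (use r_pos[of "f x"] in simp)
  then show "((\<lambda>x. r (f x)) has_real_derivative sin (f x) * cos (f x)) (at x within {0..})" by (rule has_field_derivative_at_within)
qed

text \<open>An identity rather than an inequality, so the defect
  \<open>\<phi>' - \<sigma> * r \<phi>\<close> is kept. With zero defect it evaluates the
  competitor; in the lower bound the squared defect measures the distance from the profile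
  equation.\<close>

lemma energy_identity:
  assumes d: "\<And>x. x \<in> {0..1} \<Longrightarrow> (\<phi> has_real_derivative \<phi>' x) (at x within {0..1})"
    and c': "continuous_on {0..1} \<phi>'" and p0: "\<phi> 0 = 0"
  shows "integral {0..1} (\<lambda>x. 1/8 * (\<phi>' x)\<^sup>2 + \<sigma>\<^sup>2/8 * (sin (\<phi> x))\<^sup>2)
    = 1/8 * integral {0..1} (\<lambda>x. (\<phi>' x - \<sigma> * r (\<phi> x))\<^sup>2) + \<sigma>/4 * R (\<phi> 1) - \<sigma>\<^sup>2 * \<alpha>\<^sup>2 / 8"
proof -
  have cp: "continuous_on {0..1} \<phi>" by (rule DERIV_continuous_on[OF d])
  have cr: "continuous_on {0..1} (\<lambda>x. r (\<phi> x))" by (rule continuous_on_compose2[OF continuous_r cp]) auto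
  have "((\<lambda>x. r (\<phi> x) * \<phi>' x) has_integral R (\<phi> 1) - R (\<phi> 0)) {0..1}"
  proof (rule fundamental_theorem_of_calculus)
    fix x :: real assume "x \<in> {0..1}"
    from DERIV_chain2[OF R_deriv d[OF this]]
    show "((\<lambda>x. R (\<phi> x)) has_vector_derivative r (\<phi> x) * \<phi>' x) (at x within {0..1})"
      by (simp add: has_real_derivative_iff_has_vector_derivative)
  qed simp
  then have i: "((\<lambda>x. r (\<phi> x) * \<phi>' x) has_integral R (\<phi> 1)) {0..1}" by (simp add: p0 R_0)
  have c: "((\<lambda>x::real. \<sigma>\<^sup>2 * \<alpha>\<^sup>2 / 8) has_integral \<sigma>\<^sup>2 * \<alpha>\<^sup>2 / 8) {0..1}"
    using has_integral_const_real[of "\<sigma>\<^sup>2 * \<alpha>\<^sup>2 / 8" 0 1] by simp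
  have "((\<lambda>x. 1/8 * (\<phi>' x - \<sigma> * r (\<phi> x))\<^sup>2 + \<sigma>/4 * (r (\<phi> x) * \<phi>' x) - \<sigma>\<^sup>2 * \<alpha>\<^sup>2 / 8) has_integral
     (1/8 * integral {0..1} (\<lambda>x. (\<phi>' x - \<sigma> * r (\<phi> x))\<^sup>2) + \<sigma>/4 * R (\<phi> 1) - \<sigma>\<^sup>2 * \<alpha>\<^sup>2 / 8)) {0..1}"
    by (intro has_integral_add has_integral_diff has_integral_mult_right i c integrable_integral integrable_continuous_real continuous_intros c' cr)
  moreover have "1/8 * (\<phi>' x - \<sigma> * r (\<phi> x))\<^sup>2 + \<sigma>/4 * (r (\<phi> x) * \<phi>' x) - \<sigma>\<^sup>2 * \<alpha>\<^sup>2 / 8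
      = 1/8 * (\<phi>' x)\<^sup>2 + \<sigma>\<^sup>2/8 * (sin (\<phi> x))\<^sup>2" for x
  proof -
    have "1/8 * (\<phi>' x - \<sigma> * r (\<phi> x))\<^sup>2 + \<sigma>/4 * (r (\<phi> x) * \<phi>' x) - \<sigma>\<^sup>2 * \<alpha>\<^sup>2 / 8
      = 1/8 * (\<phi>' x)\<^sup>2 + \<sigma>\<^sup>2/8 * ((r (\<phi> x))\<^sup>2 - \<alpha>\<^sup>2)" by (simp add: power2_eq_square field_simps)
    then show ?thesis by (simp add: r_sq)
  qed
  ultimately show ?thesis by (simp add: integral_unique)
qed

text \<open>The profile run at scale \<open>\<sigma>\<close> has no defect, so only
  \<open>R t - 2 * kt * t\<close> at its end value is left, which is bounded however often the phase
  winds.\<close>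

lemma supercritical_upper_bound:
  assumes min: "is_minimizer \<epsilon> \<delta> \<kappa> v \<phi>" and \<delta>: "\<delta> > 0" "\<epsilon> > 0"
    and \<sigma>: "\<sigma> = sqrt \<delta> / \<epsilon>" and \<kappa>: "\<kappa> = kt * \<sigma>" and C: "\<And>t. \<bar>R t - 2 * kt * t\<bar> \<le> C"
  shows "G \<epsilon> \<delta> \<kappa> v \<phi> \<le> \<sigma> / 4 * C - \<sigma>\<^sup>2 * \<alpha>\<^sup>2 / 8"
proof -
  have \<sigma>0: "\<sigma> > 0" using \<delta> by (simp add: \<sigma>)
  have \<sigma>2: "\<delta>/(8*\<epsilon>\<^sup>2) = \<sigma>\<^sup>2/8" using \<delta> by (simp add: \<sigma> power_divide)
  obtain f where f: "f 0 = 0" "\<And>x. (f has_real_derivative r (f x)) (at x)" using profile_exists by blast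
  define \<psi> where "\<psi> = (\<lambda>x. f (\<sigma> * x))"
  define \<psi>' where "\<psi>' = (\<lambda>x. \<sigma> * r (\<psi> x))"
  have d: "(\<psi> has_real_derivative \<psi>' x) (at x)" for x
    unfolding \<psi>_def \<psi>'_def
    by (rule DERIV_cong[OF DERIV_chain2[OF f(2), of "\<lambda>x. \<sigma> * x" \<sigma>]]) (auto intro!: derivative_eq_intros)
  have c\<psi>: "continuous_on {0..1} \<psi>" by (rule DERIV_continuous_on[OF has_field_derivative_at_within[OF d]])
  have c': "continuous_on {0..1} \<psi>'" unfolding \<psi>'_def
    by (intro continuous_intros continuous_on_compose2[OF continuous_r c\<psi>]) auto
  have \<psi>0: "\<psi> 0 = 0" by (simp add: \<psi>_def f)
  have h\<psi>: "(\<psi>' has_integral \<psi> 1) {0..1}"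
    using fundamental_theorem_of_calculus[of 0 1 \<psi> \<psi>'] has_field_derivative_at_within[OF d] \<psi>0
    by (simp flip: has_real_derivative_iff_has_vector_derivative)
  have "G \<epsilon> \<delta> \<kappa> v \<phi> \<le> integral {0..1} (\<lambda>x. 1/8 * (\<psi>' x)\<^sup>2 + \<sigma>\<^sup>2/8 * (sin (\<psi> x))\<^sup>2 - \<kappa>/2 * \<psi>' x)"
    using minimizer_upper_bound[OF min d c' \<psi>0] unfolding \<sigma>2 .
  also have "\<dots> = integral {0..1} (\<lambda>x. 1/8 * (\<psi>' x)\<^sup>2 + \<sigma>\<^sup>2/8 * (sin (\<psi> x))\<^sup>2) - \<kappa>/2 * \<psi> 1"
    by (rule integral_unique, intro has_integral_diff has_integral_mult_right h\<psi> integrable_integral integrable_continuous_real continuous_intros c\<psi> c')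
  also have "\<dots> = \<sigma>/4 * R (\<psi> 1) - \<sigma>\<^sup>2 * \<alpha>\<^sup>2 / 8 - \<kappa>/2 * \<psi> 1"
    by (subst energy_identity[OF has_field_derivative_at_within[OF d] c' \<psi>0]) (simp add: \<psi>'_def)
  also have "\<dots> = \<sigma>/4 * (R (\<psi> 1) - 2 * kt * \<psi> 1) - \<sigma>\<^sup>2 * \<alpha>\<^sup>2 / 8" by (simp add: \<kappa> field_simps)
  also have "\<dots> \<le> \<sigma> / 4 * C - \<sigma>\<^sup>2 * \<alpha>\<^sup>2 / 8"
  proof -
    have "R (\<psi> 1) - 2 * kt * \<psi> 1 \<le> C" using C[of "\<psi> 1"] by linarith
    then have "\<sigma>/4 * (R (\<psi> 1) - 2 * kt * \<psi> 1) \<le> \<sigma>/4 * C" using \<sigma>0 by (intro mult_left_mono) auto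
    then show ?thesis by simp
  qed
  finally show ?thesis .
qed

end

section \<open>Slope at the left end in the winding regime\<close>

lemma rescaled_left_end:
  assumes reg: "regular_minimizer \<epsilon> \<sigma> \<kappa> \<eta> v \<phi> M \<phi>'" and T: "T \<le> \<sigma>" and x: "x \<in> {0..T}"
  shows "x / \<sigma> \<in> {0..1}" "\<bar>v (x / \<sigma>) - 1\<bar> \<le> \<eta>"
    "((\<lambda>x. \<phi> (x / \<sigma>)) has_real_derivative 2 * (\<kappa> / \<sigma>) - M (x / \<sigma>) / \<sigma> / (v (x / \<sigma>))\<^sup>2) (at x within {0..T})"
    "((\<lambda>x. M (x / \<sigma>) / \<sigma>) has_real_derivative - ((v (x / \<sigma>))^4 * (sin (\<phi> (x / \<sigma>)) * cos (\<phi> (x / \<sigma>))))) (at x within {0..T})"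
proof -
  have \<sigma>: "\<sigma> > 0" using reg by (simp add: regular_minimizer_def)
  have im: "y / \<sigma> \<in> {0..1}" if "y \<in> {0..T}" for y using that \<sigma> T by (auto simp: field_simps)
  show im': "x / \<sigma> \<in> {0..1}" using im x by blast
  show "\<bar>v (x / \<sigma>) - 1\<bar> \<le> \<eta>" using reg im' by (auto simp: regular_minimizer_def)
  have a: "((\<lambda>x. x / \<sigma>) has_real_derivative 1 / \<sigma>) (at x within {0..T})"
    using \<sigma> by (auto intro!: derivative_eq_intros)
  have chain: "((\<lambda>x. f (x / \<sigma>)) has_real_derivative d / \<sigma>) (at x within {0..T})"
    if f: "(f has_real_derivative d) (at (x / \<sigma>) within {0..1})" for f d
  proof -
    have "(f has_real_derivative d) (at (x / \<sigma>) within (\<lambda>x. x / \<sigma>) ` {0..T})"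
      using im by (intro DERIV_subset[OF f]) auto
    from DERIV_image_chain[OF this a] show ?thesis by (simp add: o_def)
  qed
  have "(\<phi> has_real_derivative 2 * \<kappa> - M (x / \<sigma>) / (v (x / \<sigma>))\<^sup>2) (at (x / \<sigma>) within {0..1})"
    using reg im' by (auto simp: regular_minimizer_def)
  from chain[OF this]
  show "((\<lambda>x. \<phi> (x / \<sigma>)) has_real_derivative 2 * (\<kappa> / \<sigma>) - M (x / \<sigma>) / \<sigma> / (v (x / \<sigma>))\<^sup>2) (at x within {0..T})"
    by (rule DERIV_cong) (simp add: diff_divide_distrib)
  have "(M has_real_derivative - (\<sigma>\<^sup>2 * (v (x / \<sigma>))^4 * (sin (\<phi> (x / \<sigma>)) * cos (\<phi> (x / \<sigma>))))) (at (x / \<sigma>) within {0..1})"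
    using reg im' by (auto simp: regular_minimizer_def)
  from DERIV_cdivide[OF chain[OF this], of \<sigma>]
  show "((\<lambda>x. M (x / \<sigma>) / \<sigma>) has_real_derivative - ((v (x / \<sigma>))^4 * (sin (\<phi> (x / \<sigma>)) * cos (\<phi> (x / \<sigma>))))) (at x within {0..T})"
    by (rule DERIV_cong) (use \<sigma> in \<open>simp add: power2_eq_square\<close>)
qed

lemma abs_sin_cos_le_1: "\<bar>sin x * cos x\<bar> \<le> 1" for x :: real
  by (simp add: abs_mult mult_le_one)

lemma continuous_nonvanishing_pos:
  fixes f :: "real \<Rightarrow> real"
  assumes "continuous_on {a..b} f" "\<And>x. x \<in> {a..b} \<Longrightarrow> f x \<noteq> 0" "f b > 0" "a \<le> b"
  shows "f a > 0"
proof (rule ccontr)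
  assume "\<not> f a > 0"
  then obtain x where "a \<le> x" "x \<le> b" "f x = 0"
    using IVT'[of f a 0 b] assms(1,3,4) by auto
  then show False using assms(2)[of x] by auto
qed

context winding
begin

text \<open>If the defect \<^term>\<open>\<phi>' - \<sigma> * r \<phi>\<close> is small in the mean, it is small at some point
  of the boundary layer; the almost conserved quantity \<^term>\<open>z\<^sup>2 - (sin \<phi>)\<^sup>2\<close> transports this
  information back to the end point.\<close>

lemma initial_slope:
  assumes reg: "regular_minimizer \<epsilon> \<sigma> \<kappa> \<eta> v \<phi> M \<phi>'" and \<kappa>: "\<kappa> = kt * \<sigma>" and kt: "kt \<ge> 0"
    and L: "0 < L" "L \<le> \<sigma>"
    and D: "integral {0..1} (\<lambda>x. (\<phi>' x - \<sigma> * r (\<phi> x))\<^sup>2) \<le> q\<^sup>2 * L * \<sigma>" and q: "q > 0"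
  defines "B \<equiv> 3 * (2 * kt + \<alpha> + 1 + q) + 16 * L"
  defines "\<rho> \<equiv> q + 10 * \<eta> * B"
  defines "\<Delta> \<equiv> \<rho> * (2 * \<alpha> + 2 + \<rho>) + 40 * \<eta> * (2 * kt + B) * L"
  assumes small: "\<rho> < \<alpha>" "\<Delta> < \<alpha>\<^sup>2"
  shows "\<bar>2 * kt - M 0 / \<sigma> - \<alpha>\<bar> \<le> \<Delta> / \<alpha>"
proof -
  have \<sigma>: "\<sigma> > 0" and \<eta>: "0 \<le> \<eta>" "\<eta> \<le> 1/2" and p0: "\<phi> 0 = 0" and c': "continuous_on {0..1} \<phi>'"
    and d: "\<And>x. x \<in> {0..1} \<Longrightarrow> (\<phi> has_real_derivative \<phi>' x) (at x within {0..1})"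
    and p': "\<And>x. x \<in> {0..1} \<Longrightarrow> \<phi>' x = 2 * \<kappa> - M x / (v x)\<^sup>2"
    using reg by (auto simp: regular_minimizer_def)
  have \<kappa>\<sigma>: "\<kappa> / \<sigma> = kt" using \<sigma> by (simp add: \<kappa>)
  note re = rescaled_left_end[OF reg L(2), unfolded \<kappa>\<sigma>]
  define f where "f = (\<lambda>x. \<phi> (x / \<sigma>))"
  define m where "m = (\<lambda>x. M (x / \<sigma>) / \<sigma>)"
  define w where "w = (\<lambda>x. v (x / \<sigma>))"
  define f' where "f' = (\<lambda>x. 2 * kt - m x / (w x)\<^sup>2)"
  define z where "z = (\<lambda>x. 2 * kt - m x)"
  define sc where "sc = (\<lambda>x. sin (f x) * cos (f x))"
  have df: "(f has_real_derivative f' x) (at x within {0..L})" if "x \<in> {0..L}" for x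
    using re(3)[OF that] by (simp add: f_def f'_def m_def w_def)
  have dm: "(m has_real_derivative - ((w x)^4 * sc x)) (at x within {0..L})" if "x \<in> {0..L}" for x
    using re(4)[OF that] by (simp add: f_def m_def w_def sc_def)
  have dz: "(z has_real_derivative (w x)^4 * sc x) (at x within {0..L})" if "x \<in> {0..L}" for x
    unfolding z_def using DERIV_diff[OF DERIV_const dm[OF that], of "2 * kt"] by simp
  have wb: "\<bar>w x - 1\<bar> \<le> \<eta>" if "x \<in> {0..L}" for x using re(2)[OF that] by (simp add: w_def)
  note nb = near_one_bounds[OF wb \<eta>(2)]
  have sc1: "\<bar>sc x\<bar> \<le> 1" for x by (simp add: sc_def abs_sin_cos_le_1)
  have B0: "B \<ge> 0" "16 * L \<le> B" using kt \<alpha> q L by (auto simp: B_def)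
  \<comment> \<open>Selection in the mean: a rescaled defect above \<open>q\<close> on all of {0..L}
    would violate the integral bound \<open>D\<close>.\<close>
  have "\<exists>y\<in>{0..L}. \<bar>f' y - r (f y)\<bar> \<le> q"
  proof (rule ccontr)
    assume neg: "\<not> (\<exists>y\<in>{0..L}. \<bar>f' y - r (f y)\<bar> \<le> q)"
    let ?h = "\<lambda>x. (\<phi>' x - \<sigma> * r (\<phi> x))\<^sup>2"
    have cp: "continuous_on {0..1} \<phi>" by (rule DERIV_continuous_on[OF d])
    have ch: "continuous_on {0..1} ?h"
      by (intro continuous_intros c' continuous_on_compose2[OF continuous_r cp]) auto
    have sub: "{0..L/\<sigma>} \<subseteq> {0..1}" using L \<sigma> by (auto simp: field_simps)
    have cont_h: "continuous_on {0..L/\<sigma>} ?h" by (rule continuous_on_subset[OF ch sub])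
    have big: "q\<^sup>2 * \<sigma>\<^sup>2 < ?h x" if x: "x \<in> {0..L/\<sigma>}" for x
    proof -
      have "x * \<sigma> \<in> {0..L}" using x \<sigma> by (auto simp: field_simps)
      then have "q < \<bar>f' (x * \<sigma>) - r (f (x * \<sigma>))\<bar>" using neg by (meson not_le)
      moreover have "f' (x * \<sigma>) - r (f (x * \<sigma>)) = (\<phi>' x - \<sigma> * r (\<phi> x)) / \<sigma>"
      proof -
        have "x \<in> {0..1}" using x sub by blast
        then show ?thesis using \<sigma> p'[of x] by (simp add: f'_def m_def w_def f_def \<kappa> field_simps)
      qed
      ultimately have "q < \<bar>(\<phi>' x - \<sigma> * r (\<phi> x)) / \<sigma>\<bar>" by (simp only:)
      then have "q * \<sigma> < \<bar>\<phi>' x - \<sigma> * r (\<phi> x)\<bar>" using \<sigma> by (simp add: pos_less_divide_eq)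
      then have "(q * \<sigma>)\<^sup>2 < \<bar>\<phi>' x - \<sigma> * r (\<phi> x)\<bar>\<^sup>2" using q \<sigma> by (intro power_strict_mono) auto
      then show ?thesis by (simp add: power_mult_distrib)
    qed
    obtain x0 where x0: "x0 \<in> {0..L/\<sigma>}" "\<And>x. x \<in> {0..L/\<sigma>} \<Longrightarrow> ?h x0 \<le> ?h x"
      using continuous_attains_inf[OF compact_Icc _ cont_h] L \<sigma> by auto
    have "q\<^sup>2 * L * \<sigma> = q\<^sup>2 * \<sigma>\<^sup>2 * (L / \<sigma>)" using \<sigma> by (simp add: power2_eq_square)
    also have "\<dots> < ?h x0 * (L / \<sigma>)" using big[OF x0(1)] L \<sigma> by (intro mult_strict_right_mono) auto
    also have "\<dots> = integral {0..L/\<sigma>} (\<lambda>x::real. ?h x0)" using L \<sigma> by simp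
    also have "\<dots> \<le> integral {0..L/\<sigma>} ?h"
      by (rule integral_le[OF _ integrable_continuous_real[OF cont_h]]) (use x0 in auto)
    also have "\<dots> \<le> integral {0..1} ?h"
      using sub by (intro integral_subset_le integrable_continuous_real cont_h ch) auto
    also note D
    finally show False by simp
  qed
  then obtain y1 where y1: "y1 \<in> {0..L}" "\<bar>f' y1 - r (f y1)\<bar> \<le> q" by blast
  have f'y1: "\<bar>f' y1\<bar> \<le> \<alpha> + 1 + q" using y1(2) r_le[of "f y1"] r_pos[of "f y1"] by linarith
  \<comment> \<open>At \<open>y1\<close> the flux is bounded directly from the equation, with
    \<open>w\<^sup>2 \<le> 3\<close>; moving by at most \<open>L\<close> at rate 16 adds the second
    part of \<open>B\<close>.\<close>
  have my1: "\<bar>m y1\<bar> \<le> 3 * (2 * kt + \<alpha> + 1 + q)"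
  proof -
    have w: "1/2 \<le> w y1" "w y1 \<le> 3/2" using nb(4)[OF y1(1)] wb[OF y1(1)] \<eta>(2) by auto
    then have "(w y1)\<^sup>2 \<le> (3/2)\<^sup>2" by (intro power_mono) auto
    then have w2: "(w y1)\<^sup>2 \<le> 3" by (simp add: power2_eq_square)
    have "m y1 = (w y1)\<^sup>2 * (2 * kt - f' y1)" using w by (simp add: f'_def)
    then have "\<bar>m y1\<bar> = (w y1)\<^sup>2 * \<bar>2 * kt - f' y1\<bar>" by (simp add: abs_mult)
    also have "\<dots> \<le> 3 * (2 * kt + \<alpha> + 1 + q)" using w2 f'y1 kt by (intro mult_mono) auto
    finally show ?thesis .
  qed
  have mB: "\<bar>m x\<bar> \<le> B" if x: "x \<in> {0..L}" for x
  proof -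
    have "\<bar>m x - m y1\<bar> \<le> 16 * L"
    proof (rule bounded_derivative_growth[OF dm _ x y1(1)])
      fix y assume y: "y \<in> {0..L}"
      have "\<bar>(w y)^4 * sc y\<bar> \<le> 16 * 1" unfolding abs_mult using nb(3)[OF y] sc1 by (intro mult_mono) auto
      then show "\<bar>- ((w y)^4 * sc y)\<bar> \<le> 16" by simp
    qed
    then show ?thesis using my1 unfolding B_def by linarith
  qed
  have fz: "\<bar>f' x - z x\<bar> \<le> 10 * \<eta> * B" if x: "x \<in> {0..L}" for x
  proof -
    have "f' x - z x = - (m x * (1 / (w x)\<^sup>2 - 1))" by (simp add: f'_def z_def algebra_simps)
    then have "\<bar>f' x - z x\<bar> = \<bar>m x\<bar> * \<bar>1 / (w x)\<^sup>2 - 1\<bar>" by (simp only: abs_minus_cancel abs_mult)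
    also have "\<dots> \<le> B * (10 * \<eta>)" using mB[OF x] nb(1)[OF x] B0 by (intro mult_mono) auto
    finally show ?thesis by (simp add: mult_ac)
  qed
  have zB: "\<bar>z x\<bar> \<le> 2 * kt + B" if x: "x \<in> {0..L}" for x
    using mB[OF x] kt unfolding z_def by linarith
  \<comment> \<open>Conserved by the limiting system \<open>f' = z\<close>,
    \<open>z' = sin f * cos f\<close>; here it drifts over {0..L} only by a multiple of
    \<open>\<eta>\<close>. At \<open>y1\<close> it is close to \<open>\<alpha>\<^sup>2\<close>,
    because \<open>z\<close> is there close to \<open>r f\<close>.\<close>
  define Q where "Q = (\<lambda>x. (z x)\<^sup>2 - (sin (f x))\<^sup>2)"
  have dQ: "(Q has_real_derivative 2 * sc x * (z x * ((w x)^4 - 1) + (z x - f' x))) (at x within {0..L})" if x: "x \<in> {0..L}" for x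
  proof -
    have "(Q has_real_derivative 2 * z x * ((w x)^4 * sc x) - 2 * sin (f x) * (cos (f x) * f' x)) (at x within {0..L})"
      unfolding Q_def
      by (rule DERIV_cong[OF DERIV_diff[OF DERIV_power[OF dz[OF x], of 2] DERIV_power[OF DERIV_chain2[OF DERIV_sin df[OF x]], of 2]]])
         simp
    then show ?thesis by (rule DERIV_cong) (simp add: sc_def algebra_simps)
  qed
  have Qy: "\<bar>Q x - Q y1\<bar> \<le> 40 * \<eta> * (2 * kt + B) * L" if x: "x \<in> {0..L}" for x
  proof (rule bounded_derivative_growth[OF dQ _ x y1(1)])
    fix y assume y: "y \<in> {0..L}"
    have "\<bar>z y * ((w y)^4 - 1)\<bar> \<le> (2 * kt + B) * (10 * \<eta>)"
      unfolding abs_mult using zB[OF y] nb(2)[OF y] kt B0 by (intro mult_mono) auto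
    moreover have "\<bar>z y - f' y\<bar> \<le> (2 * kt + B) * (10 * \<eta>)"
    proof -
      have "0 \<le> kt * \<eta>" using kt \<eta> by simp
      then show ?thesis using fz[OF y] by (simp add: abs_minus_commute algebra_simps)
    qed
    ultimately have "\<bar>z y * ((w y)^4 - 1) + (z y - f' y)\<bar> \<le> 20 * \<eta> * (2 * kt + B)"
      by (simp add: algebra_simps abs_le_iff)
    then have "\<bar>2 * sc y\<bar> * \<bar>z y * ((w y)^4 - 1) + (z y - f' y)\<bar> \<le> 2 * (20 * \<eta> * (2 * kt + B))"
      using sc1[of y] by (intro mult_mono) auto
    then show "\<bar>2 * sc y * (z y * ((w y)^4 - 1) + (z y - f' y))\<bar> \<le> 40 * \<eta> * (2 * kt + B)"
      by (simp add: abs_mult mult.assoc)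
  qed
  have zr: "\<bar>z y1 - r (f y1)\<bar> \<le> \<rho>" using y1(2) fz[OF y1(1)] unfolding \<rho>_def by linarith
  have \<rho>0: "\<rho> \<ge> 0" using zr by linarith
  have Qy1: "\<bar>Q y1 - \<alpha>\<^sup>2\<bar> \<le> \<rho> * (2 * \<alpha> + 2 + \<rho>)"
  proof -
    have "Q y1 - \<alpha>\<^sup>2 = (z y1)\<^sup>2 - (r (f y1))\<^sup>2" by (simp add: Q_def r_sq)
    also have "\<dots> = (z y1 - r (f y1)) * (z y1 + r (f y1))" by (simp add: power2_eq_square algebra_simps)
    finally have "\<bar>Q y1 - \<alpha>\<^sup>2\<bar> = \<bar>z y1 - r (f y1)\<bar> * \<bar>z y1 + r (f y1)\<bar>" by (simp only: abs_mult)
    also have "\<dots> \<le> \<rho> * (2 * \<alpha> + 2 + \<rho>)"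
    proof (rule mult_mono[OF zr _ \<rho>0])
      show "\<bar>z y1 + r (f y1)\<bar> \<le> 2 * \<alpha> + 2 + \<rho>" using zr r_le[of "f y1"] r_pos[of "f y1"] by linarith
    qed simp
    finally show ?thesis .
  qed
  have Q\<Delta>: "\<bar>Q x - \<alpha>\<^sup>2\<bar> \<le> \<Delta>" if x: "x \<in> {0..L}" for x
    using Qy[OF x] Qy1 unfolding \<Delta>_def by linarith
  \<comment> \<open>\<open>Q > 0\<close> keeps \<open>z\<close> away from zero, so the positive sign
    at \<open>y1\<close> is inherited at 0 and rules out the root \<open>- \<alpha>\<close>.\<close>
  have z0: "z x \<noteq> 0" if x: "x \<in> {0..L}" for x
  proof
    assume "z x = 0"
    then have "Q x \<le> 0" by (simp add: Q_def)
    then show False using Q\<Delta>[OF x] small(2) by linarith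
  qed
  have "z y1 > 0" using zr r_ge[of "f y1"] small(1) by linarith
  moreover have "continuous_on {0..y1} z"
    by (rule continuous_on_subset[OF DERIV_continuous_on[OF dz]]) (use y1 in auto)
  ultimately have z0p: "z 0 > 0"
    using continuous_nonvanishing_pos[of 0 y1 z] z0 y1(1) by auto
  have "\<bar>(z 0)\<^sup>2 - \<alpha>\<^sup>2\<bar> \<le> \<Delta>" using Q\<Delta>[of 0] L by (simp add: Q_def f_def p0)
  moreover have "(z 0)\<^sup>2 - \<alpha>\<^sup>2 = (z 0 - \<alpha>) * (z 0 + \<alpha>)" by (simp add: power2_eq_square algebra_simps)
  ultimately have "\<bar>z 0 - \<alpha>\<bar> * \<bar>z 0 + \<alpha>\<bar> \<le> \<Delta>" by (simp only: abs_mult)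
  moreover have "\<bar>z 0 - \<alpha>\<bar> * \<alpha> \<le> \<bar>z 0 - \<alpha>\<bar> * \<bar>z 0 + \<alpha>\<bar>" using z0p \<alpha> by (intro mult_left_mono) auto
  ultimately have "\<bar>z 0 - \<alpha>\<bar> * \<alpha> \<le> \<Delta>" by linarith
  then have "\<bar>z 0 - \<alpha>\<bar> \<le> \<Delta> / \<alpha>" using \<alpha> by (simp add: field_simps)
  then show ?thesis by (simp add: z_def m_def)
qed

end

text \<open>The loss is \<open>4 * \<eta> + 2 * \<kappa> * \<epsilon>\<close> times the phase energy
  \<open>J\<close>, so \<open>J\<close> needs an a priori bound first: \<open>G \<le> 0\<close> and
  Young's inequality give \<open>J \<le> 8 * \<kappa>\<^sup>2\<close>. The identity for
  \<open>J\<close> then exposes the defect.\<close>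

lemma (in winding) energy_defect_bound:
  assumes reg: "regular_minimizer \<epsilon> \<sigma> \<kappa> \<eta> v \<phi> M \<phi>'" and min: "is_minimizer \<epsilon> \<delta> \<kappa> v \<phi>"
    and \<sigma>: "\<sigma> = sqrt \<delta> / \<epsilon>" and \<delta>: "\<delta> > 0" and \<kappa>: "\<kappa> = kt * \<sigma>"
    and C: "\<And>t. \<bar>R t - 2 * kt * t\<bar> \<le> C" and \<kappa>e: "\<kappa> * \<epsilon> \<le> 1" and \<theta>: "4 * \<eta> + 2 * \<kappa> * \<epsilon> \<le> 1/2"
  shows "1/8 * integral {0..1} (\<lambda>x. (\<phi>' x - \<sigma> * r (\<phi> x))\<^sup>2) - \<sigma> / 4 * C - \<sigma>\<^sup>2 * \<alpha>\<^sup>2 / 8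
    - (4 * \<eta> + 2 * \<kappa> * \<epsilon>) * (8 * \<kappa>\<^sup>2) \<le> G \<epsilon> \<delta> \<kappa> v \<phi>"
proof -
  have p: "\<sigma> > 0" "\<kappa> > 0" "\<epsilon> > 0" "0 \<le> \<eta>" and p0: "\<phi> 0 = 0" and c': "continuous_on {0..1} \<phi>'"
    and d: "\<And>x. x \<in> {0..1} \<Longrightarrow> (\<phi> has_real_derivative \<phi>' x) (at x within {0..1})"
    using reg by (auto simp: regular_minimizer_def)
  have cp: "continuous_on {0..1} \<phi>" by (rule DERIV_continuous_on[OF d])
  define J where "J = integral {0..1} (\<lambda>x. 1/8 * (\<phi>' x)\<^sup>2 + \<sigma>\<^sup>2/8 * (sin (\<phi> x))\<^sup>2)"
  define \<tau> where "\<tau> = 4 * \<eta> + 2 * \<kappa> * \<epsilon>"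
  have \<tau>: "0 \<le> \<tau>" "\<tau> \<le> 1/2" using p \<theta> by (auto simp: \<tau>_def)
  have "0 \<le> (1 - \<kappa> * \<epsilon>) * well_energy \<epsilon> v" using \<kappa>e well_energy_nonneg by (intro mult_nonneg_nonneg) auto
  moreover have "(1 - \<kappa> * \<epsilon>) * well_energy \<epsilon> v + (1 - \<tau>) * J - \<kappa>/2 * \<phi> 1 \<le> G \<epsilon> \<delta> \<kappa> v \<phi>"
    using regular_minimizer_energy[OF reg min \<sigma> \<delta>] by (simp add: J_def \<tau>_def algebra_simps)
  ultimately have E: "(1 - \<tau>) * J - \<kappa>/2 * \<phi> 1 \<le> G \<epsilon> \<delta> \<kappa> v \<phi>" by linarith
  have h\<phi>: "(\<phi>' has_integral \<phi> 1) {0..1}"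
    using fundamental_theorem_of_calculus[of 0 1 \<phi> \<phi>'] d p0
    by (simp flip: has_real_derivative_iff_has_vector_derivative)
  have hc: "((\<lambda>x::real. 2 * \<kappa>\<^sup>2) has_integral 2 * \<kappa>\<^sup>2) {0..1}"
    using has_integral_const_real[of "2 * \<kappa>\<^sup>2" 0 1] by simp
  \<comment> \<open>The weight \<open>1/4\<close> leaves a positive share of \<open>J\<close>, of
    which the loss \<open>\<tau>\<close> takes at most one half.\<close>
  have "\<kappa>/2 * \<phi> 1 \<le> 1/4 * J + 2 * \<kappa>\<^sup>2"
  proof (rule has_integral_le)
    show "((\<lambda>x. \<kappa>/2 * \<phi>' x) has_integral \<kappa>/2 * \<phi> 1) {0..1}" by (rule has_integral_mult_right[OF h\<phi>])
    show "((\<lambda>x. 1/4 * (1/8 * (\<phi>' x)\<^sup>2 + \<sigma>\<^sup>2/8 * (sin (\<phi> x))\<^sup>2) + 2 * \<kappa>\<^sup>2) has_integral 1/4 * J + 2 * \<kappa>\<^sup>2) {0..1}"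
      unfolding J_def
      by (intro has_integral_add has_integral_mult_right hc integrable_integral integrable_continuous_real continuous_intros cp c')
    fix x :: real
    have "0 \<le> 1/32 * (\<phi>' x - 8 * \<kappa>)\<^sup>2 + 1/4 * (\<sigma>\<^sup>2/8 * (sin (\<phi> x))\<^sup>2)" by simp
    also have "\<dots> = 1/4 * (1/8 * (\<phi>' x)\<^sup>2 + \<sigma>\<^sup>2/8 * (sin (\<phi> x))\<^sup>2) + 2 * \<kappa>\<^sup>2 - \<kappa>/2 * \<phi>' x"
      by (simp add: power2_eq_square field_simps)
    finally show "\<kappa>/2 * \<phi>' x \<le> 1/4 * (1/8 * (\<phi>' x)\<^sup>2 + \<sigma>\<^sup>2/8 * (sin (\<phi> x))\<^sup>2) + 2 * \<kappa>\<^sup>2" by simp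
  qed
  moreover have "G \<epsilon> \<delta> \<kappa> v \<phi> \<le> 0" by (rule minimizer_nonpositive[OF min])
  moreover have J0: "0 \<le> J" unfolding J_def
    by (rule integral_nonneg) (auto intro!: integrable_continuous_real continuous_intros cp c')
  have "\<tau> * J \<le> 1/2 * J" using \<tau> J0 by (intro mult_right_mono) auto
  moreover have "(1 - \<tau>) * J = J - \<tau> * J" by (simp add: algebra_simps)
  ultimately have J8: "J \<le> 8 * \<kappa>\<^sup>2" using E by linarith
  then have "\<tau> * J \<le> \<tau> * (8 * \<kappa>\<^sup>2)" using \<tau> by (intro mult_left_mono) auto
  then have "J - \<kappa>/2 * \<phi> 1 - \<tau> * (8 * \<kappa>\<^sup>2) \<le> G \<epsilon> \<delta> \<kappa> v \<phi>"
    using E \<open>(1 - \<tau>) * J = J - \<tau> * J\<close> by linarith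
  moreover have "J = 1/8 * integral {0..1} (\<lambda>x. (\<phi>' x - \<sigma> * r (\<phi> x))\<^sup>2) + \<sigma>/4 * R (\<phi> 1) - \<sigma>\<^sup>2 * \<alpha>\<^sup>2 / 8"
    unfolding J_def by (rule energy_identity[OF d c' p0])
  moreover have "\<sigma>/4 * R (\<phi> 1) - \<kappa>/2 * \<phi> 1 = \<sigma>/4 * (R (\<phi> 1) - 2 * kt * \<phi> 1)" by (simp add: \<kappa> field_simps)
  moreover have "\<sigma>/4 * (- C) \<le> \<sigma>/4 * (R (\<phi> 1) - 2 * kt * \<phi> 1)"
    using C[of "\<phi> 1"] p by (intro mult_left_mono) linarith+
  ultimately show ?thesis unfolding \<tau>_def by linarith
qed

text \<open>The energy is of order \<open>\<sigma>\<^sup>2\<close>, and the two bounds differ by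
  \<open>O(\<sigma>)\<close> plus a multiple of
  \<open>\<tau> * \<kappa>\<^sup>2 = o(\<sigma>\<^sup>2)\<close>, enough for the leading order. The
  profile asks for more: \<open>initial_slope\<close> works with a defect integral of size
  \<open>O(\<sigma>)\<close>, and for this \<open>\<tau> * \<sigma>\<close> must stay
  bounded.\<close>

lemma supercritical_twist_asymptotics:
  fixes \<delta> \<kappa> :: "real \<Rightarrow> real" and v \<phi> :: "real \<Rightarrow> real \<Rightarrow> real" and kt :: real
  assumes kt: "kt > 1/pi" and \<kappa>: "\<forall>e>0. \<kappa> e = kt * sqrt (\<delta> e) / e"
    and o2: "(\<lambda>e. e\<^sup>2) \<in> o[at_right 0](\<delta>)" and o1: "\<delta> \<in> o[at_right 0](\<lambda>e. e)"
    and fam: "minimizer_family \<delta> \<kappa> v \<phi>"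
  defines "\<alpha> \<equiv> (THE a. 0 < a \<and> a \<le> 2 * kt \<and> integral {0..pi/2} (\<lambda>y. sqrt (a\<^sup>2 + (sin y)\<^sup>2)) = kt * pi)"
  shows "\<exists>C. eventually (\<lambda>e. (SUP x\<in>{0<..<1}. \<bar>v e x - 1\<bar>) \<le> C * sqrt (\<delta> e / e)) (at_right 0)"
    and "asymp_eq (at_right 0) (\<lambda>e. G e (\<delta> e) (\<kappa> e) (v e) (\<phi> e)) (\<lambda>e. - (\<alpha>\<^sup>2 * \<delta> e / (8 * e\<^sup>2)))"
    and "\<exists>\<phi>0. ode_sol \<alpha> \<phi>0"
    and "\<delta> \<in> O[at_right 0](\<lambda>e. e powr (3/2)) \<Longrightarrow> ode_sol \<alpha> \<phi>0 \<Longrightarrow>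
          C1_loc_conv (\<lambda>e x. \<phi> e (e * x / sqrt (\<delta> e))) \<phi>0 (at_right 0)"
proof -
  let ?F = "at_right (0::real)"
  have \<delta>0: "\<forall>e>0. \<delta> e > 0" using fam by (simp add: minimizer_family_def)
  note sl = scaling_limits[OF \<kappa> \<delta>0 o1 o2]
  have "0 < 1 / pi" by simp
  then have kt0: "kt > 0" using kt by linarith
  have \<alpha>p: "0 < \<alpha> \<and> \<alpha> \<le> 2 * kt \<and> integral {0..pi/2} (\<lambda>y. sqrt (\<alpha>\<^sup>2 + (sin y)\<^sup>2)) = kt * pi"
    unfolding \<alpha>_def by (rule theI'[OF winding_parameter_ex1[OF kt]])
  interpret winding \<alpha> kt by unfold_locales (use \<alpha>p in auto)
  obtain C where C: "C > 0" "\<And>t. \<bar>R t - 2 * kt * t\<bar> \<le> C" by (rule R_minus_linear_bounded) blast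
  define \<sigma> where "\<sigma> = (\<lambda>e. sqrt (\<delta> e) / e)"
  define \<eta> where "\<eta> = (\<lambda>e. sqrt (6 * e) * \<kappa> e)"
  define \<tau> where "\<tau> = (\<lambda>e. 4 * \<eta> e + 2 * \<kappa> e * e)"
  obtain M \<phi>' where "eventually (\<lambda>e. regular_minimizer e (sqrt (\<delta> e) / e) (\<kappa> e) (sqrt (6 * e) * \<kappa> e) (v e) (\<phi> e) (M e) (\<phi>' e)) ?F"
    by (rule minimizer_family_regular[OF fam sl(3)])
  then have reg: "eventually (\<lambda>e. regular_minimizer e (\<sigma> e) (\<kappa> e) (\<eta> e) (v e) (\<phi> e) (M e) (\<phi>' e)) ?F"
    by (simp add: \<sigma>_def \<eta>_def)
  have \<eta>0: "(\<eta> \<longlongrightarrow> 0) ?F" using sl(3) by (simp add: \<eta>_def)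
  have \<sigma>t: "filterlim \<sigma> at_top ?F" using sl(2) by (simp add: \<sigma>_def)
  have \<tau>0: "(\<tau> \<longlongrightarrow> 0) ?F"
  proof -
    have "((\<lambda>e. 4 * \<eta> e + 2 * (\<kappa> e * e)) \<longlongrightarrow> 4 * 0 + 2 * 0) ?F"
      by (intro tendsto_add tendsto_mult tendsto_const \<eta>0 sl(4))
    then show ?thesis by (simp add: \<tau>_def mult.assoc)
  qed
  have pos: "eventually (\<lambda>e. e > 0 \<and> \<sigma> e > 0 \<and> \<kappa> e = kt * \<sigma> e \<and> \<delta> e > 0 \<and> is_minimizer e (\<delta> e) (\<kappa> e) (v e) (\<phi> e)) ?F"
    using eventually_at_right_0_pos
    by eventually_elim (use \<delta>0 \<kappa> fam in \<open>auto simp: \<sigma>_def minimizer_family_def\<close>)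
  have \<eta>_eq: "\<eta> e = sqrt 6 * kt * sqrt (\<delta> e / e)" if "e > 0" for e using sl(6)[OF that] by (simp add: \<eta>_def)
  define Dd where "Dd = (\<lambda>e. integral {0..1} (\<lambda>x. (\<phi>' e x - \<sigma> e * r (\<phi> e x))\<^sup>2))"
  have Dd0: "0 \<le> Dd e" for e unfolding Dd_def by (rule integral_square_nonneg)
  have LB: "eventually (\<lambda>e. 1/8 * Dd e - \<sigma> e / 4 * C - (\<sigma> e)\<^sup>2 * \<alpha>\<^sup>2 / 8 - \<tau> e * (8 * (\<kappa> e)\<^sup>2) \<le> G e (\<delta> e) (\<kappa> e) (v e) (\<phi> e)) ?F"
  proof -
    have "eventually (\<lambda>e. \<kappa> e * e < 1) ?F" using order_tendstoD(2)[OF sl(4), of 1] by simp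
    moreover have "eventually (\<lambda>e. \<tau> e < 1/2) ?F" using order_tendstoD(2)[OF \<tau>0, of "1/2"] by simp
    ultimately show ?thesis using reg pos
    proof eventually_elim
      case (elim e)
      show ?case unfolding Dd_def \<tau>_def
        by (rule energy_defect_bound[OF elim(3) _ _ _ _ C(2)]) (use elim in \<open>auto simp: \<sigma>_def \<tau>_def\<close>)
    qed
  qed
  have UB: "eventually (\<lambda>e. G e (\<delta> e) (\<kappa> e) (v e) (\<phi> e) \<le> \<sigma> e / 4 * C - (\<sigma> e)\<^sup>2 * \<alpha>\<^sup>2 / 8) ?F"
    using pos
  proof eventually_elim
    case (elim e)
    show ?case by (rule supercritical_upper_bound[OF _ _ _ _ _ C(2)]) (use elim in \<open>auto simp: \<sigma>_def\<close>)
  qed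
  show "\<exists>C. eventually (\<lambda>e. (SUP x\<in>{0<..<1}. \<bar>v e x - 1\<bar>) \<le> C * sqrt (\<delta> e / e)) ?F"
  proof (intro exI)
    show "eventually (\<lambda>e. (SUP x\<in>{0<..<1}. \<bar>v e x - 1\<bar>) \<le> sqrt 6 * kt * sqrt (\<delta> e / e)) ?F"
      using reg pos
    proof eventually_elim
      case (elim e)
      have "\<bar>v e x - 1\<bar> \<le> \<eta> e" if "x \<in> {0<..<1}" for x using elim(1) that by (simp add: regular_minimizer_def)
      then have "\<bar>SUP x\<in>{0<..<1}. \<bar>v e x - 1\<bar>\<bar> \<le> \<eta> e" by (rule abs_SUP_le)
      then show ?case using elim(2) by (simp add: \<eta>_eq abs_le_iff)
    qed
  qed
  show "asymp_eq ?F (\<lambda>e. G e (\<delta> e) (\<kappa> e) (v e) (\<phi> e)) (\<lambda>e. - (\<alpha>\<^sup>2 * \<delta> e / (8 * e\<^sup>2)))"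
  proof (rule asymp_eqI)
    have inv: "((\<lambda>e. inverse (\<sigma> e)) \<longlongrightarrow> 0) ?F" by (rule tendsto_inverse_0_at_top[OF \<sigma>t])
    have tgt: "- (\<alpha>\<^sup>2 * \<delta> e / (8 * e\<^sup>2)) = - ((\<sigma> e)\<^sup>2 * \<alpha>\<^sup>2 / 8)" if "\<delta> e > 0" for e
      using that by (simp add: \<sigma>_def power_divide mult_ac)
    show "eventually (\<lambda>e. - (\<alpha>\<^sup>2 * \<delta> e / (8 * e\<^sup>2)) \<noteq> 0) ?F" using pos by eventually_elim (use \<alpha> in auto)
    show "((\<lambda>e. G e (\<delta> e) (\<kappa> e) (v e) (\<phi> e) / - (\<alpha>\<^sup>2 * \<delta> e / (8 * e\<^sup>2))) \<longlongrightarrow> 1) ?F"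
    proof (rule tendsto_sandwich)
      let ?lo = "\<lambda>e. 1 - 2 * C / \<alpha>\<^sup>2 * inverse (\<sigma> e)"
      let ?hi = "\<lambda>e. 1 + 2 * C / \<alpha>\<^sup>2 * inverse (\<sigma> e) + 64 * kt\<^sup>2 / \<alpha>\<^sup>2 * \<tau> e"
      have "(?lo \<longlongrightarrow> 1 - 2 * C / \<alpha>\<^sup>2 * 0) ?F" by (intro tendsto_intros inv)
      then show "(?lo \<longlongrightarrow> 1) ?F" by simp
      have "(?hi \<longlongrightarrow> 1 + 2 * C / \<alpha>\<^sup>2 * 0 + 64 * kt\<^sup>2 / \<alpha>\<^sup>2 * 0) ?F" by (intro tendsto_intros inv \<tau>0)
      then show "(?hi \<longlongrightarrow> 1) ?F" by simp
      show "eventually (\<lambda>e. ?lo e \<le> G e (\<delta> e) (\<kappa> e) (v e) (\<phi> e) / - (\<alpha>\<^sup>2 * \<delta> e / (8 * e\<^sup>2))) ?F"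
        using UB pos
      proof eventually_elim
        case (elim e)
        define A where "A = (\<sigma> e)\<^sup>2 * \<alpha>\<^sup>2 / 8"
        have A: "A > 0" using elim(2) \<alpha> by (simp add: A_def)
        have "?lo e * A = - (\<sigma> e / 4 * C - (\<sigma> e)\<^sup>2 * \<alpha>\<^sup>2 / 8)"
          using elim(2) \<alpha> by (simp add: A_def power2_eq_square field_simps)
        also have "\<dots> \<le> - G e (\<delta> e) (\<kappa> e) (v e) (\<phi> e)" using elim(1) by linarith
        finally have "?lo e \<le> - G e (\<delta> e) (\<kappa> e) (v e) (\<phi> e) / A" using A by (simp only: pos_le_divide_eq)
        moreover have "\<delta> e > 0" using elim(2) by simp
        ultimately show ?case unfolding tgt[OF \<open>\<delta> e > 0\<close>] A_def[symmetric] by simp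
      qed
      show "eventually (\<lambda>e. G e (\<delta> e) (\<kappa> e) (v e) (\<phi> e) / - (\<alpha>\<^sup>2 * \<delta> e / (8 * e\<^sup>2)) \<le> ?hi e) ?F"
        using LB pos
      proof eventually_elim
        case (elim e)
        define A where "A = (\<sigma> e)\<^sup>2 * \<alpha>\<^sup>2 / 8"
        have A: "A > 0" using elim(2) \<alpha> by (simp add: A_def)
        have "- G e (\<delta> e) (\<kappa> e) (v e) (\<phi> e) \<le> \<sigma> e / 4 * C + (\<sigma> e)\<^sup>2 * \<alpha>\<^sup>2 / 8 + \<tau> e * (8 * (\<kappa> e)\<^sup>2)"
          using elim(1) Dd0[of e] by linarith
        also have "\<dots> = ?hi e * A"
          using elim(2) \<alpha> by (simp add: A_def power2_eq_square field_simps)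
        finally have "- G e (\<delta> e) (\<kappa> e) (v e) (\<phi> e) / A \<le> ?hi e" using A by (simp only: pos_divide_le_eq)
        moreover have "\<delta> e > 0" using elim(2) by simp
        ultimately show ?case unfolding tgt[OF \<open>\<delta> e > 0\<close>] A_def[symmetric] by simp
      qed
    qed
  qed
  show "\<exists>\<phi>0. ode_sol \<alpha> \<phi>0" using profile_exists profile_ode by metis
  show "C1_loc_conv (\<lambda>e x. \<phi> e (e * x / sqrt (\<delta> e))) \<phi>0 ?F"
    if O: "\<delta> \<in> O[at_right 0](\<lambda>e. e powr (3/2))" and sol: "ode_sol \<alpha> \<phi>0"
  proof -
    obtain c where c: "c > 0" "eventually (\<lambda>e. norm (\<delta> e) \<le> c * norm (e powr (3/2))) ?F"
      using landau_o.bigE[OF O] by blast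
    \<comment> \<open>Eight times the gap between the energy bounds, divided by
      \<open>\<sigma>\<close>; the bracket bounds \<open>\<tau> * \<sigma>\<close>.\<close>
    define CD where "CD = 4 * C + 64 * kt\<^sup>2 * (4 * (sqrt 6 * kt * c) + 2 * kt)"
    have CD: "CD > 0" unfolding CD_def using C(1) kt0 c(1) by (intro add_pos_nonneg) auto
    have DdB: "eventually (\<lambda>e. Dd e \<le> CD * \<sigma> e) ?F"
    proof -
      have "eventually (\<lambda>e. \<delta> e / e < 1) ?F" using order_tendstoD(2)[OF smalloD_tendsto[OF o1], of 1] by simp
      then show ?thesis using c(2) LB UB pos
      proof eventually_elim
        case (elim e)
        have e: "e > 0" "\<sigma> e > 0" "\<delta> e > 0" "\<kappa> e = kt * \<sigma> e" using elim(5) by auto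
        have e32: "e powr (3/2) = e * sqrt e"
        proof -
          have "e powr (3/2) = e powr (1 + 1/2)" by simp
          also have "\<dots> = e * sqrt e" using e by (simp only: powr_add) (simp add: powr_half_sqrt)
          finally show ?thesis .
        qed
        have "\<delta> e \<le> c * (e * sqrt e)" using elim(2) e by (simp add: e32)
        then have d32: "\<delta> e / (e * sqrt e) \<le> c" using e by (simp add: pos_divide_le_eq)
        \<comment> \<open>This is where \<open>\<delta> = O(\<epsilon>^(3/2))\<close> enters:
          \<open>\<eta> * \<sigma>\<close> is a multiple of
          \<open>\<delta> / \<epsilon>^(3/2)\<close>.\<close>
        have "\<eta> e * \<sigma> e = sqrt 6 * kt * (\<delta> e / (e * sqrt e))"
          using e by (simp add: \<eta>_eq[OF e(1)] \<sigma>_def real_sqrt_divide mult.assoc)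
        also have "\<dots> \<le> sqrt 6 * kt * c" using d32 kt0 by (intro mult_left_mono) auto
        finally have 1: "\<eta> e * \<sigma> e \<le> sqrt 6 * kt * c" .
        have "\<kappa> e * e * \<sigma> e = kt * (\<delta> e / e)" unfolding e(4) using e(1,3) by (simp add: \<sigma>_def mult.assoc)
        also have "\<dots> \<le> kt * 1" using elim(1) kt0 by (intro mult_left_mono) auto
        finally have 2: "\<kappa> e * e * \<sigma> e \<le> kt" by simp
        have "\<tau> e * \<sigma> e = 4 * (\<eta> e * \<sigma> e) + 2 * (\<kappa> e * e * \<sigma> e)" by (simp add: \<tau>_def algebra_simps)
        then have 3: "\<tau> e * \<sigma> e \<le> 4 * (sqrt 6 * kt * c) + 2 * kt" using 1 2 by linarith
        have "1/8 * Dd e \<le> \<sigma> e / 2 * C + \<tau> e * (8 * (\<kappa> e)\<^sup>2)" using elim(3,4) by linarith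
        then have "Dd e \<le> \<sigma> e * (4 * C) + 64 * kt\<^sup>2 * (\<tau> e * \<sigma> e) * \<sigma> e"
          unfolding e(4) by (simp add: power2_eq_square algebra_simps)
        also have "64 * kt\<^sup>2 * (\<tau> e * \<sigma> e) * \<sigma> e \<le> 64 * kt\<^sup>2 * (4 * (sqrt 6 * kt * c) + 2 * kt) * \<sigma> e"
          using 3 e by (intro mult_right_mono mult_left_mono) auto
        finally show ?case by (simp add: CD_def algebra_simps)
      qed
    qed
    define z0 where "z0 = (\<lambda>e. 2 * kt - M e 0 / \<sigma> e)"
    have z0\<alpha>: "(z0 \<longlongrightarrow> \<alpha>) ?F"
    proof (rule tendstoI)
      fix \<mu> :: real assume \<mu>: "\<mu> > 0"
      \<comment> \<open>\<open>b\<close> merges two demands on \<open>\<Delta>\<close>: below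
        \<open>\<alpha>\<^sup>2\<close>, as \<open>initial_slope\<close> requires, and below
        \<open>\<mu> * \<alpha>\<close> for the target accuracy. \<open>q\<close> is then small
        enough for \<open>q * (2 * \<alpha> + 2 + q) < b\<close>, and \<open>L\<close> makes
        \<open>q\<^sup>2 * L\<close> equal to \<open>CD\<close>. With these fixed,
        \<open>\<eta>\<close> tends to 0.\<close>
      define b where "b = min (\<alpha>\<^sup>2) (\<mu> * \<alpha>)"
      have b: "b > 0" using \<alpha> \<mu> by (simp add: b_def)
      define q where "q = min (\<alpha> / 2) (b / (2 * (3 * \<alpha> + 2)))"
      have "q > 0" using \<alpha> b unfolding q_def by (intro min_less_iff_conj[THEN iffD2] conjI divide_pos_pos) auto
      moreover have q2: "q \<le> \<alpha> / 2" "q \<le> b / (2 * (3 * \<alpha> + 2))" unfolding q_def by (rule min.cobounded1, rule min.cobounded2)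
      moreover have "\<alpha> / 2 < \<alpha>" using \<alpha> by simp
      ultimately have q: "q > 0" "q < \<alpha>" by linarith+
      have qb: "q * (2 * \<alpha> + 2 + q) < b"
      proof -
        have "q * (2 * \<alpha> + 2 + q) \<le> b / (2 * (3 * \<alpha> + 2)) * (3 * \<alpha> + 2)"
          by (rule mult_mono) (use q q2 \<alpha> b in auto)
        also have "\<dots> = b / 2" using \<alpha> by (simp add: field_simps)
        finally show ?thesis using b by linarith
      qed
      define L where "L = CD / q\<^sup>2"
      have L: "L > 0" "q\<^sup>2 * L = CD" using CD q by (auto simp: L_def)
      define B where "B = 3 * (2 * kt + \<alpha> + 1 + q) + 16 * L"
      define \<rho> where "\<rho> = (\<lambda>e. q + 10 * \<eta> e * B)"
      define \<Delta> where "\<Delta> = (\<lambda>e. \<rho> e * (2 * \<alpha> + 2 + \<rho> e) + 40 * \<eta> e * (2 * kt + B) * L)"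
      have "(\<rho> \<longlongrightarrow> q + 10 * 0 * B) ?F" unfolding \<rho>_def by (intro tendsto_intros \<eta>0)
      then have \<rho>q: "(\<rho> \<longlongrightarrow> q) ?F" by simp
      have "(\<Delta> \<longlongrightarrow> q * (2 * \<alpha> + 2 + q) + 40 * 0 * (2 * kt + B) * L) ?F"
        unfolding \<Delta>_def by (intro tendsto_intros \<eta>0 \<rho>q)
      then have \<Delta>q: "(\<Delta> \<longlongrightarrow> q * (2 * \<alpha> + 2 + q)) ?F" by simp
      have "eventually (\<lambda>e. L \<le> \<sigma> e) ?F" using \<sigma>t by (simp add: filterlim_at_top)
      then show "eventually (\<lambda>e. dist (z0 e) \<alpha> < \<mu>) ?F"
        using order_tendstoD(2)[OF \<rho>q q(2)] order_tendstoD(2)[OF \<Delta>q qb] DdB reg pos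
      proof eventually_elim
        case (elim e)
        have "\<bar>2 * kt - M e 0 / \<sigma> e - \<alpha>\<bar> \<le> \<Delta> e / \<alpha>"
          unfolding \<Delta>_def \<rho>_def B_def
        proof (rule initial_slope[OF elim(5) _ _ L(1) elim(1) _ q(1)])
          show "\<kappa> e = kt * \<sigma> e" using elim(6) by simp
          show "0 \<le> kt" using kt0 by simp
          show "integral {0..1} (\<lambda>x. (\<phi>' e x - \<sigma> e * r (\<phi> e x))\<^sup>2) \<le> q\<^sup>2 * L * \<sigma> e"
            unfolding L(2) using elim(4) by (simp add: Dd_def)
        qed (use elim(2,3) in \<open>auto simp: \<rho>_def \<Delta>_def B_def b_def\<close>)
        also have "\<dots> < \<mu>" using elim(3) \<alpha> by (simp add: b_def pos_divide_less_eq)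
        finally show ?case by (simp add: z0_def dist_real_def)
      qed
    qed
    obtain f' where f': "\<phi>0 0 = 0" "f' 0 = \<alpha>"
      "\<And>x. x \<ge> 0 \<Longrightarrow> (\<phi>0 has_real_derivative f' x) (at x within {0..})"
      "\<And>x. x \<ge> 0 \<Longrightarrow> (f' has_real_derivative sin (\<phi>0 x) * cos (\<phi>0 x)) (at x within {0..})"
      using sol by (auto simp: ode_sol_def)
    define m where "m = (\<lambda>e x. M e (x / \<sigma> e) / \<sigma> e)"
    define w where "w = (\<lambda>e x. v e (x / \<sigma> e))"
    define sc where "sc = (\<lambda>e x. sin (\<phi> e (x / \<sigma> e)) * cos (\<phi> e (x / \<sigma> e)))"
    have "C1_loc_conv (\<lambda>e x. \<phi> e (x / \<sigma> e)) \<phi>0 ?F"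
    proof (rule C1_loc_conv_by_Gronwall[OF f'(3,4), where z = "\<lambda>e x. 2 * kt - m e x" and z' = "\<lambda>e x. (w e x)^4 * sc e x"
          and \<psi>' = "\<lambda>e x. 2 * kt - m e x / (w e x)\<^sup>2"])
      have "eventually (\<lambda>e. \<phi>0 0 = \<phi> e (0 / \<sigma> e)) ?F"
        using reg by eventually_elim (simp add: regular_minimizer_def f'(1))
      then show "((\<lambda>e. \<phi> e (0 / \<sigma> e)) \<longlongrightarrow> \<phi>0 0) ?F" by (rule Lim_transform_eventually[OF tendsto_const])
      show "((\<lambda>e. 2 * kt - m e 0) \<longlongrightarrow> f' 0) ?F" using z0\<alpha> by (simp add: z0_def m_def f'(2))
    next
      fix T \<rho> :: real assume T: "T > 0" and \<rho>: "\<rho> > 0"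
      \<comment> \<open>Bounds the rescaled flux on {0..T}: its initial value once the slope is
        within 1 of \<open>\<alpha>\<close>, plus growth at rate at most 16.\<close>
      define B where "B = 2 * kt + \<alpha> + 1 + 16 * T"
      have B: "B > 0" using kt0 \<alpha> T by (simp add: B_def)
      define \<rho>' where "\<rho>' = \<rho> / (10 * (B + 1))"
      have \<rho>': "\<rho>' > 0" using \<rho> B by (simp add: \<rho>'_def)
      have "eventually (\<lambda>e. dist (z0 e) \<alpha> < 1) ?F" by (rule tendstoD[OF z0\<alpha>]) simp
      moreover have "eventually (\<lambda>e. T \<le> \<sigma> e) ?F" using \<sigma>t by (simp add: filterlim_at_top)
      ultimately show "\<forall>\<^sub>F e in ?F. \<forall>x\<in>{0..T}.
             ((\<lambda>x. \<phi> e (x / \<sigma> e)) has_real_derivative 2 * kt - m e x / (w e x)\<^sup>2) (at x within {0..T}) \<and>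
             ((\<lambda>x. 2 * kt - m e x) has_real_derivative w e x ^ 4 * sc e x) (at x within {0..T}) \<and>
             \<bar>2 * kt - m e x / (w e x)\<^sup>2 - (2 * kt - m e x)\<bar> \<le> \<rho> \<and>
             \<bar>w e x ^ 4 * sc e x - sin (\<phi>0 x) * cos (\<phi>0 x)\<bar> \<le> \<bar>\<phi> e (x / \<sigma> e) - \<phi>0 x\<bar> + \<rho>"
        using order_tendstoD(2)[OF \<eta>0 \<rho>'] reg pos
      proof eventually_elim
        case (elim e)
        have \<eta>h: "0 \<le> \<eta> e" "\<eta> e \<le> 1/2" using elim(4) by (auto simp: regular_minimizer_def)
        have \<kappa>\<sigma>: "\<kappa> e / \<sigma> e = kt" using elim(5) by simp
        note re = rescaled_left_end[OF elim(4) elim(2), unfolded \<kappa>\<sigma>]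
        have wb: "\<bar>w e x - 1\<bar> \<le> \<eta> e" if "x \<in> {0..T}" for x using re(2)[OF that] by (simp add: w_def)
        note nb = near_one_bounds[OF wb \<eta>h(2)]
        have sc1: "\<bar>sc e x\<bar> \<le> 1" for x by (simp add: sc_def abs_sin_cos_le_1)
        have dm: "(m e has_real_derivative - ((w e x)^4 * sc e x)) (at x within {0..T})" if "x \<in> {0..T}" for x
          using re(4)[OF that] by (simp add: m_def w_def sc_def)
        have m0: "\<bar>m e 0\<bar> \<le> 2 * kt + \<alpha> + 1"
          using elim(1) kt0 \<alpha> by (auto simp: z0_def m_def dist_real_def abs_le_iff abs_less_iff)
        have mB: "\<bar>m e x\<bar> \<le> B" if x: "x \<in> {0..T}" for x
        proof -
          have "\<bar>m e x - m e 0\<bar> \<le> 16 * T"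
          proof (rule bounded_derivative_growth[OF dm _ x])
            fix y assume y: "y \<in> {0..T}"
            have "\<bar>(w e y)^4 * sc e y\<bar> \<le> 16 * 1" unfolding abs_mult using nb(3)[OF y] sc1 by (intro mult_mono) auto
            then show "\<bar>- ((w e y)^4 * sc e y)\<bar> \<le> 16" by simp
          qed (use T in auto)
          then show ?thesis using m0 unfolding B_def by linarith
        qed
        have t: "10 * \<eta> e * (B + 1) \<le> \<rho>"
        proof -
          have "\<eta> e * (10 * (B + 1)) \<le> \<rho>' * (10 * (B + 1))" using elim(3) B by (intro mult_right_mono) auto
          also have "\<dots> = \<rho>" using B by (simp add: \<rho>'_def)
          finally show ?thesis by (simp add: algebra_simps)
        qed
        have t': "10 * \<eta> e * B \<le> \<rho>" "10 * \<eta> e \<le> \<rho>"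
        proof -
          have "0 \<le> \<eta> e * B" using \<eta>h B by simp
          then show "10 * \<eta> e * B \<le> \<rho>" "10 * \<eta> e \<le> \<rho>" using t \<eta>h by (simp_all add: algebra_simps)
        qed
        show ?case
        proof (intro ballI conjI)
          fix x assume x: "x \<in> {0..T}"
          show "((\<lambda>x. \<phi> e (x / \<sigma> e)) has_real_derivative 2 * kt - m e x / (w e x)\<^sup>2) (at x within {0..T})"
            using re(3)[OF x] by (simp add: m_def w_def)
          show "((\<lambda>x. 2 * kt - m e x) has_real_derivative w e x ^ 4 * sc e x) (at x within {0..T})"
            using DERIV_diff[OF DERIV_const dm[OF x], of "2 * kt"] by simp
          have "2 * kt - m e x / (w e x)\<^sup>2 - (2 * kt - m e x) = - (m e x * (1 / (w e x)\<^sup>2 - 1))" by (simp add: algebra_simps)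
          then have "\<bar>2 * kt - m e x / (w e x)\<^sup>2 - (2 * kt - m e x)\<bar> = \<bar>m e x\<bar> * \<bar>1 / (w e x)\<^sup>2 - 1\<bar>"
            by (simp only: abs_minus_cancel abs_mult)
          also have "\<dots> \<le> B * (10 * \<eta> e)" using mB[OF x] nb(1)[OF x] B by (intro mult_mono) auto
          also have "\<dots> \<le> \<rho>" using t'(1) by (simp add: mult_ac)
          finally show "\<bar>2 * kt - m e x / (w e x)\<^sup>2 - (2 * kt - m e x)\<bar> \<le> \<rho>" .
          have "w e x ^ 4 * sc e x - sc e x = (w e x ^ 4 - 1) * sc e x" by (simp add: algebra_simps)
          then have "\<bar>w e x ^ 4 * sc e x - sc e x\<bar> = \<bar>w e x ^ 4 - 1\<bar> * \<bar>sc e x\<bar>" by (simp only: abs_mult)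
          also have "\<dots> \<le> 10 * \<eta> e * 1" using nb(2)[OF x] sc1 \<eta>h by (intro mult_mono) auto
          finally have "\<bar>w e x ^ 4 * sc e x - sc e x\<bar> \<le> \<rho>" using t'(2) by linarith
          moreover have "\<bar>sc e x - sin (\<phi>0 x) * cos (\<phi>0 x)\<bar> \<le> \<bar>\<phi> e (x / \<sigma> e) - \<phi>0 x\<bar>"
            unfolding sc_def by (rule sin_cos_Lipschitz)
          ultimately show "\<bar>w e x ^ 4 * sc e x - sin (\<phi>0 x) * cos (\<phi>0 x)\<bar> \<le> \<bar>\<phi> e (x / \<sigma> e) - \<phi>0 x\<bar> + \<rho>"
            by linarith
        qed
      qed
    qed
    then show ?thesis by (simp add: \<sigma>_def mult.commute)
  qed
qed

theorem theorem3:
  shows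
  \<comment> \<open>(a)\<close>
  "(\<exists>C>0. \<forall>(d::real) \<kappa> v \<phi>.
      d > 0 \<and> (\<exists>K. \<forall>e>0. \<kappa> e \<le> K) \<and> minimizer_family (\<lambda>_. d) \<kappa> v \<phi> \<longrightarrow>
        (\<lambda>e. SUP x\<in>{0<..<1}. \<bar>v e x - 1\<bar>) \<in> o[at_right 0](\<lambda>e. e) \<and>
        asymp_eq (at_right 0) (\<lambda>e. \<phi> e 1) (\<lambda>e. 2 * \<kappa> e * e / sqrt d) \<and>
        eventually (\<lambda>e. \<forall>x\<in>good_set (v e). \<bar>\<phi> e x\<bar> \<le> C * \<kappa> e * e / sqrt d) (at_right 0) \<and>
        asymp_eq (at_right 0) (\<lambda>e. G e d (\<kappa> e) (v e) (\<phi> e))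
                 (\<lambda>e. - ((\<kappa> e)\<^sup>2 * e / (2 * sqrt d))) \<and>
        C1_loc_conv (\<lambda>e x. sqrt d / (2 * \<kappa> e * e) * \<phi> e (1 - e * x / sqrt d))
                    (\<lambda>x. exp (- x)) (at_right 0))
   \<and>
  \<comment> \<open>(b)\<close>
   (\<forall>\<delta> \<kappa> v \<phi> (kt::real).
      0 < kt \<and> kt < 1/pi \<and> (\<forall>e>0. \<kappa> e = kt * sqrt (\<delta> e) / e) \<and>
      \<delta> \<in> o[at_right 0](\<lambda>e. e) \<and> (\<lambda>e. e\<^sup>2) \<in> o[at_right 0](\<delta>) \<and>
      minimizer_family \<delta> \<kappa> v \<phi> \<longrightarrow>
        (\<lambda>e. SUP x\<in>{0<..<1}. \<bar>1 - v e x\<bar>) \<in> o[at_right 0](\<lambda>e. \<delta> e powr (1/4)) \<and>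
        asymp_eq (at_right 0) (\<lambda>e. \<phi> e 1) (\<lambda>e. arcsin (2 * kt)) \<and>
        asymp_eq (at_right 0) (\<lambda>e. G e (\<delta> e) (\<kappa> e) (v e) (\<phi> e))
          (\<lambda>e. sqrt (\<delta> e) / e *
                ((1 - sqrt (1 - 4 * kt\<^sup>2)) / 4 - kt / 2 * arcsin (2 * kt))) \<and>
        (\<exists>h. (h \<longlongrightarrow> 0) (at_right 0) \<and>
           eventually (\<lambda>e. \<forall>x\<in>good_set (v e).
              \<bar>\<phi> e x\<bar> \<le> arcsin (2 * kt) * (1 + h e)) (at_right 0)) \<and>
        C1_loc_conv (\<lambda>e x. \<phi> e (1 - e * x / sqrt (\<delta> e)))
          (\<lambda>x. 2 * arctan (tan (arcsin (2 * kt) / 2) * exp (- x))) (at_right 0))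
   \<and>
  \<comment> \<open>(c)\<close>
   (\<forall>\<delta> \<kappa> v \<phi> (kt::real).
      kt > 1/pi \<and> (\<forall>e>0. \<kappa> e = kt * sqrt (\<delta> e) / e) \<and>
      (\<lambda>e. e\<^sup>2) \<in> o[at_right 0](\<delta>) \<and> \<delta> \<in> o[at_right 0](\<lambda>e. e) \<and>
      minimizer_family \<delta> \<kappa> v \<phi> \<longrightarrow>
        (let \<alpha> = (THE a. 0 < a \<and> a \<le> 2 * kt \<and>
                      integral {0..pi/2} (\<lambda>y. sqrt (a\<^sup>2 + (sin y)\<^sup>2)) = kt * pi) in
          (\<exists>C. eventually (\<lambda>e. (SUP x\<in>{0<..<1}. \<bar>v e x - 1\<bar>) \<le> C * sqrt (\<delta> e / e)) (at_right 0)) \<and>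
          asymp_eq (at_right 0) (\<lambda>e. G e (\<delta> e) (\<kappa> e) (v e) (\<phi> e))
            (\<lambda>e. - (\<alpha>\<^sup>2 * \<delta> e / (8 * e\<^sup>2))) \<and>
          (\<delta> \<in> O[at_right 0](\<lambda>e. e powr (3/2)) \<longrightarrow>
             (\<exists>\<phi>0. ode_sol \<alpha> \<phi>0) \<and>
             (\<forall>\<phi>0. ode_sol \<alpha> \<phi>0 \<longrightarrow>
                C1_loc_conv (\<lambda>e x. \<phi> e (e * x / sqrt (\<delta> e))) \<phi>0 (at_right 0)))))"
proof (rule conjI[OF _ conjI], goal_cases)
  case 1
  \<comment> \<open>The witness 14 depends neither on \<open>d\<close> nor on the bound for
    \<open>\<kappa>\<close>, so it can precede the universal quantifiers.\<close>
  show ?case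
    by (intro exI[of _ "14::real"] conjI allI impI; (elim conjE exE)?;
        (rule small_twist_asymptotics; assumption)?) simp
next
  case 2
  show ?case
    by (intro conjI allI impI; elim conjE; rule subcritical_twist_asymptotics; assumption)
next
  case 3
  show ?case
    unfolding Let_def
    by (intro conjI allI impI; elim conjE; rule supercritical_twist_asymptotics; assumption)
qed

end
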